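(* Let $s,d\in\mathbb{N}$ with $s>d/2$, let $B\in\mathbb{R}^{d\times d}$ be a Frolov matrix, let $\psi:\mathbb{R}\to\mathbb{R}$ be an infinitely differentiable function such that $\psi|_{(-\infty,0)}=0$, $\psi|_{(1,\infty)}=1$ and $\psi|_{(0,1)}:(0,1)\to(0,1)$ is a diffeomorphism, and let $U$ and $V$ be independent random vectors uniformly distributed in $[1,2^{1/d}]^d$ and $[0,1]^d$, respectively. There is some $c>0$ (which may depend on $s$, $d$, $B$ and $\psi$) such that for every $n\in\mathbb{N}$ and every $f\in H^{s}([0,1]^d)$ \[ \left(\mathbb{E}\left|\widetilde{Q}_{n^{1/d}\hat{U}B}^V(f)-I_d(f)\right|^2\right)^{1/2} \leq c\, n^{-s/d-1/2}\, \Vert f\Vert_{H^{s}([0,1]^d)} \] and \[ \sup_{(u,v)\in[1,2^{1/d}]^d\times[0,1]^d}\left|\widetilde{Q}_{n^{1/d}\hat{u}B}^v(f)-I_d(f)\right| \leq c\, n^{-s/d}\, \Vert f\Vert_{H^{s}([0,1]^d)}. \]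
   Context: Notation: $\mathbb{N}=\{1,2,\dots\}$; for $f:[0,1]^d\to\mathbb{R}$ integrable, $I_d(f)=\int_{[0,1]^d} f(x)\,dx$. For $u\in\mathbb{R}^d$, $\hat{u}=\mathrm{diag}(u_1,\dots,u_d)$. Put $\Psi:\mathbb{R}^d\to\mathbb{R}^d$, $\Psi(x)=(\psi(x_1),\dots,\psi(x_d))^\top$, and $|D\Psi(x)|=\det D\Psi(x)=\prod_{i=1}^d\psi'(x_i)$. For an invertible matrix $S\in\mathbb{R}^{d\times d}$, $v\in\mathbb{R}^d$ and $f:[0,1]^d\to\mathbb{R}$, the transformed quadrature rule is \[\widetilde{Q}_S^v(f)=\frac{1}{|\det S|}\sum_{m\in\mathbb{Z}^d} f\left(\Psi\left(S^{-\top}(m+v)\right)\right)\cdot\left|D\Psi\left(S^{-\top}(m+v)\right)\right|,\] where $S^{-\top}$ is the transpose of the inverse of $S$ (terms with $S^{-\top}(m+v)\notin[0,1]^d$ vanish). The expectation is with respect to $(U,V)$. A matrix $B\in\mathbb{R}^{d\times d}$ is a Frolov matrix if: (a) $B$ is invertible; (b) $\left|\prod_{j=1}^d (Bm)_j\right|\geq 1$ for every $m\in\mathbb{Z}^d\setminus\{0\}$; (c) for all $x,y\in\mathbb{R}^d$ the box $[x,y]=\{z\in\mathbb{R}^d : z_j \text{ lies between } x_j \text{ and } y_j \text{ (inclusive) for } j=1,\dots,d\}$ with volume $V_0=\prod_{j=1}^d|x_j-y_j|$ contains at most $V_0+1$ lattice points $Bm$, $m\in\mathbb{Z}^d$. $H^{s}([0,1]^d)$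 is the space of real-valued $f\in L^2([0,1]^d)$ whose weak derivatives $D^\alpha f$ exist and lie in $L^2([0,1]^d)$ for all $\alpha\in\mathbb{N}_0^d$ with $|\alpha|=\sum_j\alpha_j\leq s$, with norm $\Vert f\Vert_{H^{s}([0,1]^d)}=\left(\sum_{|\alpha|\leq s}\Vert D^\alpha f\Vert_{L^2([0,1]^d)}^2\right)^{1/2}$; since $s>d/2$, its elements are identified with their continuous representatives. *)

theory Defs
  imports "HOL-Analysis.Analysis" "HOL-Probability.Probability"
begin

section \<open>Smooth functions\<close>

text \<open>Meaningful for open \<open>A\<close>: the derivatives are derivatives on a neighbourhood.\<close>

definition smooth_real_on :: "real set \<Rightarrow> (real \<Rightarrow> real) \<Rightarrow> bool" where
  "smooth_real_on A h \<longleftrightarrow> (\<forall>k. \<forall>x\<in>A. (deriv ^^ k) h differentiable (at x))"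

definition diffeomorphism_real :: "real set \<Rightarrow> real set \<Rightarrow> (real \<Rightarrow> real) \<Rightarrow> bool" where
  "diffeomorphism_real A A' h \<longleftrightarrow>
     bij_betw h A A' \<and> smooth_real_on A h \<and> smooth_real_on A' (inv_into A h)"

definition partial_deriv :: "'n::finite \<Rightarrow> (real^'n \<Rightarrow> real) \<Rightarrow> (real^'n \<Rightarrow> real)" where
  "partial_deriv i \<phi> = (\<lambda>x. frechet_derivative \<phi> (at x) (axis i 1))"

text \<open>All iterated partial derivatives are (Frechet) differentiable, hence also continuous.\<close>

definition smooth :: "(real^'n::finite \<Rightarrow> real) \<Rightarrow> bool" where
  "smooth \<phi> \<longleftrightarrow> (\<forall>is x. foldr partial_deriv is \<phi> differentiable (at x))"

section \<open>The Sobolev space \<open>H\<^sup>s([0,1]\<^sup>d)\<close>\<close>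

abbreviation unit_cube :: "(real^'n::finite) set" where
  "unit_cube \<equiv> cbox (vec 0) (vec 1)"

definition cube_integral :: "(real^'n::finite \<Rightarrow> real) \<Rightarrow> real" where
  "cube_integral f = integral\<^sup>L (lebesgue_on unit_cube) f"

definition square_integrable :: "(real^'n::finite \<Rightarrow> real) \<Rightarrow> bool" where
  "square_integrable f \<longleftrightarrow>
     f \<in> borel_measurable (lebesgue_on unit_cube) \<and>
     integrable (lebesgue_on unit_cube) (\<lambda>x. (f x)\<^sup>2)"

definition L2_norm_cube :: "(real^'n::finite \<Rightarrow> real) \<Rightarrow> real" where
  "L2_norm_cube f = sqrt (cube_integral (\<lambda>x. (f x)\<^sup>2))"

text \<open>Functions in \<open>C\<^sub>c\<^sup>\<infinity>((0,1)\<^sup>d)\<close>, extended by zero to the whole space.\<close>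

definition test_function :: "(real^'n::finite \<Rightarrow> real) \<Rightarrow> bool" where
  "test_function \<phi> \<longleftrightarrow> smooth \<phi> \<and>
     (\<exists>K. compact K \<and> K \<subseteq> box (vec 0) (vec 1) \<and> (\<forall>x. x \<notin> K \<longrightarrow> \<phi> x = 0))"

definition multi_order :: "('n::finite \<Rightarrow> nat) \<Rightarrow> nat" where
  "multi_order \<alpha> = (\<Sum>j\<in>UNIV. \<alpha> j)"

text \<open>
  The classical derivative \<open>D\<^sup>\<alpha>\<close>. The index type carries no order, so some order of
  differentiation is chosen; for smooth functions the choice is immaterial by Schwarz's theorem.
\<close>

definition multi_deriv ::
    "('n::finite \<Rightarrow> nat) \<Rightarrow> (real^'n \<Rightarrow> real) \<Rightarrow> (real^'n \<Rightarrow> real)" where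
  "multi_deriv \<alpha> \<phi> = foldr partial_deriv (SOME is. \<forall>j. count_list is j = \<alpha> j) \<phi>"

definition L2_weak_deriv ::
    "('n::finite \<Rightarrow> nat) \<Rightarrow> (real^'n \<Rightarrow> real) \<Rightarrow> (real^'n \<Rightarrow> real) \<Rightarrow> bool" where
  "L2_weak_deriv \<alpha> f g \<longleftrightarrow> square_integrable g \<and>
     (\<forall>\<phi>. test_function \<phi> \<longrightarrow>
        cube_integral (\<lambda>x. f x * multi_deriv \<alpha> \<phi> x) =
        (-1) ^ multi_order \<alpha> * cube_integral (\<lambda>x. g x * \<phi> x))"

text \<open>
  Functions on the cube are represented by total functions of which only the values on the cube
  matter. Every class in \<open>H\<^sup>s\<close> is represented by its continuous representative (\<open>s > d/2\<close>).
\<close>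

definition sobolev :: "nat \<Rightarrow> (real^'n::finite \<Rightarrow> real) set" where
  "sobolev s = {f. continuous_on unit_cube f \<and> square_integrable f \<and>
     (\<forall>\<alpha>. multi_order \<alpha> \<le> s \<longrightarrow> (\<exists>g. L2_weak_deriv \<alpha> f g))}"

text \<open>Weak derivatives are unique up to null sets, so the norm does not depend on the choice.\<close>

definition sobolev_norm :: "nat \<Rightarrow> (real^'n::finite \<Rightarrow> real) \<Rightarrow> real" where
  "sobolev_norm s f =
     sqrt (\<Sum>\<alpha> | multi_order \<alpha> \<le> s. (L2_norm_cube (SOME g. L2_weak_deriv \<alpha> f g))\<^sup>2)"

lemma finite_multi_order_le: "finite {\<alpha> :: 'n::finite \<Rightarrow> nat. multi_order \<alpha> \<le> s}"
proof (rule finite_subset)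
  show "{\<alpha> :: 'n \<Rightarrow> nat. multi_order \<alpha> \<le> s} \<subseteq> PiE UNIV (\<lambda>_. {..s})"
  proof
    fix \<alpha> :: "'n \<Rightarrow> nat" assume "\<alpha> \<in> {\<alpha>. multi_order \<alpha> \<le> s}"
    then have *: "(\<Sum>j\<in>UNIV. \<alpha> j) \<le> s" by (simp add: multi_order_def)
    have "\<alpha> j \<le> s" for j
      using order_trans[OF member_le_sum[of j UNIV \<alpha>] *] by simp
    then show "\<alpha> \<in> PiE UNIV (\<lambda>_. {..s})" by auto
  qed
  show "finite (PiE (UNIV :: 'n set) (\<lambda>_. {..s}))" by (intro finite_PiE) auto
qed

section \<open>Frolov matrices and the transformed quadrature rule\<close>

definition real_vec :: "int^'n \<Rightarrow> real^'n" where
  "real_vec m = (\<chi> j. real_of_int (m $ j))"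

definition diag_matrix :: "real^'n \<Rightarrow> real^'n^'n" where
  "diag_matrix u = (\<chi> i j. if i = j then u $ i else 0)"

definition frolov_matrix :: "real^'n^'n::finite \<Rightarrow> bool" where
  "frolov_matrix B \<longleftrightarrow>
     invertible B \<and>
     (\<forall>m. m \<noteq> 0 \<longrightarrow> \<bar>\<Prod>j\<in>UNIV. (B *v real_vec m) $ j\<bar> \<ge> 1) \<and>
     (\<forall>x y. let P = {z \<in> range (\<lambda>m. B *v real_vec m).
                       \<forall>j. min (x $ j) (y $ j) \<le> z $ j \<and> z $ j \<le> max (x $ j) (y $ j)}
            in finite P \<and> real (card P) \<le> (\<Prod>j\<in>UNIV. \<bar>x $ j - y $ j\<bar>) + 1)"

definition Psi :: "(real \<Rightarrow> real) \<Rightarrow> real^'n \<Rightarrow> real^'n" where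
  "Psi \<psi> x = (\<chi> j. \<psi> (x $ j))"

definition Psi_det :: "(real \<Rightarrow> real) \<Rightarrow> real^'n::finite \<Rightarrow> real" where
  "Psi_det \<psi> x = (\<Prod>j\<in>UNIV. deriv \<psi> (x $ j))"

lemma Psi_det_eq_det_jacobian:
  fixes x :: "real^'n::finite"
  assumes "\<And>t. \<psi> differentiable (at t)"
  shows "Psi_det \<psi> x = det (matrix (frechet_derivative (Psi \<psi>) (at x)))"
proof -
  have d: "(\<psi> has_derivative (\<lambda>h. h * deriv \<psi> t)) (at t)" for t
    using assms[of t] DERIV_deriv_iff_real_differentiable[of \<psi> t]
    by (simp add: has_field_derivative_def mult_commute_abs)
  have "((\<lambda>y. \<psi> (y $ j)) has_derivative (\<lambda>h. h $ j * deriv \<psi> (x $ j))) (at x)" for j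
    by (rule has_derivative_compose[OF bounded_linear.has_derivative[OF bounded_linear_vec_nth has_derivative_ident] d])
  then have "(Psi \<psi> has_derivative (\<lambda>h. \<chi> j. h $ j * deriv \<psi> (x $ j))) (at x)"
    unfolding has_derivative_componentwise_within[where f = "Psi \<psi>"]
    by (auto simp: Psi_def Basis_vec_def inner_axis)
  then have "frechet_derivative (Psi \<psi>) (at x) = (\<lambda>h. \<chi> j. h $ j * deriv \<psi> (x $ j))"
    by (rule frechet_derivative_at[symmetric])
  then show ?thesis
    by (subst det_diagonal) (auto simp: Psi_det_def matrix_def axis_def)
qed

text \<open>
  If \<open>\<psi>\<close> is differentiable and constant on \<open>(-\<infinity>,0)\<close> and on \<open>(1,\<infinity>)\<close>, then \<open>Psi_det \<psi>\<close> vanishes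
  outside the unit cube, so only finitely many terms of the sum are nonzero when \<open>S\<close> is invertible.
\<close>

definition quadrature ::
    "(real \<Rightarrow> real) \<Rightarrow> real^'n^'n::finite \<Rightarrow> real^'n \<Rightarrow> (real^'n \<Rightarrow> real) \<Rightarrow> real" where
  "quadrature \<psi> S v f = 1 / \<bar>det S\<bar> *
     (\<Sum>\<^sub>\<infinity>m. f (Psi \<psi> (transpose (matrix_inv S) *v (real_vec m + v))) *
            Psi_det \<psi> (transpose (matrix_inv S) *v (real_vec m + v)))"

definition scaled_frolov :: "real^'n^'n::finite \<Rightarrow> nat \<Rightarrow> real^'n \<Rightarrow> real^'n^'n" where
  "scaled_frolov B n u = (real n powr (1 / real CARD('n))) *\<^sub>R (diag_matrix u ** B)"

abbreviation dilation_cube :: "(real^'n::finite) set" where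
  "dilation_cube \<equiv> cbox (vec 1) (vec (2 powr (1 / real CARD('n))))"

definition random_dilation_shift ::
    "'w measure \<Rightarrow> ('w \<Rightarrow> real^'n::finite) \<Rightarrow> ('w \<Rightarrow> real^'n) \<Rightarrow> bool" where
  "random_dilation_shift M U V \<longleftrightarrow>
     prob_space M \<and>
     prob_space.indep_var M borel U borel V \<and>
     distr M borel U = uniform_measure lborel dilation_cube \<and>
     distr M borel V = uniform_measure lborel unit_cube"

end

theory Submission
  imports Defs
begin

text \<open>
  The substitution \<open>\<Psi>\<close> turns the rule into a shifted lattice rule applied to
  \<open>g = (f \<circ> \<Psi>) |D\<Psi>|\<close>, a function vanishing outside the cube. As a function of the shift
  \<open>v\<close> this rule is periodic, its Fourier coefficients are the values of the Fourier transform
  of \<open>g\<close> at the points \<open>S m\<close>, and the coefficient at \<open>m = 0\<close> is the integral of \<open>f\<close>. The error is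
  therefore at most the sum of \<open>|ft g (S m)|\<close> over \<open>m \<noteq> 0\<close>, and by Parseval its mean square over \<open>v\<close> is at most
  the corresponding sum of squares.

  Averaging the sum of squares over the dilation \<open>u\<close>, the Frolov property bounds the number of \<open>m\<close> whose
  points \<open>S m\<close> can reach a given frequency, which leaves \<open>4/n\<close> times the integral of \<open>|ft g|\<^sup>2\<close>
  over \<open>\<Prod>|\<xi>\<^sub>j| \<ge> n\<close>, where \<open>|\<xi>| \<ge> n\<^bsup>1/d\<^esup>\<close>; the uniform bound is Cauchy-Schwarz
  against \<open>\<Sum>|S m|\<^bsup>-2s\<^esup>\<close>. Both use that the pure derivatives \<open>\<partial>\<^sub>j\<^sup>s g\<close> have \<open>L\<^sup>2\<close> norm bounded by the
  Sobolev norm of \<open>f\<close>, proved for mollifications of \<open>f\<close> and passed to the limit in the Fourier transform.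
\<close>

section \<open>Fourier coefficients on the unit cube\<close>

text \<open>The gain of n^(-1/2) over the uniform bound comes from averaging over the dilation. For
  fixed m the map taking u to S m has a Jacobian that is at least n and comparable to
  \<Prod>|\<xi>_j| up to a factor 2, while at most 2 \<Prod>|\<xi>_j| / n indices m reach a given
  \<xi>; the products cancel and leave 4/n. On the region that remains, some single coordinate
  satisfies |\<xi>_j| \<ge> n^(1/d), so one pure derivative of order s supplies the whole decay.

  The obstacle is that f is only weakly differentiable and that |D\<Psi>| degenerates at the
  boundary of the cube. Smooth approximants of f carry all derivative estimates, with constants
  independent of the approximant. The limit needs only pointwise convergence of Fourier transforms:
  Fatou's lemma handles the tail integral, finite partial sums handle the uniform bound. For the
  transform only an upper bound in L2 is required, so Bessel's inequality on the cube, integrated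
  over shifted frequencies, does the work of Plancherel's theorem.\<close>

definition has_pderiv :: "'n::finite \<Rightarrow> (real^'n \<Rightarrow> 'b::real_normed_vector) \<Rightarrow> (real^'n \<Rightarrow> 'b) \<Rightarrow> bool"
  where "has_pderiv j h h' \<longleftrightarrow>
    (\<forall>x. ((\<lambda>t. h (x + t *\<^sub>R axis j 1)) has_vector_derivative h' x) (at 0))"

lemma has_pderivD:
  assumes "has_pderiv j h h'"
  shows "((\<lambda>t. h (x + t *\<^sub>R axis j 1)) has_vector_derivative h' (x + t *\<^sub>R axis j 1)) (at t within T)"
proof -
  have "((\<lambda>u. h ((x + t *\<^sub>R axis j 1) + u *\<^sub>R axis j 1)) has_vector_derivative
      h' (x + t *\<^sub>R axis j 1)) (at (t + (-t)))"
    using assms by (simp add: has_pderiv_def)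
  moreover have "((\<lambda>u. u - t) has_vector_derivative 1) (at t)"
    by (auto intro!: derivative_eq_intros)
  ultimately have "((\<lambda>u. h (x + t *\<^sub>R axis j 1 + (u - t) *\<^sub>R axis j 1)) has_vector_derivative
      h' (x + t *\<^sub>R axis j 1)) (at t)"
    using vector_diff_chain_at[of "\<lambda>u. u - t" 1 t
      "\<lambda>u. h (x + t *\<^sub>R axis j 1 + u *\<^sub>R axis j 1)"] by (simp add: o_def)
  then show ?thesis
    by (auto simp: algebra_simps scaleR_diff_left intro: has_vector_derivative_at_within)
qed

lemma has_pderiv_mult:
  fixes f :: "real^'n::finite \<Rightarrow> 'b::real_normed_algebra"
  assumes "has_pderiv j f f'" "has_pderiv j g g'"
  shows "has_pderiv j (\<lambda>x. f x * g x) (\<lambda>x. f x * g' x + f' x * g x)"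
  using assms unfolding has_pderiv_def
  by (auto intro!: has_vector_derivative_mult[where f="\<lambda>t. f (x + t *\<^sub>R axis j 1)"
        and g="\<lambda>t. g (x + t *\<^sub>R axis j 1)" for x, simplified, THEN has_vector_derivative_eq_rhs])

lemma has_pderiv_sum:
  assumes "\<And>i. i \<in> I \<Longrightarrow> has_pderiv j (f i) (f' i)"
  shows "has_pderiv j (\<lambda>x. \<Sum>i\<in>I. f i x) (\<lambda>x. \<Sum>i\<in>I. f' i x)"
  using assms unfolding has_pderiv_def by (auto intro!: has_vector_derivative_sum)

lemma has_pderiv_coord:
  fixes h :: "real \<Rightarrow> real"
  assumes "\<And>t. (h has_real_derivative h' t) (at t)"
  shows "has_pderiv j (\<lambda>x. h (x $ j)) (\<lambda>x. h' (x $ j))"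
  unfolding has_pderiv_def
proof
  fix x :: "real^'a"
  have "((\<lambda>t. h (x $ j + t)) has_real_derivative h' (x $ j)) (at 0)"
    using DERIV_shift[of h "h' (x$j)" 0 "x $ j"] assms[of "x $ j"] by (simp add: add.commute)
  then show "((\<lambda>t. h ((x + t *\<^sub>R axis j 1) $ j)) has_vector_derivative h' (x $ j)) (at 0)"
    by (simp add: has_real_derivative_iff_has_vector_derivative)
qed

lemma has_pderiv_indep:
  assumes "\<And>x t. h (x + t *\<^sub>R axis j 1) = h x"
  shows "has_pderiv j h (\<lambda>_. 0)"
  using assms unfolding has_pderiv_def by simp

lemma has_pderiv_of_real:
  assumes "has_pderiv j h h'"
  shows "has_pderiv j (\<lambda>x. of_real (h x) :: complex) (\<lambda>x. of_real (h' x))"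
  using assms unfolding has_pderiv_def
  by (auto intro!: derivative_eq_intros simp: has_real_derivative_iff_has_vector_derivative)

lemma pderiv_eq_0_outside:
  fixes h :: "real^'n::finite \<Rightarrow> 'b::real_normed_vector"
  assumes "has_pderiv j h h'" "closed K" "\<And>x. x \<notin> K \<Longrightarrow> h x = 0" "x \<notin> K"
  shows "h' x = 0"
proof -
  have "open ((\<lambda>t. x + t *\<^sub>R axis j 1) -` (- K))"
    using assms(2) by (intro open_vimage continuous_intros) auto
  then have "((\<lambda>t. h (x + t *\<^sub>R axis j 1)) has_vector_derivative 0) (at 0)"
    using assms(3,4)
    by (intro has_vector_derivative_transform_within_open[OF has_vector_derivative_const[of 0],
          where S="(\<lambda>t. x + t *\<^sub>R axis j 1) -` (- K)"]) auto
  moreover have "((\<lambda>t. h (x + t *\<^sub>R axis j 1)) has_vector_derivative h' x) (at 0)"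
    using assms(1) by (simp add: has_pderiv_def)
  ultimately show ?thesis
    using vector_derivative_unique_at by blast
qed

text \<open>Translating h along the axis keeps its support in a fixed larger box, so the integral of
  the translate is constant in t. Differentiating under the integral at t = 0 gives the
  claim.\<close>

lemma integral_pderiv_eq_0:
  fixes h :: "real^'n::finite \<Rightarrow> 'b::banach"
  assumes h: "continuous_on UNIV h" and h': "continuous_on UNIV h'" and d: "has_pderiv j h h'"
    and 0: "\<And>x. x \<notin> unit_cube \<Longrightarrow> h x = 0"
  shows "integral unit_cube h' = 0"
proof -
  \<comment> \<open>\<open>?K\<close> contains every translate of the unit cube by |t| < 1, so all
    integrals run over one fixed box, as the Leibniz rule requires.\<close>
  let ?e = "axis j 1 :: real^'n" and ?K = "cbox (vec (-1)) (vec 2) :: (real^'n) set"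
  have const: "integral ?K (\<lambda>x. h (x + t *\<^sub>R ?e)) = integral unit_cube h" if "t \<in> {-1<..<1}" for t
  proof -
    have "(h has_integral integral unit_cube h) unit_cube"
      using h by (intro integrable_integral integrable_continuous) (auto intro: continuous_on_subset)
    then have "((\<lambda>x. h (x + t *\<^sub>R ?e)) has_integral integral unit_cube h)
        (cbox (vec 0 - t *\<^sub>R ?e) (vec 1 - t *\<^sub>R ?e))"
      by (rule has_integral_shift_cbox)
    moreover have "h (x + t *\<^sub>R ?e) = 0" if "x \<notin> cbox (vec 0 - t *\<^sub>R ?e) (vec 1 - t *\<^sub>R ?e)" for x
    proof (rule 0)
      have "x + t *\<^sub>R ?e \<in> unit_cube \<longleftrightarrow> x \<in> cbox (vec 0 - t *\<^sub>R ?e) (vec 1 - t *\<^sub>R ?e)"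
        unfolding mem_box_cart vector_add_component vector_minus_component vector_scaleR_component vec_component
        by (intro iff_allI) linarith
      with that show "x + t *\<^sub>R ?e \<notin> unit_cube" by blast
    qed
    moreover have "cbox (vec 0 - t *\<^sub>R ?e) (vec 1 - t *\<^sub>R ?e) \<subseteq> ?K"
    proof
      fix x assume x: "x \<in> cbox (vec 0 - t *\<^sub>R ?e) (vec 1 - t *\<^sub>R ?e)"
      have "- 1 \<le> x $ i \<and> x $ i \<le> 2" for i
      proof -
        have "axis j (1::real) $ i = 0 \<or> axis j (1::real) $ i = 1" by (simp add: axis_def)
        then show ?thesis
          using x[unfolded mem_box_cart, rule_format, of i] that by (elim disjE) simp_all
      qed
      then show "x \<in> ?K" by (simp add: mem_box_cart)
    qed
    ultimately show ?thesis
      by (rule integral_unique[OF has_integral_on_superset])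
  qed
  have "((\<lambda>t. integral ?K (\<lambda>x. h (x + t *\<^sub>R ?e))) has_vector_derivative
      integral ?K (\<lambda>x. h' (x + 0 *\<^sub>R ?e))) (at 0 within {-1<..<1})"
  proof (rule leibniz_rule_vector_derivative)
    show "((\<lambda>t. h (x + t *\<^sub>R ?e)) has_vector_derivative h' (x + t *\<^sub>R ?e)) (at t within {-1<..<1})" for x t
      using d by (rule has_pderivD)
    show "(\<lambda>x. h (x + t *\<^sub>R ?e)) integrable_on ?K" for t
      by (intro integrable_continuous continuous_on_compose2[OF h] continuous_intros) auto
    show "continuous_on ({-1<..<1} \<times> ?K) (\<lambda>(t,x). h' (x + t *\<^sub>R ?e))"
      unfolding split_beta by (intro continuous_on_compose2[OF h'] continuous_intros) auto
  qed auto
  moreover have "((\<lambda>t. integral ?K (\<lambda>x. h (x + t *\<^sub>R ?e))) has_vector_derivative 0) (at 0 within {-1<..<1})"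
    by (rule has_vector_derivative_transform[OF _ _ has_vector_derivative_const[of "integral unit_cube h"]])
      (auto simp: const)
  ultimately have "integral ?K h' = 0"
    using vector_derivative_unique_within[of 0 "{-1<..<1}"] by (simp add: at_within_open[of 0 "{-1<..<1::real}"])
  moreover have "integral ?K h' = integral unit_cube h'"
  proof (rule integral_unique, rule has_integral_on_superset)
    show "(h' has_integral integral unit_cube h') unit_cube"
      using h' by (intro integrable_integral integrable_continuous) (auto intro: continuous_on_subset)
    show "h' x = 0" if "x \<notin> unit_cube" for x
      by (rule pderiv_eq_0_outside[OF d _ _ that]) (use 0 in auto)
    show "unit_cube \<subseteq> ?K" by (rule subset_interval_imp_cart) auto
  qed
  ultimately show ?thesis by simp
qed

text \<open>Integrating over the cube only lets one notion serve twice: for periodic functions the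
  values at integer vectors are the Fourier coefficients, and for functions vanishing off the cube
  it is the Fourier transform on the whole space.\<close>

definition ft :: "(real^'n::finite \<Rightarrow> real) \<Rightarrow> real^'n \<Rightarrow> complex" where
  "ft h \<xi> = integral unit_cube (\<lambda>x. of_real (h x) * cis (- (2 * pi * (\<xi> \<bullet> x))))"

text \<open>Integration by parts: the j-th derivative of h times the character integrates to zero
  over the cube, and one of its two terms is a multiple of h times the same character.\<close>

lemma ft_pderiv:
  fixes h :: "real^'n::finite \<Rightarrow> real"
  assumes h: "continuous_on UNIV h" and h': "continuous_on UNIV h'" and d: "has_pderiv j h h'"
    and 0: "\<And>x. x \<notin> unit_cube \<Longrightarrow> h x = 0"
  shows "ft h' \<xi> = 2 * pi * \<i> * \<xi> $ j * ft h \<xi>"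
proof -
  let ?e = "\<lambda>x. cis (- (2 * pi * (\<xi> \<bullet> x)))"
  have de: "has_pderiv j ?e (\<lambda>x. - (2 * pi * \<xi> $ j) *\<^sub>R (\<i> * ?e x))"
    unfolding has_pderiv_def
  proof
    fix x :: "real^'n"
    have "((\<lambda>t. - (2 * pi * (\<xi> \<bullet> (x + t *\<^sub>R axis j 1)))) has_real_derivative - (2 * pi * \<xi> $ j)) (at 0)"
      by (auto intro!: derivative_eq_intros simp: inner_add_right inner_axis)
    moreover have "(cis has_vector_derivative \<i> * cis t) (at t)" for t
    proof -
      have "((\<lambda>z. exp (\<i> * z)) has_field_derivative \<i> * cis t) (at (complex_of_real t))"
        by (auto intro!: derivative_eq_intros simp: cis_conv_exp)
      then have "((\<lambda>t. exp (\<i> * complex_of_real t)) has_vector_derivative \<i> * cis t) (at t)"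
        by (rule has_vector_derivative_real_field)
      moreover have "(\<lambda>t. exp (\<i> * complex_of_real t)) = cis"
        by (simp add: fun_eq_iff cis_conv_exp)
      ultimately show ?thesis by simp
    qed
    ultimately show "((\<lambda>t. ?e (x + t *\<^sub>R axis j 1)) has_vector_derivative - (2 * pi * \<xi> $ j) *\<^sub>R (\<i> * ?e x)) (at 0)"
      using vector_diff_chain_at[of "\<lambda>t. - (2 * pi * (\<xi> \<bullet> (x + t *\<^sub>R axis j 1)))" "- (2 * pi * \<xi> $ j)" 0 cis "\<i> * ?e x"]
      by (simp add: o_def has_real_derivative_iff_has_vector_derivative)
  qed
  have "integral unit_cube (\<lambda>x. of_real (h x) * (- (2 * pi * \<xi> $ j) *\<^sub>R (\<i> * ?e x)) + of_real (h' x) * ?e x) = 0"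
  proof (rule integral_pderiv_eq_0)
    show "has_pderiv j (\<lambda>x. of_real (h x) * ?e x)
       (\<lambda>x. of_real (h x) * (- (2 * pi * \<xi> $ j) *\<^sub>R (\<i> * ?e x)) + of_real (h' x) * ?e x)"
      by (intro has_pderiv_mult has_pderiv_of_real d de)
  qed (use 0 in \<open>auto intro!: continuous_intros h h'\<close>)
  also have "(\<lambda>x. of_real (h x) * (- (2 * pi * \<xi> $ j) *\<^sub>R (\<i> * ?e x)) + of_real (h' x) * ?e x) =
    (\<lambda>x. - (2 * pi * \<i> * \<xi> $ j) * (of_real (h x) * ?e x) + of_real (h' x) * ?e x)"
    by (simp add: fun_eq_iff scaleR_conv_of_real)
  also have "integral unit_cube \<dots> = integral unit_cube (\<lambda>x. - (2 * pi * \<i> * \<xi> $ j) * (of_real (h x) * ?e x)) + ft h' \<xi>"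
    unfolding ft_def
    by (intro Henstock_Kurzweil_Integration.integral_add integrable_continuous continuous_intros
        continuous_on_subset[OF h] continuous_on_subset[OF h']) auto
  also have "integral unit_cube (\<lambda>x. - (2 * pi * \<i> * \<xi> $ j) * (of_real (h x) * ?e x)) = - (2 * pi * \<i> * \<xi> $ j) * ft h \<xi>"
    unfolding ft_def by (rule integral_mult_right)
  finally show ?thesis by (simp add: algebra_simps)
qed

section \<open>Orthogonality of the characters on the cube\<close>

lemma integral_lborel_prod_Basis:
  fixes f :: "'a::euclidean_space \<Rightarrow> real \<Rightarrow> 'b::{real_normed_field,banach,second_countable_topology}"
  assumes "\<And>b. b \<in> Basis \<Longrightarrow> integrable lborel (f b)"
  shows "(LINT x|lborel. (\<Prod>b\<in>Basis. f b (x \<bullet> b))) = (\<Prod>b\<in>Basis. LINT t|lborel. f b t)"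
proof -
  interpret product_sigma_finite "\<lambda>_::'a. lborel :: real measure" ..
  have [measurable]: "f b \<in> borel_measurable borel" if "b \<in> Basis" for b
    using borel_measurable_integrable[OF assms[OF that]] by simp
  have "(LINT x|lborel. (\<Prod>b\<in>Basis. f b (x \<bullet> b))) =
      (LINT y|(\<Pi>\<^sub>M b\<in>Basis. lborel). (\<Prod>b\<in>Basis. f b ((\<Sum>c\<in>Basis. y c *\<^sub>R c) \<bullet> b)))"
    by (subst lborel_eq) (simp add: integral_distr)
  also have "\<dots> = (LINT y|(\<Pi>\<^sub>M b\<in>Basis. lborel). (\<Prod>b\<in>Basis. f b (y b)))"
    by (intro Bochner_Integration.integral_cong prod.cong) (auto simp: inner_sum_left inner_Basis if_distrib cong: if_cong)
  also have "\<dots> = (\<Prod>b\<in>Basis. LINT t|lborel. f b t)"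
    by (rule product_integral_prod) (use assms in auto)
  finally show ?thesis .
qed

lemma cis_sum: "cis (\<Sum>i\<in>I. f i) = (\<Prod>i\<in>I. cis (f i))"
  by (induction I rule: infinite_finite_induct) (auto simp flip: cis_mult)

lemma prod_scaleR_complex: "(\<Prod>i\<in>I. a i *\<^sub>R f i) = (\<Prod>i\<in>I. a i) *\<^sub>R (\<Prod>i\<in>I. f i :: complex)"
  by (simp add: scaleR_conv_of_real prod.distrib)

lemma bij_betw_axis_Basis: "bij_betw (\<lambda>j. axis j 1) UNIV (Basis :: (real^'n::finite) set)"
  by (auto simp: bij_betw_def inj_on_def axis_eq_axis Basis_vec_def)

lemma integral_cis_01:
  fixes k :: int
  shows "integral {0..1} (\<lambda>t. cis (2 * pi * k * t)) = (if k = 0 then 1 else 0)"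
proof (cases "k = 0")
  case False
  have "((\<lambda>t. cis (2 * pi * k * t)) has_integral
      (cis (2 * pi * k * 1) / (2 * pi * k * \<i>) - cis (2 * pi * k * 0) / (2 * pi * k * \<i>))) {0..1}"
  proof (rule fundamental_theorem_of_calculus)
    fix t :: real
    have "((\<lambda>z. exp (\<i> * (2 * pi * k * z)) / (2 * pi * k * \<i>)) has_field_derivative cis (2 * pi * k * t))
        (at (complex_of_real t))"
      using False by (auto intro!: derivative_eq_intros simp: cis_conv_exp mult_ac)
    then have "((\<lambda>t. exp (\<i> * (2 * pi * k * complex_of_real t)) / (2 * pi * k * \<i>)) has_vector_derivative
        cis (2 * pi * k * t)) (at t within {0..1})"
      by (rule has_vector_derivative_real_field)
    then show "((\<lambda>t. cis (2 * pi * k * t) / (2 * pi * k * \<i>)) has_vector_derivative cis (2 * pi * k * t))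
        (at t within {0..1})"
      by (simp add: cis_conv_exp)
  qed simp
  then show ?thesis
    using False by (simp add: cis_multiple_2pi integral_unique)
qed simp

lemma indicator_unit_cube_prod:
  fixes x :: "real^'n::finite"
  shows "indicator unit_cube x = (\<Prod>b\<in>Basis. indicator {0..1} (x \<bullet> b) :: real)"
proof -
  have iff: "x \<in> unit_cube \<longleftrightarrow> (\<forall>b\<in>Basis. x \<bullet> b \<in> {0..1})"
    by (auto simp: mem_box_cart Basis_vec_def inner_axis)
  show ?thesis
  proof (cases "x \<in> unit_cube")
    case True
    then show ?thesis using iff by (simp add: prod.neutral)
  next
    case False
    then obtain b where "b \<in> Basis" "x \<bullet> b \<notin> {0..1}" using iff by blast
    then have "(\<Prod>b\<in>Basis. indicator {0..1} (x \<bullet> b) :: real) = 0"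
      by (intro prod_zero bexI[of _ b]) (auto simp: indicator_def)
    then show ?thesis using False by simp
  qed
qed

lemma integral_cube_char:
  fixes m :: "int^'n::finite"
  shows "integral unit_cube (\<lambda>x. cis (2 * pi * (real_vec m \<bullet> x))) = (if m = 0 then 1 else 0)"
proof -
  define f :: "real^'n \<Rightarrow> real \<Rightarrow> complex"
    where "f = (\<lambda>b t. indicator {0..1} t *\<^sub>R cis (2 * pi * (real_vec m \<bullet> b) * t))"
  have int1: "set_integrable lborel {0..1} (\<lambda>t. cis (2 * pi * c * t))" for c :: real
    unfolding set_integrable_def by (intro borel_integrable_compact continuous_intros) auto
  have f1: "(LINT t|lborel. f b t) = integral {0..1} (\<lambda>t. cis (2 * pi * (real_vec m \<bullet> b) * t))" for b
    using set_borel_integral_eq_integral(2)[OF int1] by (simp add: f_def set_lebesgue_integral_def)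
  have "set_integrable lborel unit_cube (\<lambda>x. cis (2 * pi * (real_vec m \<bullet> x)))"
    unfolding set_integrable_def by (intro borel_integrable_compact continuous_intros) auto
  then have "integral unit_cube (\<lambda>x. cis (2 * pi * (real_vec m \<bullet> x))) =
      (LINT x|lborel. indicator unit_cube x *\<^sub>R cis (2 * pi * (real_vec m \<bullet> x)))"
    by (simp add: set_borel_integral_eq_integral(2)[symmetric] set_lebesgue_integral_def)
  also have "\<dots> = (LINT x|lborel. (\<Prod>b\<in>Basis. f b (x \<bullet> b)))"
  proof (rule Bochner_Integration.integral_cong)
    fix x :: "real^'n"
    have "cis (2 * pi * (real_vec m \<bullet> x)) = (\<Prod>b\<in>Basis. cis (2 * pi * (real_vec m \<bullet> b) * (x \<bullet> b)))"
      by (subst euclidean_inner) (simp add: sum_distrib_left flip: cis_sum mult.assoc)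
    moreover note indicator_unit_cube_prod[of x]
    ultimately show "indicator unit_cube x *\<^sub>R cis (2 * pi * (real_vec m \<bullet> x)) = (\<Prod>b\<in>Basis. f b (x \<bullet> b))"
      by (simp add: f_def prod_scaleR_complex)
  qed simp
  also have "\<dots> = (\<Prod>b\<in>Basis. LINT t|lborel. f b t)"
    by (rule integral_lborel_prod_Basis) (use int1 in \<open>auto simp: f_def set_integrable_def\<close>)
  also have "\<dots> = (\<Prod>b\<in>Basis. integral {0..1} (\<lambda>t. cis (2 * pi * (real_vec m \<bullet> b) * t)))"
    by (simp only: f1)
  also have "\<dots> = (\<Prod>j\<in>UNIV. integral {0..1} (\<lambda>t. cis (2 * pi * (m $ j) * t)))"
    by (subst prod.reindex_bij_betw[OF bij_betw_axis_Basis, symmetric])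
      (simp add: real_vec_def inner_axis)
  also have "\<dots> = (\<Prod>j\<in>UNIV. if m $ j = 0 then 1 else 0)"
    by (simp only: integral_cis_01)
  also have "\<dots> = (if m = 0 then 1 else 0)"
    by (auto simp: vec_eq_iff)
  finally show ?thesis .
qed

section \<open>Periodic functions\<close>

text \<open>Generating the class by characters and sums makes closure under products a double
  induction; a finite table of coefficients is extracted only once, in
  \<open>trig_poly_expand\<close>.\<close>

inductive trig_poly :: "(real^'n::finite \<Rightarrow> complex) \<Rightarrow> bool" where
  char: "trig_poly (\<lambda>x. c * cis (2 * pi * (real_vec m \<bullet> x)))"
| add: "trig_poly f \<Longrightarrow> trig_poly g \<Longrightarrow> trig_poly (\<lambda>x. f x + g x)"

lemma real_vec_add: "real_vec (m + k) = real_vec m + real_vec k"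
  by (simp add: real_vec_def vec_eq_iff)

lemma real_vec_0 [simp]: "real_vec 0 = 0"
  by (simp add: real_vec_def vec_eq_iff)

lemma real_vec_minus: "real_vec (- m) = - real_vec m"
  by (simp add: real_vec_def vec_eq_iff)

lemma real_vec_diff: "real_vec (m - k) = real_vec m - real_vec k"
  by (simp add: real_vec_def vec_eq_iff)

lemma trig_poly_const: "trig_poly (\<lambda>x. c)"
  using trig_poly.char[of c 0] by simp

lemma trig_poly_mult:
  assumes "trig_poly f" "trig_poly g"
  shows "trig_poly (\<lambda>x. f x * g x)"
  using assms
proof (induction f)
  case (char c m)
  from char show ?case
  proof (induction g)
    case (char d k)
    have "trig_poly (\<lambda>x. (c * d) * cis (2 * pi * (real_vec (m + k) \<bullet> x)))"
      by (rule trig_poly.char)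
    then show ?case
      by (simp add: real_vec_add inner_add_left distrib_left flip: cis_mult) (simp add: mult_ac)
  next
    case (add g g')
    then show ?case by (simp add: distrib_left trig_poly.add)
  qed
next
  case (add f f')
  then show ?case by (simp add: distrib_right trig_poly.add)
qed

lemma trig_poly_sum:
  assumes "finite I" "\<And>i. i \<in> I \<Longrightarrow> trig_poly (f i)"
  shows "trig_poly (\<lambda>x. \<Sum>i\<in>I. f i x)"
  using assms by (induction I rule: finite_induct) (auto intro: trig_poly_const trig_poly.add)

lemma trig_poly_expand:
  assumes "trig_poly f"
  obtains A c where "finite A" "\<And>x. f x = (\<Sum>m\<in>A. c m * cis (2 * pi * (real_vec m \<bullet> x)))"
proof -
  have "\<exists>A c. finite A \<and> (\<forall>x. f x = (\<Sum>m\<in>A. c m * cis (2 * pi * (real_vec m \<bullet> x))))"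
    using assms
  proof induction
    case (char c m)
    show ?case by (intro exI[of _ "{m}"] exI[of _ "\<lambda>_. c"]) auto
  next
    case (add f g)
    then obtain A c B d where A: "finite A" "\<And>x. f x = (\<Sum>m\<in>A. c m * cis (2 * pi * (real_vec m \<bullet> x)))"
      and B: "finite B" "\<And>x. g x = (\<Sum>m\<in>B. d m * cis (2 * pi * (real_vec m \<bullet> x)))"
      by auto
    let ?c = "\<lambda>m. (if m \<in> A then c m else 0) + (if m \<in> B then d m else 0)"
    have "f x + g x = (\<Sum>m\<in>A \<union> B. ?c m * cis (2 * pi * (real_vec m \<bullet> x)))" for x
    proof -
      have "f x = (\<Sum>m\<in>A \<union> B. (if m \<in> A then c m else 0) * cis (2 * pi * (real_vec m \<bullet> x)))"
        unfolding A(2) by (rule sum.mono_neutral_cong_left) (use A(1) B(1) in auto)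
      moreover have "g x = (\<Sum>m\<in>A \<union> B. (if m \<in> B then d m else 0) * cis (2 * pi * (real_vec m \<bullet> x)))"
        unfolding B(2) by (rule sum.mono_neutral_cong_left) (use A(1) B(1) in auto)
      ultimately show ?thesis by (simp only: distrib_right sum.distrib)
    qed
    then show ?case using A(1) B(1) by (intro exI[of _ "A \<union> B"] exI[of _ ?c]) auto
  qed
  then show ?thesis using that by blast
qed

text \<open>The standard embedding of the torus: two points have the same image iff they differ by
  an integer vector, and the image of the cube is a compact set to which Stone-Weierstrass
  applies.\<close>

definition torus_map :: "real^'n::finite \<Rightarrow> complex^'n" where
  "torus_map x = (\<chi> i. cis (2 * pi * x $ i))"

text \<open>Real linear functionals of the embedded point are combinations of the cosines and sines
  of the coordinates, and these combine the characters of frequency \<open>axis i 1\<close> and its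
  negative. Constants, sums and products stay in the class.\<close>

lemma trig_poly_real_polynomial:
  assumes "real_polynomial_function (p :: complex^'n::finite \<Rightarrow> real)"
  shows "trig_poly (\<lambda>x. of_real (p (torus_map x)))"
  using assms
proof induction
  case (linear p)
  have ax: "real_vec (axis i 1) \<bullet> x = x $ i" for x :: "real^'n" and i
    by (simp add: real_vec_def inner_vec_def axis_def if_distrib[of "\<lambda>z. z * _"] if_distrib[of real_of_int] cong: if_cong)
  have "trig_poly (\<lambda>x. u * cis (2 * pi * (real_vec (axis i 1) \<bullet> x)) + w * cis (2 * pi * (real_vec (- axis i 1) \<bullet> x)))"
    for u w and i :: 'n
    by (intro trig_poly.intros)
  then have cs: "trig_poly (\<lambda>x. u * cis (2 * pi * x $ i) + w * cis (- (2 * pi * x $ i)))" for u w and i :: 'n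
    by (simp add: real_vec_minus ax)
  have c: "trig_poly (\<lambda>x. of_real (cos (2 * pi * x $ i)))" for i :: 'n
    using cs[of "1/2" i "1/2"] by (rule back_subst[of trig_poly]) (auto simp: complex_eq_iff)
  have s: "trig_poly (\<lambda>x. of_real (sin (2 * pi * x $ i)))" for i :: 'n
    using cs[of "-\<i>/2" i "\<i>/2"] by (rule back_subst[of trig_poly]) (auto simp: complex_eq_iff)
  have "p (torus_map x) = (\<Sum>i\<in>UNIV. cos (2 * pi * x $ i) * p (axis i 1) + sin (2 * pi * x $ i) * p (axis i \<i>))" for x
  proof -
    have "torus_map x = (\<Sum>i\<in>UNIV. cos (2 * pi * x $ i) *\<^sub>R axis i 1 + sin (2 * pi * x $ i) *\<^sub>R axis i \<i>)"
      by (simp add: torus_map_def vec_eq_iff complex_eq_iff axis_def if_distrib sum.distrib cong: if_cong)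
    then show ?thesis
      using linear by (simp add: linear_sum linear_add linear_scale bounded_linear.linear)
  qed
  then have "trig_poly (\<lambda>x. of_real (p (torus_map x))) =
     trig_poly (\<lambda>x. \<Sum>i\<in>UNIV. of_real (cos (2 * pi * x $ i)) * of_real (p (axis i 1)) +
       of_real (sin (2 * pi * x $ i)) * of_real (p (axis i \<i>)))" by simp
  then show ?case
    by (auto intro!: trig_poly_sum trig_poly_mult trig_poly.add c s trig_poly_const)
qed (auto intro: trig_poly_const trig_poly.add trig_poly_mult)

lemma frac_cis: "cis (2 * pi * frac t) = cis (2 * pi * t)"
  by (simp add: frac_def right_diff_distrib cis_multiple_2pi flip: cis_divide)

text \<open>F descends to a continuous function on the embedded torus, real polynomials are
  uniformly dense there, and they pull back to trigonometric polynomials.\<close>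

lemma periodic_approx:
  fixes F :: "real^'n::finite \<Rightarrow> real"
  assumes F: "continuous_on UNIV F" and per: "\<And>x m. F (x + real_vec m) = F x" and "e > 0"
  obtains A c where "finite A"
    "\<And>x. cmod (of_real (F x) - (\<Sum>m\<in>A. c m * cis (2 * pi * (real_vec m \<bullet> x)))) < e"
proof -
  define T where "T = torus_map ` (unit_cube :: (real^'n) set)"
  \<comment> \<open>\<open>F'\<close> picks some preimage in the cube; \<open>inj\<close> shows that
    by periodicity the value of F does not depend on the choice.\<close>
  define F' where "F' = (\<lambda>z. F (inv_into unit_cube torus_map z))"
  have frac: "(\<chi> i. frac (x $ i)) \<in> unit_cube" "torus_map (\<chi> i. frac (x $ i)) = torus_map x" for x :: "real^'n"
    by (auto simp: mem_box_cart torus_map_def frac_cis vec_eq_iff less_imp_le[OF frac_lt_1])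
  have inj: "F x = F y" if "torus_map x = torus_map y" for x y
  proof -
    have "\<exists>k::int. x $ i = y $ i + k" for i
    proof -
      have "cis (2 * pi * x $ i) = cis (2 * pi * y $ i)"
        using that by (simp add: torus_map_def vec_eq_iff)
      then have "cos (2 * pi * x $ i) = cos (2 * pi * y $ i)" "sin (2 * pi * x $ i) = sin (2 * pi * y $ i)"
        by (simp_all add: complex_eq_iff)
      then obtain n :: int where "2 * pi * x $ i = 2 * pi * y $ i + 2 * pi * n"
        using sin_cos_eq_iff by metis
      then have "2 * pi * (x $ i) = 2 * pi * (y $ i + n)" by (simp add: distrib_left)
      then show ?thesis by auto
    qed
    then obtain k where "\<And>i. x $ i = y $ i + real_of_int (k i)" by metis
    then have "x = y + real_vec (\<chi> i. k i)" by (simp add: vec_eq_iff real_vec_def)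
    then show ?thesis using per by simp
  qed
  have F'_eq: "F' (torus_map x) = F x" for x
    unfolding F'_def
    by (rule inj) (metis frac f_inv_into_f imageI)
  have cont_tm: "continuous_on S torus_map" for S :: "(real^'n) set"
    unfolding torus_map_def by (intro continuous_intros)
  have compT: "compact T" unfolding T_def by (intro compact_continuous_image cont_tm) simp
  \<comment> \<open>A quotient argument: the preimage of a closed set under \<open>F'\<close> is the
    image of a compact part of the cube under \<open>torus_map\<close>, hence closed.\<close>
  have "continuous_on T F'"
    unfolding continuous_on_closed_invariant
  proof (intro allI impI)
    fix C :: "real set" assume "closed C"
    let ?A = "torus_map ` (unit_cube \<inter> F -` C)"
    have "closed (F -` C)" using F \<open>closed C\<close> by (simp add: continuous_on_closed_vimage)
    then have "compact (unit_cube \<inter> F -` C)" by (intro compact_Int_closed) auto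
    then have "closed ?A" by (intro compact_imp_closed compact_continuous_image cont_tm)
    moreover have "?A \<inter> T = F' -` C \<inter> T" by (auto simp: T_def F'_eq dest: inj)
    ultimately show "\<exists>A. closed A \<and> A \<inter> T = F' -` C \<inter> T" by blast
  qed
  then obtain p where p: "real_polynomial_function p" "\<And>z. z \<in> T \<Longrightarrow> \<bar>F' z - p z\<bar> < e"
    using Stone_Weierstrass_real_polynomial_function[OF compT _ \<open>e > 0\<close>] by metis
  from trig_poly_expand[OF trig_poly_real_polynomial[OF p(1)]] obtain A c where
    A: "finite A" "\<And>x. complex_of_real (p (torus_map x)) = (\<Sum>m\<in>A. c m * cis (2 * pi * (real_vec m \<bullet> x)))" by blast
  have "cmod (of_real (F x) - (\<Sum>m\<in>A. c m * cis (2 * pi * (real_vec m \<bullet> x)))) < e" for x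
  proof -
    have "torus_map x \<in> T" unfolding T_def by (metis frac imageI)
    then show ?thesis using p(2)[of "torus_map x"]
      by (simp add: F'_eq flip: A(2) of_real_diff)
  qed
  with A(1) show ?thesis using that by blast
qed

section \<open>Mean-square and uniform bounds for periodic functions\<close>

lemma ft_real_vec_integral:
  assumes "continuous_on unit_cube F"
  shows "((\<lambda>x. of_real (F x) * cis (- (2 * pi * (\<xi> \<bullet> x)))) has_integral ft F \<xi>) unit_cube"
  unfolding ft_def using assms
  by (intro integrable_integral integrable_continuous continuous_intros)

lemma integral_cube_char_has_integral:
  "((\<lambda>x. cis (2 * pi * (real_vec m \<bullet> x))) has_integral (if m = 0 then 1 else 0)) unit_cube"
proof -
  have "(\<lambda>x. cis (2 * pi * (real_vec m \<bullet> x))) integrable_on unit_cube"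
    by (intro integrable_continuous continuous_intros)
  then show ?thesis by (simp only: has_integral_integral integral_cube_char)
qed

lemma content_unit_cube [simp]: "measure lborel (cbox 0 1 :: (real^'n::finite) set) = 1"
  using integral_cube_char[of "0 :: int^'n"] by (simp add: scaleR_conv_of_real)

text \<open>Expanding the square and using orthonormality completes the square in the coefficients.
  With c the Fourier coefficients this yields Bessel's inequality and the best approximation; with
  the index set {0} it yields the variance.\<close>

lemma L2_distance_trig:
  fixes F :: "real^'n::finite \<Rightarrow> real" and c :: "int^'n \<Rightarrow> complex"
  assumes F: "continuous_on unit_cube F" and A: "finite A"
  shows "integral unit_cube (\<lambda>x. (cmod (of_real (F x) - (\<Sum>m\<in>A. c m * cis (2 * pi * (real_vec m \<bullet> x)))))\<^sup>2) =
    integral unit_cube (\<lambda>x. (F x)\<^sup>2) - (\<Sum>m\<in>A. (cmod (ft F (real_vec m)))\<^sup>2)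
    + (\<Sum>m\<in>A. (cmod (c m - ft F (real_vec m)))\<^sup>2)"
proof -
  let ?e = "\<lambda>m x. cis (2 * pi * (real_vec m \<bullet> x)) :: complex"
  let ?e' = "\<lambda>m x. cis (- (2 * pi * (real_vec m \<bullet> x))) :: complex"
  let ?a = "\<lambda>m. ft F (real_vec m)"
  let ?P = "\<lambda>x. \<Sum>m\<in>A. c m * ?e m x"
  have sq: "((\<lambda>x. complex_of_real ((F x)\<^sup>2)) has_integral of_real (integral unit_cube (\<lambda>x. (F x)\<^sup>2))) unit_cube"
    using F by (intro has_integral_of_real integrable_integral integrable_continuous continuous_intros)
  have fc: "((\<lambda>x. of_real (F x) * ?e' m x) has_integral ?a m) unit_cube" for m
    using F by (rule ft_real_vec_integral)
  have "((\<lambda>x. cnj (of_real (F x) * ?e' m x)) has_integral cnj (?a m)) unit_cube" for m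
    using fc[of m] has_integral_cnj[of "\<lambda>x. of_real (F x) * ?e' m x"] by (simp add: o_def)
  then have fc': "((\<lambda>x. of_real (F x) * ?e m x) has_integral cnj (?a m)) unit_cube" for m
    by (simp add: cis_cnj)
  have ee: "((\<lambda>x. ?e m x * ?e' k x) has_integral (if m = k then 1 else 0)) unit_cube" for m k
    using integral_cube_char_has_integral[of "m - k"]
    by (simp add: real_vec_diff inner_diff_left right_diff_distrib cis_mult)
  have eq: "complex_of_real ((cmod (of_real (F x) - ?P x))\<^sup>2) =
      of_real ((F x)\<^sup>2) - (\<Sum>m\<in>A. cnj (c m) * (of_real (F x) * ?e' m x)) - (\<Sum>m\<in>A. c m * (of_real (F x) * ?e m x))
      + (\<Sum>m\<in>A. \<Sum>k\<in>A. c m * cnj (c k) * (?e m x * ?e' k x))" for x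
  proof -
    have "complex_of_real ((cmod (of_real (F x) - ?P x))\<^sup>2) = (of_real (F x) - ?P x) * cnj (of_real (F x) - ?P x)"
      by (rule complex_norm_square)
    also have "cnj (of_real (F x) - ?P x) = of_real (F x) - (\<Sum>m\<in>A. cnj (c m) * ?e' m x)"
      by (simp add: cis_cnj)
    also have "(of_real (F x) - ?P x) * \<dots> = of_real (F x) * of_real (F x)
       - of_real (F x) * (\<Sum>m\<in>A. cnj (c m) * ?e' m x) - of_real (F x) * ?P x + ?P x * (\<Sum>m\<in>A. cnj (c m) * ?e' m x)"
      by (simp add: algebra_simps)
    also have "of_real (F x) * (\<Sum>m\<in>A. cnj (c m) * ?e' m x) = (\<Sum>m\<in>A. cnj (c m) * (of_real (F x) * ?e' m x))"
      unfolding sum_distrib_left by (intro sum.cong refl mult.left_commute)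
    also have "of_real (F x) * ?P x = (\<Sum>m\<in>A. c m * (of_real (F x) * ?e m x))"
      unfolding sum_distrib_left by (intro sum.cong refl mult.left_commute)
    also have "?P x * (\<Sum>m\<in>A. cnj (c m) * ?e' m x) = (\<Sum>m\<in>A. \<Sum>k\<in>A. c m * cnj (c k) * (?e m x * ?e' k x))"
      unfolding sum_product by (intro sum.cong refl) (simp only: mult_ac)
    finally show ?thesis by (simp only: power2_eq_square of_real_mult)
  qed
  have "((\<lambda>x. complex_of_real ((cmod (of_real (F x) - ?P x))\<^sup>2)) has_integral
     (of_real (integral unit_cube (\<lambda>x. (F x)\<^sup>2)) - (\<Sum>m\<in>A. cnj (c m) * ?a m) - (\<Sum>m\<in>A. c m * cnj (?a m))
      + (\<Sum>m\<in>A. \<Sum>k\<in>A. c m * cnj (c k) * (if m = k then 1 else 0)))) unit_cube"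
    unfolding eq
    by (intro has_integral_add has_integral_diff has_integral_sum A has_integral_mult_right fc fc' ee sq)
  also have "(\<Sum>m\<in>A. \<Sum>k\<in>A. c m * cnj (c k) * (if m = k then 1 else 0)) = (\<Sum>m\<in>A. c m * cnj (c m))"
    using A by (intro sum.cong refl) (simp add: if_distrib sum.delta cong: if_cong)
  also have "of_real (integral unit_cube (\<lambda>x. (F x)\<^sup>2)) - (\<Sum>m\<in>A. cnj (c m) * ?a m) - (\<Sum>m\<in>A. c m * cnj (?a m)) + \<dots> =
     complex_of_real (integral unit_cube (\<lambda>x. (F x)\<^sup>2) - (\<Sum>m\<in>A. (cmod (?a m))\<^sup>2) + (\<Sum>m\<in>A. (cmod (c m - ?a m))\<^sup>2))"
  proof -
    have "complex_of_real ((cmod (c m - ?a m))\<^sup>2) =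
        c m * cnj (c m) - cnj (c m) * ?a m - c m * cnj (?a m) + of_real ((cmod (?a m))\<^sup>2)" for m
      unfolding complex_norm_square by (simp add: algebra_simps)
    then show ?thesis
      by (simp only: of_real_add of_real_diff of_real_sum sum.distrib sum_subtractf) simp
  qed
  finally have "((\<lambda>x. Re (complex_of_real ((cmod (of_real (F x) - ?P x))\<^sup>2))) has_integral
     Re (complex_of_real (integral unit_cube (\<lambda>x. (F x)\<^sup>2) - (\<Sum>m\<in>A. (cmod (?a m))\<^sup>2) + (\<Sum>m\<in>A. (cmod (c m - ?a m))\<^sup>2)))) unit_cube"
    using has_integral_linear[OF _ bounded_linear_Re, unfolded o_def] by blast
  then show ?thesis by (simp add: integral_unique)
qed

lemma bessel:
  fixes F :: "real^'n::finite \<Rightarrow> real"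
  assumes "continuous_on unit_cube F" "finite A"
  shows "(\<Sum>m\<in>A. (cmod (ft F (real_vec m)))\<^sup>2) \<le> integral unit_cube (\<lambda>x. (F x)\<^sup>2)"
proof -
  let ?g = "\<lambda>x. (cmod (of_real (F x) - (\<Sum>m\<in>A. ft F (real_vec m) * cis (2 * pi * (real_vec m \<bullet> x)))))\<^sup>2"
  have "0 \<le> integral unit_cube ?g"
    by (intro Henstock_Kurzweil_Integration.integral_nonneg integrable_continuous continuous_intros assms) auto
  then show ?thesis
    using L2_distance_trig[OF assms, of "\<lambda>m. ft F (real_vec m)"] by simp
qed

lemma ft_0:
  assumes "continuous_on unit_cube F"
  shows "ft F 0 = of_real (integral unit_cube F)"
  unfolding ft_def using has_integral_of_real[OF integrable_integral[OF integrable_continuous[OF assms]]]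
  by (auto intro!: integral_unique)

text \<open>A trigonometric polynomial uniformly within \<open>sqrt e\<close> of F has squared L2
  distance at most e, and replacing its coefficients by the Fourier coefficients of F can only
  decrease it. The index 0 is put into A so that the mean can be split off later.\<close>

lemma parseval_approx:
  fixes F :: "real^'n::finite \<Rightarrow> real"
  assumes F: "continuous_on UNIV F" and per: "\<And>x m. F (x + real_vec m) = F x" and "e > 0"
  obtains A where "finite A" "0 \<in> A"
    "integral unit_cube (\<lambda>x. (F x)\<^sup>2) \<le> (\<Sum>m\<in>A. (cmod (ft F (real_vec m)))\<^sup>2) + e"
    "integral unit_cube (\<lambda>x. (cmod (of_real (F x) - (\<Sum>m\<in>A. ft F (real_vec m) * cis (2 * pi * (real_vec m \<bullet> x)))))\<^sup>2) \<le> e"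
proof -
  have FQ: "continuous_on unit_cube F" using F continuous_on_subset by blast
  have "sqrt e > 0" using \<open>e > 0\<close> by simp
  from periodic_approx[OF F per this] obtain A0 c0 where A0: "finite A0"
    "\<And>x. cmod (of_real (F x) - (\<Sum>m\<in>A0. c0 m * cis (2 * pi * (real_vec m \<bullet> x)))) < sqrt e" by metis
  define A c where "A = insert 0 A0" and "c = (\<lambda>m. if m \<in> A0 then c0 m else 0)"
  have A: "finite A" "0 \<in> A" using A0 by (auto simp: A_def)
  have P: "(\<Sum>m\<in>A0. c0 m * cis (2 * pi * (real_vec m \<bullet> x))) = (\<Sum>m\<in>A. c m * cis (2 * pi * (real_vec m \<bullet> x)))" for x
    unfolding A_def c_def using A0(1) by (intro sum.mono_neutral_cong_left) auto
  let ?g = "\<lambda>x. (cmod (of_real (F x) - (\<Sum>m\<in>A. c m * cis (2 * pi * (real_vec m \<bullet> x)))))\<^sup>2"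
  have "?g x \<le> e" for x
  proof -
    have "?g x \<le> (sqrt e)\<^sup>2" by (rule power_mono) (use A0(2)[of x] P[of x] in auto)
    then show ?thesis using \<open>e > 0\<close> by simp
  qed
  moreover have "?g integrable_on unit_cube"
    by (intro integrable_continuous continuous_intros FQ)
  ultimately have "integral unit_cube ?g \<le> integral unit_cube (\<lambda>x::real^'n. e)"
    by (intro integral_le) auto
  also have "\<dots> = e" by simp
  finally have le: "integral unit_cube ?g \<le> e" .
  have "(\<Sum>m\<in>A. (cmod (c m - ft F (real_vec m)))\<^sup>2) \<ge> 0" by (simp add: sum_nonneg)
  with le L2_distance_trig[OF FQ A(1), of c] L2_distance_trig[OF FQ A(1), of "\<lambda>m. ft F (real_vec m)"]
  show ?thesis by (intro that[OF A]) simp_all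
qed

text \<open>The mean is the Fourier coefficient at 0, so removing it from the Parseval approximation
  leaves nonzero frequencies and an arbitrarily small e. In \<open>ennreal\<close> the infinite sum
  is meaningful without a convergence argument.\<close>

lemma periodic_variance:
  fixes F :: "real^'n::finite \<Rightarrow> real"
  assumes F: "continuous_on UNIV F" and per: "\<And>x m. F (x + real_vec m) = F x"
  shows "ennreal (integral unit_cube (\<lambda>x. (F x - integral unit_cube F)\<^sup>2)) \<le>
    (\<integral>\<^sup>+ m. ennreal ((cmod (ft F (real_vec m)))\<^sup>2) \<partial>count_space (- {0}))"
proof (rule ennreal_le_epsilon)
  fix e :: real assume "e > 0"
  have FQ: "continuous_on unit_cube F" using F continuous_on_subset by blast
  obtain A where A: "finite A" "0 \<in> A"
    "integral unit_cube (\<lambda>x. (F x)\<^sup>2) \<le> (\<Sum>m\<in>A. (cmod (ft F (real_vec m)))\<^sup>2) + e"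
    "integral unit_cube (\<lambda>x. (cmod (of_real (F x) - (\<Sum>m\<in>A. ft F (real_vec m) * cis (2 * pi * (real_vec m \<bullet> x)))))\<^sup>2) \<le> e"
    by (rule parseval_approx[OF F per \<open>e > 0\<close>])
  let ?I = "integral unit_cube F"
  have "integral unit_cube (\<lambda>x. (F x - ?I)\<^sup>2) = integral unit_cube (\<lambda>x. (cmod (of_real (F x) - (\<Sum>m\<in>{0}. ft F (real_vec m) * cis (2 * pi * (real_vec m \<bullet> x)))))\<^sup>2)"
    by (simp add: ft_0[OF FQ] flip: of_real_diff)
  also have "\<dots> = integral unit_cube (\<lambda>x. (F x)\<^sup>2) - (cmod (ft F 0))\<^sup>2"
    by (subst L2_distance_trig[OF FQ]) auto
  also have "\<dots> \<le> (\<Sum>m\<in>A. (cmod (ft F (real_vec m)))\<^sup>2) - (cmod (ft F 0))\<^sup>2 + e"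
    using A(3) by simp
  also have "\<dots> = (\<Sum>m\<in>A-{0}. (cmod (ft F (real_vec m)))\<^sup>2) + e"
    using A by (simp add: sum_diff1)
  finally have "ennreal (integral unit_cube (\<lambda>x. (F x - ?I)\<^sup>2)) \<le>
      ennreal (\<Sum>m\<in>A-{0}. (cmod (ft F (real_vec m)))\<^sup>2) + ennreal e"
    using \<open>e > 0\<close> by (simp add: sum_nonneg flip: ennreal_plus)
  also have "ennreal (\<Sum>m\<in>A-{0}. (cmod (ft F (real_vec m)))\<^sup>2) =
      (\<integral>\<^sup>+ m. ennreal ((cmod (ft F (real_vec m)))\<^sup>2) \<partial>count_space (A-{0}))"
    using A(1) by (simp add: nn_integral_count_space_finite)
  also have "\<dots> \<le> (\<integral>\<^sup>+ m. ennreal ((cmod (ft F (real_vec m)))\<^sup>2) \<partial>count_space (- {0}))"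
    by (subst (1 2) nn_integral_count_space_indicator)
      (auto intro!: nn_integral_mono simp: indicator_def)
  finally show "ennreal (integral unit_cube (\<lambda>x. (F x - ?I)\<^sup>2)) \<le>
     (\<integral>\<^sup>+ m. ennreal ((cmod (ft F (real_vec m)))\<^sup>2) \<partial>count_space (- {0})) + ennreal e"
    by (simp add: add_right_mono)
qed

text \<open>Only mean-square approximation by Fourier sums is at hand, not uniform convergence.
  Every partial sum stays within M of the mean, so the part of |F - mean| exceeding M has L2 norm
  zero, and continuity makes it vanish everywhere.\<close>

lemma periodic_sup_bound:
  fixes F :: "real^'n::finite \<Rightarrow> real"
  assumes F: "continuous_on UNIV F" and per: "\<And>x m. F (x + real_vec m) = F x"
    and M: "\<And>A. finite A \<Longrightarrow> 0 \<notin> A \<Longrightarrow> (\<Sum>m\<in>A. cmod (ft F (real_vec m))) \<le> M"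
    and v: "v \<in> unit_cube"
  shows "\<bar>F v - integral unit_cube F\<bar> \<le> M"
proof -
  have FQ: "continuous_on unit_cube F" using F continuous_on_subset by blast
  let ?I = "integral unit_cube F"
  \<comment> \<open>The squared excess over M: continuous, nonnegative, and bounded by the squared
    distance from F to any Fourier partial sum whose index set contains 0.\<close>
  let ?g = "\<lambda>x. (max 0 (\<bar>F x - ?I\<bar> - M))\<^sup>2"
  have gc: "continuous_on unit_cube ?g" by (intro continuous_intros FQ)
  have "integral unit_cube ?g \<le> e" if "e > 0" for e :: real
  proof -
    obtain A where A: "finite A" "0 \<in> A"
      "integral unit_cube (\<lambda>x. (F x)\<^sup>2) \<le> (\<Sum>m\<in>A. (cmod (ft F (real_vec m)))\<^sup>2) + e" and
      le: "integral unit_cube (\<lambda>x. (cmod (of_real (F x) - (\<Sum>m\<in>A. ft F (real_vec m) * cis (2 * pi * (real_vec m \<bullet> x)))))\<^sup>2) \<le> e"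
      by (rule parseval_approx[OF F per \<open>e > 0\<close>])
    have "?g x \<le> (cmod (of_real (F x) - (\<Sum>m\<in>A. ft F (real_vec m) * cis (2 * pi * (real_vec m \<bullet> x)))))\<^sup>2" for x
    proof -
      let ?S = "\<Sum>m\<in>A-{0}. ft F (real_vec m) * cis (2 * pi * (real_vec m \<bullet> x))"
      have "cmod ?S \<le> (\<Sum>m\<in>A-{0}. cmod (ft F (real_vec m)))"
        by (rule order_trans[OF norm_sum]) (simp add: norm_mult)
      also have "\<dots> \<le> M" using A by (intro M) auto
      finally have "cmod ?S \<le> M" .
      have "complex_of_real (F x) - (\<Sum>m\<in>A. ft F (real_vec m) * cis (2 * pi * (real_vec m \<bullet> x))) = of_real (F x - ?I) - ?S"
        using A by (subst sum.remove[of A 0]) (auto simp: ft_0[OF FQ])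
      moreover have "cmod (of_real (F x - ?I) - ?S) \<ge> cmod (of_real (F x - ?I)) - cmod ?S"
        by (rule norm_triangle_ineq2)
      ultimately have "\<bar>F x - ?I\<bar> - M \<le> cmod (of_real (F x) - (\<Sum>m\<in>A. ft F (real_vec m) * cis (2 * pi * (real_vec m \<bullet> x))))"
        using \<open>cmod ?S \<le> M\<close> by (simp only: norm_of_real)
      then show ?thesis by (intro power_mono) auto
    qed
    then have "integral unit_cube ?g \<le> integral unit_cube (\<lambda>x. (cmod (of_real (F x) - (\<Sum>m\<in>A. ft F (real_vec m) * cis (2 * pi * (real_vec m \<bullet> x)))))\<^sup>2)"
      by (intro integral_le integrable_continuous gc continuous_intros FQ) auto
    with le show ?thesis by linarith
  qed
  then have "integral unit_cube ?g \<le> 0" by (rule field_le_epsilon[of _ 0, simplified])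
  moreover have "integral unit_cube ?g \<ge> 0"
    by (intro Henstock_Kurzweil_Integration.integral_nonneg integrable_continuous gc) auto
  ultimately have "integral unit_cube ?g = 0" by simp
  moreover have "(?g has_integral integral unit_cube ?g) unit_cube"
    by (intro integrable_integral integrable_continuous gc)
  ultimately have g0: "(?g has_integral 0) unit_cube" by simp
  have "?g v = 0"
    by (rule has_integral_0_cbox_imp_0[OF gc _ g0 _ v]) (auto simp: box_ne_empty Basis_vec_def inner_axis)
  then show ?thesis by (simp add: max_def split: if_splits)
qed

section \<open>Linear substitution and periodization\<close>

lemma nn_integral_lborel_coord:
  fixes f :: "'a::euclidean_space \<Rightarrow> ennreal"
  assumes [measurable]: "f \<in> borel_measurable borel" and b: "b \<in> Basis"
  shows "(\<integral>\<^sup>+x. f x \<partial>lborel) =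
    (\<integral>\<^sup>+y. (\<integral>\<^sup>+t. f ((\<Sum>c\<in>Basis-{b}. y c *\<^sub>R c) + t *\<^sub>R b) \<partial>lborel) \<partial>(\<Pi>\<^sub>M c\<in>Basis-{b}. lborel))"
proof -
  interpret product_sigma_finite "\<lambda>_::'a. lborel :: real measure" ..
  let ?I = "Basis - {b}"
  have I: "insert b ?I = Basis" using b by auto
  let ?g = "\<lambda>y. f (\<Sum>c\<in>Basis. y c *\<^sub>R c)"
  have g: "?g (y(b := t)) = f ((\<Sum>c\<in>?I. y c *\<^sub>R c) + t *\<^sub>R b)" for y t
  proof -
    have "(\<Sum>c\<in>Basis. (y(b := t)) c *\<^sub>R c) = t *\<^sub>R b + (\<Sum>c\<in>?I. (y(b := t)) c *\<^sub>R c)"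
      using b by (subst sum.remove[of _ b]) auto
    also have "(\<Sum>c\<in>?I. (y(b := t)) c *\<^sub>R c) = (\<Sum>c\<in>?I. y c *\<^sub>R c)" by (rule sum.cong) auto
    finally show ?thesis by (simp add: add.commute)
  qed
  have "(\<integral>\<^sup>+x. f x \<partial>lborel) = (\<integral>\<^sup>+y. ?g y \<partial>(\<Pi>\<^sub>M c\<in>Basis. lborel))"
    by (subst lborel_eq) (simp add: nn_integral_distr)
  also have "\<dots> = (\<integral>\<^sup>+y. ?g y \<partial>(\<Pi>\<^sub>M c\<in>insert b ?I. lborel))"
    by (simp only: I)
  also have "\<dots> = (\<integral>\<^sup>+y. (\<integral>\<^sup>+t. ?g (y(b := t)) \<partial>lborel) \<partial>(\<Pi>\<^sub>M c\<in>?I. lborel))"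
    by (rule product_nn_integral_insert) (auto simp: I)
  finally show ?thesis by (simp only: g)
qed

text \<open>With all coordinates but m held fixed, and n is among these because m \<noteq> n, the
  shear is a translation of coordinate m.\<close>

lemma nn_integral_shear:
  fixes f :: "real^'n::finite \<Rightarrow> ennreal"
  assumes [measurable]: "f \<in> borel_measurable borel" and mn: "m \<noteq> n"
  shows "(\<integral>\<^sup>+x. f (x + x $ n *\<^sub>R axis m 1) \<partial>lborel) = (\<integral>\<^sup>+x. f x \<partial>lborel)"
proof -
  let ?b = "axis m 1 :: real^'n"
  have b: "?b \<in> Basis" by (auto simp: Basis_vec_def)
  have [measurable]: "(\<lambda>x::real^'n. x + x $ n *\<^sub>R ?b) \<in> borel_measurable borel"
    by (intro borel_measurable_continuous_onI continuous_intros)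
  have "(\<integral>\<^sup>+t. f ((w + t *\<^sub>R ?b) + (w + t *\<^sub>R ?b) $ n *\<^sub>R ?b) \<partial>lborel) = (\<integral>\<^sup>+t. f (w + t *\<^sub>R ?b) \<partial>lborel)" for w
  proof -
    have "(w + t *\<^sub>R ?b) + (w + t *\<^sub>R ?b) $ n *\<^sub>R ?b = w + (w $ n + 1 * t) *\<^sub>R ?b" for t
      using mn by (simp add: axis_def algebra_simps)
    then have "(\<integral>\<^sup>+t. f ((w + t *\<^sub>R ?b) + (w + t *\<^sub>R ?b) $ n *\<^sub>R ?b) \<partial>lborel) =
        (\<integral>\<^sup>+t. f (w + (w $ n + 1 * t) *\<^sub>R ?b) \<partial>lborel)" by (simp only:)
    then show ?thesis
      using nn_integral_real_affine[of "\<lambda>t. f (w + t *\<^sub>R ?b)" 1 "w $ n"] by simp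
  qed
  note shift = this
  show ?thesis
    unfolding nn_integral_lborel_coord[OF assms(1) b]
    by (subst nn_integral_lborel_coord[OF _ b]) (measurable, simp only: shift)
qed

text \<open>Exchanging coordinates maps boxes to boxes with the same side lengths, and
  \<open>lborel\<close> is determined by its values on boxes.\<close>

lemma nn_integral_transpose_coords:
  fixes f :: "real^'n::finite \<Rightarrow> ennreal"
  assumes [measurable]: "f \<in> borel_measurable borel"
  shows "(\<integral>\<^sup>+x. f (\<chi> i. x $ Transposition.transpose m n i) \<partial>lborel) = (\<integral>\<^sup>+x. f x \<partial>lborel)"
proof -
  let ?p = "Transposition.transpose m n" and ?g = "\<lambda>x::real^'n. \<chi> i. x $ Transposition.transpose m n i"
  have [measurable]: "?g \<in> borel_measurable borel"
    by (intro borel_measurable_continuous_onI continuous_intros)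
  have "lborel = distr lborel borel ?g"
  proof (rule lborel_eqI)
    fix l u :: "real^'n" assume lu: "\<And>b. b \<in> Basis \<Longrightarrow> l \<bullet> b \<le> u \<bullet> b"
    have lu': "l $ i \<le> u $ i" for i using lu[of "axis i 1"] by (auto simp: inner_axis Basis_vec_def)
    have "?g x \<in> box l u \<longleftrightarrow> x \<in> box (?g l) (?g u)" for x
      unfolding mem_box_cart by (auto, (metis transpose_involutory)+)
    then have "emeasure (distr lborel borel ?g) (box l u) = emeasure lborel (box (?g l) (?g u))"
      by (subst emeasure_distr) (auto simp: vimage_def)
    also have "\<dots> = (\<Prod>b\<in>Basis. (?g u - ?g l) \<bullet> b)"
      by (rule emeasure_lborel_box) (auto simp: Basis_vec_def inner_axis lu')
    also have "(\<Prod>b\<in>Basis. (?g u - ?g l) \<bullet> b) = (\<Prod>i\<in>UNIV. u $ ?p i - l $ ?p i)"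
      by (subst prod.reindex_bij_betw[OF bij_betw_axis_Basis, symmetric]) (simp add: inner_axis)
    also have "\<dots> = (\<Prod>i\<in>UNIV. u $ i - l $ i)"
      by (rule prod.reindex_bij_betw[OF bij_transpose])
    also have "\<dots> = (\<Prod>b\<in>Basis. (u - l) \<bullet> b)"
      by (subst prod.reindex_bij_betw[OF bij_betw_axis_Basis, symmetric]) (simp add: inner_axis)
    finally show "emeasure (distr lborel borel ?g) (box l u) = (\<Prod>b\<in>Basis. (u - l) \<bullet> b)" .
  qed simp
  moreover have "(\<integral>\<^sup>+x. f x \<partial>distr lborel borel ?g) = (\<integral>\<^sup>+x. f (?g x) \<partial>lborel)"
    by (rule nn_integral_distr) auto
  ultimately show ?thesis by simp
qed

lemma nn_integral_diagonal:
  fixes f :: "real^'n::finite \<Rightarrow> ennreal"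
  assumes [measurable]: "f \<in> borel_measurable borel" and c: "\<And>i. c i \<noteq> 0"
  shows "ennreal \<bar>\<Prod>i\<in>UNIV. c i\<bar> * (\<integral>\<^sup>+x. f (\<chi> i. c i * x $ i) \<partial>lborel) = (\<integral>\<^sup>+x. f x \<partial>lborel)"
proof -
  \<comment> \<open>Re-indexes the family c from coordinates to basis vectors: only the factor whose
    axis vector equals b can differ from 1.\<close>
  let ?c = "\<lambda>b::real^'n. \<Prod>i\<in>UNIV. if b = axis i 1 then c i else 1"
  have ax: "?c (axis i 1) = c i" for i :: 'n
    by (simp add: axis_eq_axis)
  let ?T = "\<lambda>x::real^'n. 0 + (\<Sum>b\<in>Basis. (?c b * (x \<bullet> b)) *\<^sub>R b)"
  have T: "?T x = (\<chi> i. c i * x $ i)" for x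
  proof -
    have "(\<Sum>b\<in>Basis. (?c b * (x \<bullet> b)) *\<^sub>R b) = (\<Sum>i\<in>UNIV. (c i * x $ i) *\<^sub>R axis i 1)"
      by (subst sum.reindex_bij_betw[OF bij_betw_axis_Basis, symmetric]) (simp add: ax inner_axis)
    then show ?thesis by (simp add: vec_eq_iff axis_def if_distrib cong: if_cong)
  qed
  have "lborel = density (distr lborel borel ?T) (\<lambda>_. \<Prod>b\<in>Basis. \<bar>?c b\<bar>)"
    by (rule lborel_affine_euclidean) (auto simp: Basis_vec_def ax c)
  also have "(\<Prod>b\<in>Basis. \<bar>?c b\<bar>) = \<bar>\<Prod>i\<in>UNIV. c i\<bar>"
    by (subst prod.reindex_bij_betw[OF bij_betw_axis_Basis, symmetric]) (simp add: ax abs_prod)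
  finally have eq: "lborel = density (distr lborel borel ?T) (\<lambda>_. ennreal \<bar>\<Prod>i\<in>UNIV. c i\<bar>)" .
  have [measurable]: "?T \<in> borel_measurable borel" by measurable
  have "(\<integral>\<^sup>+x. f x \<partial>lborel) = ennreal \<bar>\<Prod>i\<in>UNIV. c i\<bar> * (\<integral>\<^sup>+x. f (?T x) \<partial>lborel)"
    by (subst eq, subst nn_integral_density) (simp_all add: nn_integral_distr nn_integral_cmult)
  then show ?thesis unfolding T ..
qed

lemma matrix_vector_mult_measurable [measurable]:
  "(\<lambda>x::real^'n. A *v x) \<in> borel_measurable borel"
  by (intro borel_measurable_continuous_onI matrix_vector_mult_linear_continuous_on)

text \<open>Induction over elementary matrices: the formula is multiplicative in A, a zero row
  contradicts the nonzero determinant, and diagonal matrices, transpositions and shears are the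
  three cases proved above.\<close>

lemma nn_integral_linear_substitution:
  fixes f :: "real^'n::finite \<Rightarrow> ennreal"
  assumes "f \<in> borel_measurable borel" "det A \<noteq> 0"
  shows "ennreal \<bar>det A\<bar> * (\<integral>\<^sup>+x. f (A *v x) \<partial>lborel) = (\<integral>\<^sup>+x. f x \<partial>lborel)"
  using assms
proof (induction A arbitrary: f rule: induct_matrix_elementary_alt)
  case (1 A B)
  note [measurable] = \<open>f \<in> borel_measurable borel\<close>
  have AB: "det A \<noteq> 0" "det B \<noteq> 0" using 1 by (auto simp: det_mul)
  have "ennreal \<bar>det (A ** B)\<bar> * (\<integral>\<^sup>+x. f ((A ** B) *v x) \<partial>lborel) =
      ennreal \<bar>det A\<bar> * (ennreal \<bar>det B\<bar> * (\<integral>\<^sup>+x. f (A *v (B *v x)) \<partial>lborel))"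
    by (simp add: det_mul abs_mult ennreal_mult mult.assoc matrix_vector_mul_assoc)
  also have "\<dots> = ennreal \<bar>det A\<bar> * (\<integral>\<^sup>+x. f (A *v x) \<partial>lborel)"
    by (subst "1.IH"(2)[OF _ AB(2)]) auto
  also have "\<dots> = (\<integral>\<^sup>+x. f x \<partial>lborel)" by (rule "1.IH"(1)[OF _ AB(1)]) auto
  finally show ?case .
next
  case (2 A i)
  then show ?case by (simp add: det_zero_row)
next
  case (3 A)
  have d: "det A = (\<Prod>i\<in>UNIV. A $ i $ i)" using 3 by (intro det_diagonal) auto
  have A: "A *v x = (\<chi> i. A $ i $ i * x $ i)" for x
  proof -
    have "(\<Sum>j\<in>UNIV. A $ i $ j * x $ j) = (\<Sum>j\<in>UNIV. if j = i then A $ i $ j * x $ j else 0)" for i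
      using 3 by (intro sum.cong) auto
    then show ?thesis by (simp add: vec_eq_iff matrix_vector_mult_def)
  qed
  show ?case unfolding d A
    using 3 by (intro nn_integral_diagonal) (auto simp: d)
next
  case (4 m n)
  let ?A = "\<chi> i j. mat 1 $ i $ Transposition.transpose m n j :: real^'n^'n"
  have "det ?A = of_int (sign (Transposition.transpose m n)) * det (mat 1 :: real^'n^'n)"
    by (rule det_permute_columns) (simp add: permutes_swap_id)
  then have "\<bar>det ?A\<bar> = 1" by (simp add: abs_sign sign_def)
  moreover have "?A *v x = (\<chi> i. x $ Transposition.transpose m n i)" for x
  proof -
    have "(\<Sum>j\<in>UNIV. mat 1 $ i $ Transposition.transpose m n j * x $ j) =
        (\<Sum>j\<in>UNIV. if j = Transposition.transpose m n i then x $ j else 0)" for i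
      by (intro sum.cong refl) (auto simp: mat_def)
    then show ?thesis by (simp add: vec_eq_iff matrix_vector_mult_def)
  qed
  ultimately show ?case using 4 by (simp add: nn_integral_transpose_coords)
next
  case (5 m n)
  let ?A = "\<chi> i j. of_bool (i = m \<and> j = n \<or> i = j) :: real^'n^'n"
  have "?A = (\<chi> k. if k = m then row m (mat 1) + 1 *s row n (mat 1) else row k (mat 1))"
    using \<open>m \<noteq> n\<close> by (auto simp: vec_eq_iff row_def mat_def)
  then have "det ?A = det (mat 1 :: real^'n^'n)"
    by (simp only: det_row_operation[OF \<open>m \<noteq> n\<close>])
  then have "det ?A = 1" by simp
  moreover have "?A *v x = x + x $ n *\<^sub>R axis m 1" for x
  proof -
    have "(\<Sum>j\<in>UNIV. of_bool (i = m \<and> j = n \<or> i = j) * x $ j) =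
        (\<Sum>j\<in>UNIV. (if j = i then x $ j else 0) + (if j = n then (if i = m then x $ j else 0) else 0))" for i
      using \<open>m \<noteq> n\<close> by (intro sum.cong) auto
    then show ?thesis by (simp add: vec_eq_iff matrix_vector_mult_def sum.distrib axis_def)
  qed
  ultimately show ?case using 5 by (simp add: nn_integral_shear)
qed

lemma lborel_linear_substitution:
  fixes A :: "real^'n::finite^'n"
  assumes "det A \<noteq> 0"
  shows "lborel = density (distr lborel borel ((*v) A)) (\<lambda>_. ennreal \<bar>det A\<bar>)"
proof (rule measure_eqI)
  fix X :: "(real^'n) set" assume "X \<in> sets lborel"
  then have [measurable]: "X \<in> sets borel" by simp
  have "emeasure lborel X = (\<integral>\<^sup>+x. indicator X x \<partial>lborel)" by simp
  also have "\<dots> = ennreal \<bar>det A\<bar> * (\<integral>\<^sup>+x. indicator X (A *v x) \<partial>lborel)"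
    by (rule nn_integral_linear_substitution[symmetric]) (use assms in auto)
  also have "\<dots> = emeasure (density (distr lborel borel ((*v) A)) (\<lambda>_. ennreal \<bar>det A\<bar>)) X"
    using nn_integral_distr[of "(*v) A" lborel borel "indicator X"]
    by (simp add: emeasure_density nn_integral_cmult)
  finally show "emeasure lborel X = emeasure (density (distr lborel borel ((*v) A)) (\<lambda>_. ennreal \<bar>det A\<bar>)) X" .
qed simp

lemma lborel_integral_linear_substitution:
  fixes f :: "real^'n::finite \<Rightarrow> 'b::{banach,second_countable_topology}"
  assumes [measurable]: "f \<in> borel_measurable borel" and A: "det A \<noteq> 0"
  shows "(LINT x|lborel. f x) = \<bar>det A\<bar> *\<^sub>R (LINT x|lborel. f (A *v x))"
  by (subst lborel_linear_substitution[OF A], subst integral_density) (simp_all add: integral_distr)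

section \<open>Unfolding over integer cells, and periodization\<close>

definition half_open_cube :: "(real^'n::finite) set" where
  "half_open_cube = {x. \<forall>i. 0 \<le> x $ i \<and> x $ i < 1}"

lemma half_open_cube_borel [measurable]: "half_open_cube \<in> sets borel"
proof -
  have c: "{x::real^'n. 0 \<le> x $ i} \<in> sets borel" "{x::real^'n. x $ i < 1} \<in> sets borel" for i
    by (auto intro!: borel_closed borel_open closed_Collect_le open_Collect_less continuous_intros)
  have "half_open_cube = (\<Inter>i. {x::real^'n. 0 \<le> x $ i} \<inter> {x. x $ i < 1})"
    by (auto simp: half_open_cube_def)
  also have "\<dots> \<in> sets borel" using c by (intro sets.finite_INT sets.Int) auto
  finally show ?thesis .
qed

lemma AE_half_open_cube:
  "AE x in lborel. indicator half_open_cube (x :: real^'n::finite) = (indicator unit_cube x :: real)"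
proof -
  let ?N = "unit_cube - box (vec 0) (vec 1) :: (real^'n) set"
  have "emeasure lborel ?N = emeasure lborel (unit_cube :: (real^'n) set) - emeasure lborel (box (vec 0) (vec 1) :: (real^'n) set)"
    by (intro emeasure_Diff) (auto simp: emeasure_lborel_box_eq box_subset_cbox)
  also have "\<dots> = 0"
    by (simp add: emeasure_lborel_box_eq emeasure_lborel_cbox_eq less_imp_le)
  finally have "AE x in lborel. x \<notin> ?N" by (intro AE_not_in null_setsI) auto
  moreover have "box (vec 0) (vec 1) \<subseteq> (half_open_cube :: (real^'n) set)"
    by (auto simp: half_open_cube_def mem_box_cart less_imp_le)
  moreover have "half_open_cube \<subseteq> (unit_cube :: (real^'n) set)"
    by (auto simp: half_open_cube_def mem_box_cart less_imp_le)
  ultimately show ?thesis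
    by (auto elim!: eventually_mono split: split_indicator)
qed

definition floor_vec :: "real^'n \<Rightarrow> int^'n" where
  "floor_vec x = (\<chi> i. \<lfloor>x $ i\<rfloor>)"

lemma diff_real_vec_in_half_open_cube:
  "x - real_vec m \<in> half_open_cube \<longleftrightarrow> m = floor_vec x"
proof -
  have "0 \<le> t - of_int k \<and> t - of_int k < 1 \<longleftrightarrow> k = \<lfloor>t\<rfloor>" for t :: real and k
    unfolding eq_commute[of k] floor_eq_iff by auto
  then show ?thesis
    by (simp add: half_open_cube_def real_vec_def floor_vec_def vec_eq_iff)
qed

text \<open>The integer translates of the half-open cube tile the space, so h splits into its
  restrictions to the cells, each translated back to the base cell; the closed cube differs from
  that cell by a null set. A collects the cells that the support of h can meet, which keeps the sum
  finite.\<close>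

lemma lborel_integral_unfold:
  fixes h :: "real^'n::finite \<Rightarrow> 'b::{banach,second_countable_topology}"
  assumes h: "integrable lborel h" and A: "finite A" "\<And>x. h x \<noteq> 0 \<Longrightarrow> floor_vec x \<in> A"
  shows "(LINT x|lborel. h x) = (LINT x|lborel. indicator unit_cube x *\<^sub>R (\<Sum>m\<in>A. h (x + real_vec m)))"
proof -
  have [measurable]: "h \<in> borel_measurable borel" using h by auto
  have hm: "integrable lborel (\<lambda>x. h (x + real_vec m))" for m
    using h lborel_distr_plus[of "real_vec m :: real^'n"]
      integrable_distr_eq[of "(+) (real_vec m)" lborel borel h] by (simp add: add.commute)
  have shift: "(LINT x|lborel. indicator half_open_cube (x - real_vec m) *\<^sub>R h x) =
      (LINT x|lborel. indicator half_open_cube x *\<^sub>R h (x + real_vec m))" for m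
    using integral_distr[of "(+) (real_vec m)" lborel borel "\<lambda>x. indicator half_open_cube (x - real_vec m) *\<^sub>R h x"]
      lborel_distr_plus[of "real_vec m :: real^'n"] by (simp add: add.commute)
  have "h x = (\<Sum>m\<in>A. indicator half_open_cube (x - real_vec m) *\<^sub>R h x)" for x
  proof (cases "h x = 0")
    case False
    have "(\<Sum>m\<in>A. indicator half_open_cube (x - real_vec m) *\<^sub>R h x) = (\<Sum>m\<in>A. if m = floor_vec x then h x else 0)"
      by (intro sum.cong refl) (simp add: indicator_def diff_real_vec_in_half_open_cube)
    then show ?thesis using A False by simp
  qed simp
  then have "(LINT x|lborel. h x) = (LINT x|lborel. (\<Sum>m\<in>A. indicator half_open_cube (x - real_vec m) *\<^sub>R h x))"
    by simp
  also have "\<dots> = (\<Sum>m\<in>A. LINT x|lborel. indicator half_open_cube (x - real_vec m) *\<^sub>R h x)"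
    by (intro Bochner_Integration.integral_sum Bochner_Integration.integrable_bound[OF h]) (auto simp: indicator_def)
  also have "\<dots> = (\<Sum>m\<in>A. LINT x|lborel. indicator half_open_cube x *\<^sub>R h (x + real_vec m))"
    by (simp only: shift)
  also have "\<dots> =
     (LINT x|lborel. (\<Sum>m\<in>A. indicator half_open_cube x *\<^sub>R h (x + real_vec m)))"
    by (intro Bochner_Integration.integral_sum[symmetric] Bochner_Integration.integrable_bound[OF hm])
      (auto simp: indicator_def)
  also have "\<dots> = (LINT x|lborel. indicator unit_cube x *\<^sub>R (\<Sum>m\<in>A. h (x + real_vec m)))"
    by (intro integral_cong_AE)
      (use AE_half_open_cube in \<open>auto simp: scaleR_sum_right elim!: eventually_mono\<close>)
  finally show ?thesis .
qed

lemma finite_bounded_int_vec: "finite {m :: int^'n::finite. \<forall>i. \<bar>m $ i\<bar> \<le> N}"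
proof -
  have "{m :: int^'n. \<forall>i. \<bar>m $ i\<bar> \<le> N} \<subseteq> (\<lambda>f. \<chi> i. f i) ` (PiE UNIV (\<lambda>_. {-N..N}))"
  proof
    fix m :: "int^'n" assume "m \<in> {m. \<forall>i. \<bar>m $ i\<bar> \<le> N}"
    then have "\<bar>m $ i\<bar> \<le> N" for i by simp
    then have "- N \<le> m $ i \<and> m $ i \<le> N" for i using abs_le_iff minus_le_iff by blast
    then have "($) m \<in> PiE UNIV (\<lambda>_. {-N..N})" by (simp add: PiE_UNIV_domain)
    moreover have "m = (\<chi> i. m $ i)" by simp
    ultimately show "m \<in> (\<lambda>f. \<chi> i. f i) ` (PiE UNIV (\<lambda>_. {-N..N}))" by (intro image_eqI[where x="($) m"]) simp_all
  qed
  then show ?thesis by (rule finite_subset) (intro finite_imageI finite_PiE; auto)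
qed

lemma finite_real_vec_ball: "finite {m :: int^'n::finite. norm (real_vec m + v) \<le> R}"
proof (rule finite_subset[OF _ finite_bounded_int_vec])
  show "{m :: int^'n. norm (real_vec m + v) \<le> R} \<subseteq> {m. \<forall>i. \<bar>m $ i\<bar> \<le> \<lceil>R + norm v\<rceil>}"
  proof safe
    fix m :: "int^'n" and i assume *: "norm (real_vec m + v) \<le> R"
    have "norm (real_vec m) \<le> R + norm v" using * norm_diff_ineq[of "real_vec m" v] by linarith
    then have "\<bar>real_vec m $ i\<bar> \<le> R + norm v" using component_le_norm_cart[of "real_vec m" i] by linarith
    then have "real_of_int \<bar>m $ i\<bar> \<le> R + norm v" by (simp add: real_vec_def)
    then show "\<bar>m $ i\<bar> \<le> \<lceil>R + norm v\<rceil>" by (simp add: le_ceiling_iff)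
  qed
qed

definition periodize :: "(real^'n::finite \<Rightarrow> real) \<Rightarrow> real^'n \<Rightarrow> real" where
  "periodize H v = (\<Sum>\<^sub>\<infinity>m. H (real_vec m + v))"

text \<open>The index set depends on v only through the bound r, so near any point
  \<open>periodize H\<close> is one fixed finite sum. Its continuity follows from that.\<close>

lemma periodize_eq_sum:
  assumes "\<And>w. R < norm w \<Longrightarrow> H w = 0" "norm v \<le> r"
  shows "periodize H v = (\<Sum>m | norm (real_vec m) \<le> R + r. H (real_vec m + v))"
proof -
  have z: "H (real_vec m + v) = 0" if "m \<notin> {m. norm (real_vec m) \<le> R + r}" for m
    using that assms(2) norm_diff_ineq[of "real_vec m" v] by (intro assms(1)) auto
  have "finite {m::int^'a. norm (real_vec m) \<le> R + r}"
    using finite_real_vec_ball[of 0] by simp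
  then have "(\<Sum>m | norm (real_vec m) \<le> R + r. H (real_vec m + v)) = (\<Sum>\<^sub>\<infinity>m\<in>{m. norm (real_vec m) \<le> R + r}. H (real_vec m + v))"
    by simp
  also have "\<dots> = (\<Sum>\<^sub>\<infinity>m. H (real_vec m + v))"
    by (rule infsum_cong_neutral) (use z in auto)
  finally show ?thesis by (simp add: periodize_def)
qed

lemma periodize_periodic: "periodize H (x + real_vec m) = periodize H x"
proof -
  have "bij (\<lambda>k. k + m)" by (rule bij_plus_right)
  from infsum_reindex_bij_betw[OF this, of "\<lambda>k. H (real_vec k + x)"]
  show ?thesis by (simp add: periodize_def real_vec_add add_ac)
qed

lemma continuous_periodize:
  assumes H: "continuous_on UNIV H" and R: "\<And>w. R < norm w \<Longrightarrow> H w = 0"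
  shows "continuous_on UNIV (periodize H)"
proof -
  have "continuous (at v) (periodize H)" for v
  proof -
    have "continuous_on (ball v 1) (\<lambda>w. \<Sum>m | norm (real_vec m) \<le> R + (norm v + 1). H (real_vec m + w))"
      by (intro continuous_intros continuous_on_compose2[OF H]) auto
    moreover have "norm w \<le> norm v + 1" if "w \<in> ball v 1" for w
      using that norm_triangle_sub[of w v] by (auto simp: dist_norm norm_minus_commute)
    ultimately have "continuous_on (ball v 1) (periodize H)"
      by (subst continuous_on_cong[OF refl periodize_eq_sum[OF R, where r="norm v + 1"]]) auto
    then show ?thesis by (simp add: continuous_on_eq_continuous_at)
  qed
  then show ?thesis by (simp add: continuous_on_eq_continuous_at)
qed

lemma integrable_bounded_support:
  fixes h :: "real^'n::finite \<Rightarrow> 'b::euclidean_space"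
  assumes "continuous_on UNIV h" "\<And>w. R < norm w \<Longrightarrow> h w = 0"
  shows "integrable lborel h"
proof -
  have "integrable lborel (\<lambda>x. indicator (cball 0 R) x *\<^sub>R h x)"
    using assms(1) by (intro borel_integrable_compact) (auto intro: continuous_on_subset)
  moreover have "(\<lambda>x. indicator (cball 0 R) x *\<^sub>R h x) = h"
    using assms(2) by (auto simp: fun_eq_iff indicator_def)
  ultimately show ?thesis by simp
qed

lemma lborel_integral_cube:
  fixes h :: "real^'n::finite \<Rightarrow> 'b::euclidean_space"
  assumes "continuous_on unit_cube h"
  shows "(LINT x|lborel. indicator unit_cube x *\<^sub>R h x) = integral unit_cube h"
  using set_borel_integral_eq_integral(2)[of unit_cube h] borel_integrable_compact[of unit_cube h] assms
  by (simp add: set_integrable_def set_lebesgue_integral_def)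

lemma lborel_integral_eq_integral_cube:
  fixes h :: "real^'n::finite \<Rightarrow> 'b::euclidean_space"
  assumes "continuous_on UNIV h" "\<And>x. x \<notin> unit_cube \<Longrightarrow> h x = 0"
  shows "(LINT x|lborel. h x) = integral unit_cube h"
proof -
  have "(\<lambda>x. indicator unit_cube x *\<^sub>R h x) = h"
    using assms(2) by (auto simp: fun_eq_iff indicator_def)
  with lborel_integral_cube[of h] show ?thesis using assms(1) continuous_on_subset[of UNIV h unit_cube] by simp
qed

lemma floor_vec_norm:
  assumes "norm (x::real^'n::finite) \<le> R"
  shows "norm (real_vec (floor_vec x)) \<le> R + real CARD('n)"
proof -
  have "norm (x - real_vec (floor_vec x)) \<le> (\<Sum>i\<in>UNIV. \<bar>(x - real_vec (floor_vec x)) $ i\<bar>)"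
    by (rule norm_le_l1_cart)
  also have "\<dots> \<le> (\<Sum>i::'n\<in>UNIV. 1)"
    by (intro sum_mono) (simp add: real_vec_def floor_vec_def abs_le_iff; linarith)
  finally show ?thesis using assms norm_triangle_ineq2[of "real_vec (floor_vec x)" x]
    by (simp add: norm_minus_commute)
qed

text \<open>The coefficient side of Poisson summation: characters of integer frequency are invariant
  under integer translations, so unfolding turns a coefficient of the periodization into an integral
  over the whole space. That integral is not an \<open>ft\<close>, because the support of H may
  leave the cube.\<close>

lemma ft_periodize:
  fixes H :: "real^'n::finite \<Rightarrow> real"
  assumes H: "continuous_on UNIV H" and R: "\<And>w. R < norm w \<Longrightarrow> H w = 0"
  shows "ft (periodize H) (real_vec k) = (LINT w|lborel. of_real (H w) * cis (- (2 * pi * (real_vec k \<bullet> w))))"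
proof -
  let ?h = "\<lambda>w. of_real (H w) * cis (- (2 * pi * (real_vec k \<bullet> w)))"
  \<comment> \<open>Bounds both the norm of a point of the cube and the distance of a point from its
    integer part, each through the l1 norm.\<close>
  define N where "N = real CARD('n)"
  define A where "A = {m::int^'n. norm (real_vec m) \<le> R + N}"
  have h: "continuous_on UNIV ?h" by (intro continuous_intros H)
  have "finite A" using finite_real_vec_ball[of 0] by (simp add: A_def)
  have "(LINT w|lborel. ?h w) = (LINT x|lborel. indicator unit_cube x *\<^sub>R (\<Sum>m\<in>A. ?h (x + real_vec m)))"
  proof (rule lborel_integral_unfold[OF integrable_bounded_support[OF h]])
    show "floor_vec x \<in> A" if "?h x \<noteq> 0" for x
      using that R[of x] floor_vec_norm[of x R] by (auto simp: A_def N_def not_less[symmetric])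
  qed (use R \<open>finite A\<close> in auto)
  also have "\<dots> = integral unit_cube (\<lambda>x. \<Sum>m\<in>A. ?h (x + real_vec m))"
    by (intro lborel_integral_cube continuous_intros continuous_on_compose2[OF H]) auto
  also have "\<dots> = integral unit_cube (\<lambda>x. of_real (periodize H x) * cis (- (2 * pi * (real_vec k \<bullet> x))))"
  proof (rule Henstock_Kurzweil_Integration.integral_cong)
    fix x :: "real^'n" assume x: "x \<in> unit_cube"
    have "norm x \<le> (\<Sum>i\<in>UNIV. \<bar>x $ i\<bar>)" by (rule norm_le_l1_cart)
    also have "\<dots> \<le> (\<Sum>i::'n\<in>UNIV. 1)" using x by (intro sum_mono) (auto simp: mem_box_cart abs_le_iff intro: order_trans[of _ 0])
    finally have x: "norm x \<le> N" by (simp add: N_def)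
    have c: "cis (- (2 * pi * (real_vec k \<bullet> (x + real_vec m)))) = cis (- (2 * pi * (real_vec k \<bullet> x)))" for m :: "int^'n"
    proof -
      have "real_vec k \<bullet> real_vec m = of_int (\<Sum>i\<in>UNIV. k $ i * m $ i)"
        by (simp add: inner_vec_def real_vec_def)
      then have "cis (2 * pi * (real_vec k \<bullet> real_vec m)) = 1"
        by (simp only: cis_multiple_2pi[OF Ints_of_int])
      then show ?thesis by (simp add: inner_add_right distrib_left cis_divide[symmetric])
    qed
    have p: "periodize H x = (\<Sum>m\<in>A. H (x + real_vec m))"
      using periodize_eq_sum[OF R x] by (simp add: A_def add.commute)
    show "(\<Sum>m\<in>A. ?h (x + real_vec m)) = of_real (periodize H x) * cis (- (2 * pi * (real_vec k \<bullet> x)))"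
      by (simp only: c p of_real_sum sum_distrib_right)
  qed
  finally show ?thesis by (simp add: ft_def)
qed

text \<open>Boxes exhaust the integer vectors, so monotone convergence reduces the infinite sum to
  finite ones.\<close>

lemma nn_integral_count_space_int_vec_le:
  fixes f :: "int^'n::finite \<Rightarrow> ennreal"
  assumes "\<And>A. finite A \<Longrightarrow> A \<subseteq> X \<Longrightarrow> (\<Sum>m\<in>A. f m) \<le> C"
  shows "(\<integral>\<^sup>+m. f m \<partial>count_space X) \<le> C"
proof -
  define A where "A = (\<lambda>N::nat. {m::int^'n. \<forall>i. \<bar>m $ i\<bar> \<le> int N} \<inter> X)"
  have finA: "finite (A N)" for N unfolding A_def using finite_bounded_int_vec by blast
  have "incseq A"
  proof (rule monoI)
    fix N N' :: nat assume "N \<le> N'"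
    then have "\<bar>k\<bar> \<le> int N'" if "\<bar>k\<bar> \<le> int N" for k using that by linarith
    then show "A N \<subseteq> A N'" unfolding A_def by blast
  qed
  have un: "(\<Union>N. A N) = X"
  proof safe
    fix m assume m: "m \<in> X"
    have "\<bar>m $ i\<bar> \<le> int (nat (\<Sum>i\<in>UNIV. \<bar>m $ i\<bar>))" for i
      using member_le_sum[of i UNIV "\<lambda>i. \<bar>m $ i\<bar>"] by (simp add: sum_nonneg)
    then show "m \<in> (\<Union>N. A N)" using m unfolding A_def by blast
  qed (auto simp: A_def)
  have "f m * indicator X m = (SUP N. f m * indicator (A N) m)" for m
  proof (rule antisym)
    show "f m * indicator X m \<le> (SUP N. f m * indicator (A N) m)"
    proof (cases "m \<in> X")
      case True
      then obtain N where "m \<in> A N" using un by blast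
      then show ?thesis by (intro SUP_upper2[of N]) (use True in \<open>auto simp: indicator_def\<close>)
    qed simp
    show "(SUP N. f m * indicator (A N) m) \<le> f m * indicator X m"
      by (intro SUP_least mult_left_mono) (auto simp: A_def indicator_def)
  qed
  then have "(\<integral>\<^sup>+m. f m \<partial>count_space X) = (\<integral>\<^sup>+m. (SUP N. f m * indicator (A N) m) \<partial>count_space UNIV)"
    by (subst nn_integral_count_space_indicator) simp_all
  also have "\<dots> = (SUP N. \<integral>\<^sup>+m. f m * indicator (A N) m \<partial>count_space UNIV)"
    by (rule nn_integral_monotone_convergence_SUP)
      (use \<open>incseq A\<close> in \<open>auto simp: incseq_def le_fun_def indicator_def subset_iff\<close>)
  also have "\<dots> \<le> C"
  proof (rule SUP_least)
    fix N
    have "(\<integral>\<^sup>+m. f m * indicator (A N) m \<partial>count_space UNIV) = (\<Sum>m\<in>A N. f m)"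
      using finA[of N] by (subst nn_integral_count_space_indicator[symmetric]) (auto simp: nn_integral_count_space_finite)
    also have "\<dots> \<le> C" by (rule assms[OF finA]) (auto simp: A_def)
    finally show "(\<integral>\<^sup>+m. f m * indicator (A N) m \<partial>count_space UNIV) \<le> C" .
  qed
  finally show ?thesis .
qed

section \<open>A Plancherel inequality from Bessel's inequality\<close>

lemma continuous_ft:
  fixes h :: "real^'n::finite \<Rightarrow> real"
  assumes h: "continuous_on unit_cube h"
  shows "continuous_on S (ft h)"
proof -
  have "continuous_on S (\<lambda>\<xi>. integral unit_cube (\<lambda>x. of_real (h x) * cis (- (2 * pi * (\<xi> \<bullet> x)))))"
    by (rule integral_continuous_on_param)
      (auto simp: split_beta intro!: continuous_intros continuous_on_compose2[OF h])
  then show ?thesis by (simp add: ft_def[abs_def])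
qed

lemma ft_measurable [measurable]:
  "continuous_on unit_cube h \<Longrightarrow> ft h \<in> borel_measurable borel"
  by (intro borel_measurable_continuous_onI continuous_ft)

text \<open>Shifting the frequency by \<theta> multiplies h by a character. As \<open>bessel\<close>
  concerns real functions, the product is split into its cosine and sine parts; the constant 2 comes
  from |a - i b|^2 \<le> 2|a|^2 + 2|b|^2, and cos^2 + sin^2 = 1 reunites the parts.\<close>

lemma bessel_shifted:
  fixes h :: "real^'n::finite \<Rightarrow> real"
  assumes h: "continuous_on unit_cube h"
  shows "(\<integral>\<^sup>+m. ennreal ((cmod (ft h (\<theta> + real_vec m)))\<^sup>2) \<partial>count_space UNIV)
    \<le> ennreal (2 * integral unit_cube (\<lambda>x. (h x)\<^sup>2))"
proof (rule nn_integral_count_space_int_vec_le)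
  fix A :: "(int^'n) set" assume A: "finite A"
  let ?c = "\<lambda>x. h x * cos (2 * pi * (\<theta> \<bullet> x))" and ?s = "\<lambda>x. h x * sin (2 * pi * (\<theta> \<bullet> x))"
  have c: "continuous_on unit_cube ?c" and s: "continuous_on unit_cube ?s"
    by (intro continuous_intros h)+
  have "ft h (\<theta> + \<xi>) = ft ?c \<xi> - \<i> * ft ?s \<xi>" for \<xi>
  proof -
    have "of_real (h x) * cis (- (2 * pi * ((\<theta> + \<xi>) \<bullet> x))) =
      of_real (?c x) * cis (- (2 * pi * (\<xi> \<bullet> x))) - \<i> * (of_real (?s x) * cis (- (2 * pi * (\<xi> \<bullet> x))))" for x
    proof -
      have "cis (- (2 * pi * ((\<theta> + \<xi>) \<bullet> x))) = cis (- (2 * pi * (\<theta> \<bullet> x))) * cis (- (2 * pi * (\<xi> \<bullet> x)))"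
        by (simp add: cis_mult inner_add_left algebra_simps)
      also have "cis (- (2 * pi * (\<theta> \<bullet> x))) = of_real (cos (2 * pi * (\<theta> \<bullet> x))) - \<i> * of_real (sin (2 * pi * (\<theta> \<bullet> x)))"
        by (simp add: complex_eq_iff)
      finally have eq: "cis (- (2 * pi * ((\<theta> + \<xi>) \<bullet> x))) = (of_real (cos (2 * pi * (\<theta> \<bullet> x))) - \<i> * of_real (sin (2 * pi * (\<theta> \<bullet> x)))) * cis (- (2 * pi * (\<xi> \<bullet> x)))" .
      show ?thesis unfolding eq by (simp add: algebra_simps)
    qed
    moreover have "((\<lambda>x. of_real (?c x) * cis (- (2 * pi * (\<xi> \<bullet> x))) - \<i> * (of_real (?s x) * cis (- (2 * pi * (\<xi> \<bullet> x)))))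
      has_integral (ft ?c \<xi> - \<i> * ft ?s \<xi>)) unit_cube"
      by (intro has_integral_diff has_integral_mult_right ft_real_vec_integral c s)
    ultimately show ?thesis unfolding ft_def[of h] by (simp only: integral_unique)
  qed
  moreover have "(cmod (a - \<i> * b))\<^sup>2 \<le> 2 * (cmod a)\<^sup>2 + 2 * (cmod b)\<^sup>2" for a b
  proof -
    have "cmod (a - \<i> * b) \<le> cmod a + cmod b" using norm_triangle_ineq4[of a "\<i> * b"] by (simp add: norm_mult)
    then have "(cmod (a - \<i> * b))\<^sup>2 \<le> (cmod a + cmod b)\<^sup>2" by (rule power_mono) simp
    also have "\<dots> \<le> 2 * (cmod a)\<^sup>2 + 2 * (cmod b)\<^sup>2"
      using sum_squares_bound[of "cmod a" "cmod b"] by (simp add: power2_sum)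
    finally show ?thesis .
  qed
  ultimately have "(\<Sum>m\<in>A. (cmod (ft h (\<theta> + real_vec m)))\<^sup>2) \<le>
      (\<Sum>m\<in>A. 2 * (cmod (ft ?c (real_vec m)))\<^sup>2 + 2 * (cmod (ft ?s (real_vec m)))\<^sup>2)"
    by (intro sum_mono) simp
  also have "\<dots> = 2 * (\<Sum>m\<in>A. (cmod (ft ?c (real_vec m)))\<^sup>2) + 2 * (\<Sum>m\<in>A. (cmod (ft ?s (real_vec m)))\<^sup>2)"
    by (simp add: sum.distrib sum_distrib_left)
  also have "\<dots> \<le> 2 * integral unit_cube (\<lambda>x. (?c x)\<^sup>2) + 2 * integral unit_cube (\<lambda>x. (?s x)\<^sup>2)"
    using bessel[OF c A] bessel[OF s A] by linarith
  also have "\<dots> = 2 * (integral unit_cube (\<lambda>x. (?c x)\<^sup>2) + integral unit_cube (\<lambda>x. (?s x)\<^sup>2))" by simp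
  also have "integral unit_cube (\<lambda>x. (?c x)\<^sup>2) + integral unit_cube (\<lambda>x. (?s x)\<^sup>2) = integral unit_cube (\<lambda>x. (?c x)\<^sup>2 + (?s x)\<^sup>2)"
    by (intro Henstock_Kurzweil_Integration.integral_add[symmetric] integrable_continuous continuous_intros h)
  also have "(\<lambda>x. (?c x)\<^sup>2 + (?s x)\<^sup>2) = (\<lambda>x. (h x)\<^sup>2)"
    by (simp add: fun_eq_iff power_mult_distrib flip: distrib_left)
  finally show "(\<Sum>m\<in>A. ennreal ((cmod (ft h (\<theta> + real_vec m)))\<^sup>2)) \<le> ennreal (2 * integral unit_cube (\<lambda>x. (h x)\<^sup>2))"
    by (simp add: ennreal_leI)
qed

lemma countable_UNIV_int_vec: "countable (UNIV :: (int^'n::finite) set)"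
proof -
  have "countable (range (\<lambda>f::'n\<Rightarrow>int. (\<chi> i. f i)))" by (rule countable_image) simp
  moreover have "range (\<lambda>f::'n\<Rightarrow>int. (\<chi> i. f i)) = UNIV" by (metis surj_def vec_lambda_eta)
  ultimately show ?thesis by simp
qed

lemma nn_integral_unfold:
  fixes f :: "real^'n::finite \<Rightarrow> ennreal"
  assumes [measurable]: "f \<in> borel_measurable borel"
  shows "(\<integral>\<^sup>+x. f x \<partial>lborel) =
    (\<integral>\<^sup>+x. (\<integral>\<^sup>+m. f (x + real_vec m) \<partial>count_space UNIV) * indicator half_open_cube x \<partial>lborel)"
proof -
  have "(\<integral>\<^sup>+x. f x \<partial>lborel) = (\<integral>\<^sup>+x. (\<integral>\<^sup>+m. f x * indicator half_open_cube (x - real_vec m) \<partial>count_space UNIV) \<partial>lborel)"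
  proof (rule nn_integral_cong)
    fix x :: "real^'n"
    have "(\<integral>\<^sup>+m. f x * indicator half_open_cube (x - real_vec m) \<partial>count_space UNIV) =
       (\<integral>\<^sup>+m. f x * indicator {floor_vec x} m \<partial>count_space UNIV)"
      by (intro nn_integral_cong) (auto simp: indicator_def diff_real_vec_in_half_open_cube)
    then show "f x = (\<integral>\<^sup>+m. f x * indicator half_open_cube (x - real_vec m) \<partial>count_space UNIV)"
      by (simp add: nn_integral_cmult)
  qed
  also have "\<dots> = (\<integral>\<^sup>+m. (\<integral>\<^sup>+x. f x * indicator half_open_cube (x - real_vec m) \<partial>lborel) \<partial>count_space UNIV)"
    by (intro nn_integral_count_space_nn_integral countable_UNIV_int_vec) measurable
  also have "\<dots> = (\<integral>\<^sup>+m. (\<integral>\<^sup>+x. f (x + real_vec m) * indicator half_open_cube x \<partial>lborel) \<partial>count_space UNIV)"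
  proof (rule nn_integral_cong)
    fix m :: "int^'n"
    show "(\<integral>\<^sup>+x. f x * indicator half_open_cube (x - real_vec m) \<partial>lborel) = (\<integral>\<^sup>+x. f (x + real_vec m) * indicator half_open_cube x \<partial>lborel)"
      using nn_integral_distr[of "(+) (real_vec m)" lborel borel "\<lambda>x. f x * indicator half_open_cube (x - real_vec m)"]
      lborel_distr_plus[of "real_vec m :: real^'n"] by (simp add: add.commute)
  qed
  also have "\<dots> = (\<integral>\<^sup>+x. (\<integral>\<^sup>+m. f (x + real_vec m) * indicator half_open_cube x \<partial>count_space UNIV) \<partial>lborel)"
    by (intro nn_integral_count_space_nn_integral[symmetric] countable_UNIV_int_vec) measurable
  also have "\<dots> = (\<integral>\<^sup>+x. (\<integral>\<^sup>+m. f (x + real_vec m) \<partial>count_space UNIV) * indicator half_open_cube x \<partial>lborel)"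
    by (intro nn_integral_cong nn_integral_multc) auto
  finally show ?thesis .
qed

text \<open>Every frequency is uniquely a point of the half-open cube plus an integer vector, so the
  bound is the shifted Bessel inequality integrated over a cell of measure one. The constant 2 is
  inherited from there.\<close>

lemma plancherel_bound:
  fixes h :: "real^'n::finite \<Rightarrow> real"
  assumes h: "continuous_on unit_cube h"
  shows "(\<integral>\<^sup>+\<xi>. ennreal ((cmod (ft h \<xi>))\<^sup>2) \<partial>lborel) \<le> ennreal (2 * integral unit_cube (\<lambda>x. (h x)\<^sup>2))"
proof -
  let ?C = "ennreal (2 * integral unit_cube (\<lambda>x. (h x)\<^sup>2))"
  have [measurable]: "ft h \<in> borel_measurable borel" using h by (rule ft_measurable)
  have "(\<integral>\<^sup>+\<xi>. ennreal ((cmod (ft h \<xi>))\<^sup>2) \<partial>lborel) =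
     (\<integral>\<^sup>+\<xi>. (\<integral>\<^sup>+m. ennreal ((cmod (ft h (\<xi> + real_vec m)))\<^sup>2) \<partial>count_space UNIV) * indicator half_open_cube \<xi> \<partial>lborel)"
    by (rule nn_integral_unfold) measurable
  also have "\<dots> \<le> (\<integral>\<^sup>+\<xi>. ?C * indicator half_open_cube \<xi> \<partial>(lborel :: (real^'n) measure))"
    by (intro nn_integral_mono mult_right_mono bessel_shifted h) auto
  also have "\<dots> = ?C * emeasure lborel (half_open_cube :: (real^'n) set)"
    by (simp add: nn_integral_cmult)
  also have "emeasure lborel (half_open_cube :: (real^'n) set) = emeasure lborel (unit_cube :: (real^'n) set)"
    by (rule emeasure_eq_AE) (use AE_half_open_cube in \<open>auto elim!: eventually_mono simp: indicator_def split: if_splits\<close>)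
  also have "\<dots> = 1"
    using emeasure_eq_ennreal_measure[of lborel "unit_cube :: (real^'n) set"] by (simp add: emeasure_lborel_cbox_eq)
  finally show ?thesis by simp
qed

section \<open>Shifted lattice rules\<close>

lemma matrix_inv_mult:
  fixes A :: "real^'n::finite^'n"
  assumes "invertible A"
  shows "A ** matrix_inv A = mat 1" "matrix_inv A ** A = mat 1"
  using someI_ex[of "\<lambda>A'. A ** A' = mat 1 \<and> A' ** A = mat 1"] assms
  by (auto simp: invertible_def matrix_inv_def)

text \<open>The nodes of the rule lie on the shifted lattice generated by the inverse transpose; the
  frequencies that cause its error lie on the dual lattice generated by S.\<close>

abbreviation dual_matrix :: "real^'n::finite^'n \<Rightarrow> real^'n^'n" where
  "dual_matrix S \<equiv> transpose (matrix_inv S)"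

lemma dual_matrix_inverse:
  fixes S :: "real^'n::finite^'n"
  assumes "invertible S"
  shows "transpose S *v (dual_matrix S *v w) = w" "dual_matrix S *v (transpose S *v w) = w"
  using assms
  by (simp_all add: matrix_vector_mul_assoc matrix_inv_mult transpose_mat del: transpose_matrix_vector
      flip: matrix_transpose_mul)

lemma det_dual_matrix:
  fixes S :: "real^'n::finite^'n"
  assumes "invertible S"
  shows "det (dual_matrix S) = 1 / det S" "det S \<noteq> 0"
proof -
  have "det S * det (matrix_inv S) = 1"
    using matrix_inv_mult(1)[OF assms] det_mul[of S "matrix_inv S"] by simp
  moreover from this show "det S \<noteq> 0" by auto
  ultimately show "det (dual_matrix S) = 1 / det S"
    by (simp add: det_transpose eq_divide_eq mult.commute)
qed

definition lattice_rule :: "real^'n::finite^'n \<Rightarrow> (real^'n \<Rightarrow> real) \<Rightarrow> real^'n \<Rightarrow> real" where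
  "lattice_rule S g v = 1 / \<bar>det S\<bar> * periodize (\<lambda>w. g (dual_matrix S *v w)) v"

definition cube_function :: "(real^'n::finite \<Rightarrow> real) \<Rightarrow> bool" where
  "cube_function g \<longleftrightarrow> continuous_on UNIV g \<and> (\<forall>x. x \<notin> unit_cube \<longrightarrow> g x = 0)"

lemma cube_functionD:
  assumes "cube_function g"
  shows "continuous_on S g" "x \<notin> unit_cube \<Longrightarrow> g x = 0"
  using assms continuous_on_subset unfolding cube_function_def by blast+

text \<open>The transpose of S maps the cube to a bounded set, so in the coordinates w the integrand
  has bounded support and the periodization results apply.\<close>

lemma lattice_support:
  fixes g :: "real^'n::finite \<Rightarrow> real" and S :: "real^'n^'n"
  assumes S: "invertible S" and g: "cube_function g"
  obtains R where "\<And>w. R < norm w \<Longrightarrow> g (dual_matrix S *v w) = 0"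
proof -
  have "bounded ((*v) (transpose S) ` unit_cube)"
    by (intro bounded_linear_image bounded_cbox matrix_vector_mul_bounded_linear)
  then obtain R where R: "\<And>x. x \<in> unit_cube \<Longrightarrow> norm (transpose S *v x) \<le> R"
    unfolding bounded_iff by blast
  show ?thesis
  proof (rule that)
    fix w :: "real^'n" assume "R < norm w"
    then have "dual_matrix S *v w \<notin> unit_cube"
      using R[of "dual_matrix S *v w"] dual_matrix_inverse(1)[OF S, of w] by (auto simp del: transpose_matrix_vector)
    then show "g (dual_matrix S *v w) = 0" by (rule cube_functionD(2)[OF g])
  qed
qed

lemma continuous_cube_function_matrix:
  fixes A :: "real^'n::finite^'n"
  assumes "cube_function g"
  shows "continuous_on UNIV (\<lambda>w. g (A *v w))"
  by (intro continuous_on_compose2[OF cube_functionD(1)[OF assms, of UNIV]] matrix_vector_mult_linear_continuous_on) auto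

lemma continuous_lattice_rule:
  assumes S: "invertible S" and g: "cube_function g"
  shows "continuous_on UNIV (lattice_rule S g)"
proof -
  obtain R where R: "\<And>w. R < norm w \<Longrightarrow> g (dual_matrix S *v w) = 0"
    using lattice_support[OF assms] by blast
  show ?thesis
    unfolding lattice_rule_def[abs_def]
    by (intro continuous_intros continuous_periodize[OF continuous_cube_function_matrix[OF g] R])
qed

lemma lattice_rule_periodic: "lattice_rule S g (v + real_vec m) = lattice_rule S g v"
  by (simp add: lattice_rule_def periodize_periodic)

lemma ft_cmult:
  assumes "continuous_on unit_cube F"
  shows "ft (\<lambda>x. c * F x) \<xi> = of_real c * ft F \<xi>"
proof -
  have "((\<lambda>x. of_real c * (of_real (F x) * cis (- (2 * pi * (\<xi> \<bullet> x))))) has_integral of_real c * ft F \<xi>) unit_cube"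
    by (intro has_integral_mult_right ft_real_vec_integral assms)
  then show ?thesis unfolding ft_def[of "\<lambda>x. c * F x"] by (intro integral_unique) (simp add: mult.assoc)
qed

lemma ft_eq_lborel:
  assumes "cube_function g"
  shows "ft g \<xi> = (LINT x|lborel. of_real (g x) * cis (- (2 * pi * (\<xi> \<bullet> x))))"
  unfolding ft_def
  by (rule lborel_integral_eq_integral_cube[symmetric])
    (auto intro!: continuous_intros simp: cube_functionD[OF assms])

text \<open>The substitution x = \<open>dual_matrix S *v w\<close> turns the phase k . w into (S k)
  . x, and its Jacobian is exactly the factor 1/|det S| of the rule.\<close>

lemma ft_lattice_rule:
  fixes S :: "real^'n::finite^'n"
  assumes S: "invertible S" and g: "cube_function g"
  shows "ft (lattice_rule S g) (real_vec k) = ft g (S *v real_vec k)"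
proof -
  obtain R where R: "\<And>w. R < norm w \<Longrightarrow> g (dual_matrix S *v w) = 0"
    using lattice_support[OF assms] by blast
  let ?H = "\<lambda>w. g (dual_matrix S *v w)"
  note H = continuous_cube_function_matrix[OF g, of "dual_matrix S"]
  have [measurable]: "(\<lambda>x. of_real (g x) * cis (- (2 * pi * ((S *v real_vec k) \<bullet> x)))) \<in> borel_measurable borel"
    by (intro borel_measurable_continuous_onI continuous_intros cube_functionD[OF g])
  have "ft (lattice_rule S g) (real_vec k) = of_real (1 / \<bar>det S\<bar>) * ft (periodize ?H) (real_vec k)"
    unfolding lattice_rule_def[abs_def]
    by (intro ft_cmult continuous_on_subset[OF continuous_periodize[OF H R]]) auto
  also have "ft (periodize ?H) (real_vec k) = (LINT w|lborel. of_real (?H w) * cis (- (2 * pi * (real_vec k \<bullet> w))))"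
    by (rule ft_periodize[OF H R])
  also have "of_real (1 / \<bar>det S\<bar>) * \<dots> = \<bar>det (dual_matrix S)\<bar> *\<^sub>R (LINT w|lborel. of_real (?H w) * cis (- (2 * pi * (real_vec k \<bullet> w))))"
    unfolding det_dual_matrix(1)[OF S] by (simp add: scaleR_conv_of_real)
  also have "(LINT w|lborel. of_real (?H w) * cis (- (2 * pi * (real_vec k \<bullet> w)))) =
     (LINT w|lborel. of_real (g (dual_matrix S *v w)) * cis (- (2 * pi * ((S *v real_vec k) \<bullet> (dual_matrix S *v w)))))"
  proof -
    have "(S *v real_vec k) \<bullet> (dual_matrix S *v w) = real_vec k \<bullet> w" for w
      using dot_lmul_matrix[of "dual_matrix S *v w" S "real_vec k"] dual_matrix_inverse(1)[OF S, of w]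
      by (simp add: inner_commute)
    then show ?thesis by simp
  qed
  also have "\<bar>det (dual_matrix S)\<bar> *\<^sub>R \<dots> = (LINT x|lborel. of_real (g x) * cis (- (2 * pi * ((S *v real_vec k) \<bullet> x))))"
    by (rule lborel_integral_linear_substitution[symmetric]) (use det_dual_matrix[OF S] in auto)
  also have "\<dots> = ft g (S *v real_vec k)" by (rule ft_eq_lborel[OF g, symmetric])
  finally show ?thesis .
qed

text \<open>The coefficient at k = 0: averaged over the shift, the rule is exact.\<close>

lemma integral_lattice_rule:
  assumes S: "invertible S" and g: "cube_function g"
  shows "integral unit_cube (lattice_rule S g) = integral unit_cube g"
proof -
  have "of_real (integral unit_cube (lattice_rule S g)) = complex_of_real (integral unit_cube g)"
    using ft_lattice_rule[OF assms, of 0] ft_0[OF continuous_on_subset[OF continuous_lattice_rule[OF assms] subset_UNIV]]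
      ft_0[OF cube_functionD(1)[OF g]] by simp
  then show ?thesis by (simp only: of_real_eq_iff)
qed

lemma lattice_rule_variance:
  fixes S :: "real^'n::finite^'n"
  assumes S: "invertible S" and g: "cube_function g"
  shows "ennreal (integral unit_cube (\<lambda>v. (lattice_rule S g v - integral unit_cube g)\<^sup>2))
    \<le> (\<integral>\<^sup>+m. ennreal ((cmod (ft g (S *v real_vec m)))\<^sup>2) \<partial>count_space (- {0}))"
  using periodic_variance[OF continuous_lattice_rule[OF assms] lattice_rule_periodic]
  unfolding integral_lattice_rule[OF assms] ft_lattice_rule[OF assms] .

lemma lattice_rule_sup:
  fixes S :: "real^'n::finite^'n"
  assumes S: "invertible S" and g: "cube_function g"
    and M: "\<And>A. finite A \<Longrightarrow> 0 \<notin> A \<Longrightarrow> (\<Sum>m\<in>A. cmod (ft g (S *v real_vec m))) \<le> M"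
    and v: "v \<in> unit_cube"
  shows "\<bar>lattice_rule S g v - integral unit_cube g\<bar> \<le> M"
  using periodic_sup_bound[OF continuous_lattice_rule[OF S g] lattice_rule_periodic _ v, of M] M
  unfolding integral_lattice_rule[OF S g] ft_lattice_rule[OF S g] by blast

definition node_set :: "real^'n::finite^'n \<Rightarrow> real^'n \<Rightarrow> (int^'n) set" where
  "node_set S v = {m. dual_matrix S *v (real_vec m + v) \<in> unit_cube}"

lemma lattice_rule_finite_sum:
  fixes S :: "real^'n::finite^'n"
  assumes "finite (node_set S v)" "\<And>x. x \<notin> unit_cube \<Longrightarrow> g x = 0"
  shows "lattice_rule S g v = 1 / \<bar>det S\<bar> * (\<Sum>m\<in>node_set S v. g (dual_matrix S *v (real_vec m + v)))"
proof -
  have "(\<Sum>m\<in>node_set S v. g (dual_matrix S *v (real_vec m + v))) =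
      (\<Sum>\<^sub>\<infinity>m\<in>node_set S v. g (dual_matrix S *v (real_vec m + v)))"
    using assms(1) by simp
  also have "\<dots> = (\<Sum>\<^sub>\<infinity>m. g (dual_matrix S *v (real_vec m + v)))"
    by (rule infsum_cong_neutral) (use assms(2) in \<open>auto simp: node_set_def\<close>)
  finally show ?thesis by (simp add: lattice_rule_def periodize_def)
qed

text \<open>Bessel's inequality in the shift bounds the sum by the mean square of the rule.
  Cauchy-Schwarz over at most N nodes bounds that square by N / |det S| times the rule applied to
  g^2, whose mean over the shift is the integral of g^2. For the scaled Frolov matrices N / |det S|
  is bounded uniformly in n, so sampling the transform on the lattice costs only a constant.\<close>

lemma lattice_rule_bessel:
  fixes S :: "real^'n::finite^'n"
  assumes S: "invertible S" and g: "cube_function g" and A: "finite A"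
    and N: "\<And>v. v \<in> unit_cube \<Longrightarrow> finite (node_set S v) \<and> real (card (node_set S v)) \<le> N"
  shows "(\<Sum>m\<in>A. (cmod (ft g (S *v real_vec m)))\<^sup>2) \<le> N / \<bar>det S\<bar> * integral unit_cube (\<lambda>x. (g x)\<^sup>2)"
proof -
  have det: "\<bar>det S\<bar> > 0" using det_dual_matrix[OF S] by simp
  have g2: "cube_function (\<lambda>x. (g x)\<^sup>2)"
    using g unfolding cube_function_def by (auto intro!: continuous_intros)
  have c: "continuous_on unit_cube (lattice_rule S g)" "continuous_on unit_cube (lattice_rule S (\<lambda>x. (g x)\<^sup>2))"
    using continuous_lattice_rule[OF S] g g2 continuous_on_subset by blast+
  have "(\<Sum>m\<in>A. (cmod (ft g (S *v real_vec m)))\<^sup>2) = (\<Sum>m\<in>A. (cmod (ft (lattice_rule S g) (real_vec m)))\<^sup>2)"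
    by (simp add: ft_lattice_rule[OF S g])
  also have "\<dots> \<le> integral unit_cube (\<lambda>v. (lattice_rule S g v)\<^sup>2)"
    by (rule bessel[OF c(1) A])
  also have "\<dots> \<le> integral unit_cube (\<lambda>v. N / \<bar>det S\<bar> * lattice_rule S (\<lambda>x. (g x)\<^sup>2) v)"
  proof (rule integral_le)
    fix v :: "real^'n" assume v: "v \<in> unit_cube"
    let ?g = "\<lambda>m. g (dual_matrix S *v (real_vec m + v))"
    have fin: "finite (node_set S v)" and card: "real (card (node_set S v)) \<le> N" using N[OF v] by auto
    have "(\<Sum>m\<in>node_set S v. ?g m)\<^sup>2 \<le> real (card (node_set S v)) * (\<Sum>m\<in>node_set S v. (?g m)\<^sup>2)"
      using Cauchy_Schwarz_ineq_sum[of "\<lambda>_. 1" ?g "node_set S v"] by simp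
    also have "\<dots> \<le> N * (\<Sum>m\<in>node_set S v. (?g m)\<^sup>2)"
      by (intro mult_right_mono card sum_nonneg) auto
    finally have "(\<Sum>m\<in>node_set S v. ?g m)\<^sup>2 / \<bar>det S\<bar>\<^sup>2 \<le> N * (\<Sum>m\<in>node_set S v. (?g m)\<^sup>2) / \<bar>det S\<bar>\<^sup>2"
      by (intro divide_right_mono) auto
    then show "(lattice_rule S g v)\<^sup>2 \<le> N / \<bar>det S\<bar> * lattice_rule S (\<lambda>x. (g x)\<^sup>2) v"
      using lattice_rule_finite_sum[OF fin cube_functionD(2)[OF g]] lattice_rule_finite_sum[OF fin cube_functionD(2)[OF g2]]
      by (simp add: power_divide power2_eq_square)
  qed (intro integrable_continuous continuous_intros c)+
  also have "\<dots> = N / \<bar>det S\<bar> * integral unit_cube (lattice_rule S (\<lambda>x. (g x)\<^sup>2))"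
    by (rule integral_mult_right)
  also have "integral unit_cube (lattice_rule S (\<lambda>x. (g x)\<^sup>2)) = integral unit_cube (\<lambda>x. (g x)\<^sup>2)"
    by (rule integral_lattice_rule[OF S g2])
  finally show ?thesis .
qed

section \<open>Dilated Frolov lattices\<close>

definition dilation :: "nat \<Rightarrow> real^'n::finite \<Rightarrow> real^'n" where
  "dilation n u = real n powr (1 / real CARD('n)) *\<^sub>R u"

lemma powr_inverse_card_power: "x > 0 \<Longrightarrow> (x powr (1 / real CARD('n::finite))) ^ CARD('n) = x"
  by (simp add: powr_powr flip: powr_realpow)

lemma one_le_two_powr: "1 \<le> (2::real) powr (1 / real CARD('n::finite))"
  by (rule ge_one_powr_ge_zero) auto

lemma mem_dilation_cube:
  "u \<in> dilation_cube \<longleftrightarrow> (\<forall>j. 1 \<le> u $ j \<and> u $ j \<le> 2 powr (1 / real CARD('n)))" for u :: "real^'n::finite"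
  by (simp add: mem_box_cart)

lemma dilation_cubeD:
  fixes u :: "real^'n::finite"
  assumes "u \<in> dilation_cube"
  shows "1 \<le> u $ j" "u $ j \<le> 2 powr (1 / real CARD('n))"
  using assms unfolding mem_dilation_cube by auto

lemma two_powr_le_2: "(2::real) powr (1 / real CARD('n::finite)) \<le> 2"
proof -
  have "(2::real) powr (1 / real CARD('n)) \<le> 2 powr 1"
    by (intro powr_mono) (auto simp: Suc_le_eq)
  then show ?thesis by simp
qed

lemma diag_matrix_mult_vec: "diag_matrix a *v x = (\<chi> j. a $ j * x $ j)" for a :: "real^'n::finite"
  by (simp add: diag_matrix_def matrix_vector_mult_def vec_eq_iff if_distrib[of "\<lambda>z. z * _"] cong: if_cong)

lemma scaled_frolov_eq: "scaled_frolov B n u = diag_matrix (dilation n u) ** B"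
  by (simp add: scaled_frolov_def dilation_def diag_matrix_def matrix_matrix_mult_def vec_eq_iff sum_distrib_left mult.assoc
     if_distrib[of "\<lambda>z. z * _"] if_distrib[of "\<lambda>z. _ * z"] cong: if_cong)

lemma scaled_frolov_apply:
  "scaled_frolov B n u *v x = (\<chi> j. dilation n u $ j * (B *v x) $ j)"
  by (simp add: scaled_frolov_eq diag_matrix_mult_vec flip: matrix_vector_mul_assoc)

lemma det_scaled_frolov:
  fixes B :: "real^'n::finite^'n"
  assumes "n \<ge> 1"
  shows "det (scaled_frolov B n u) = real n * (\<Prod>j\<in>UNIV. u $ j) * det B"
proof -
  have "det (diag_matrix (dilation n u)) = (\<Prod>j\<in>UNIV. dilation n u $ j)"
    by (subst det_diagonal) (auto simp: diag_matrix_def)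
  also have "\<dots> = real n * (\<Prod>j\<in>UNIV. u $ j)"
    using assms by (simp add: dilation_def prod.distrib powr_inverse_card_power)
  finally show ?thesis by (simp add: scaled_frolov_eq det_mul)
qed

lemma invertible_scaled_frolov:
  fixes B :: "real^'n::finite^'n"
  assumes "invertible B" "n \<ge> 1" "\<And>j. u $ j \<noteq> 0"
  shows "invertible (scaled_frolov B n u)"
  using assms by (simp add: invertible_det_nz det_scaled_frolov)

text \<open>An explicit quotient shows how the nodes depend on u, and measurability in u can be read
  off from it.\<close>

lemma dual_scaled_frolov:
  fixes B :: "real^'n::finite^'n"
  assumes B: "invertible B" and n: "n \<ge> 1" and u: "\<And>j. u $ j \<noteq> 0"
  shows "dual_matrix (scaled_frolov B n u) *v w = (\<chi> j. (dual_matrix B *v w) $ j / dilation n u $ j)"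
proof -
  let ?x = "\<chi> j. (dual_matrix B *v w) $ j / dilation n u $ j"
  have "dilation n u $ j \<noteq> 0" for j using n u by (simp add: dilation_def)
  then have "diag_matrix (dilation n u) *v ?x = dual_matrix B *v w"
    by (simp add: diag_matrix_mult_vec vec_eq_iff)
  moreover have "transpose (diag_matrix (dilation n u)) = diag_matrix (dilation n u)"
    by (auto simp: transpose_def diag_matrix_def vec_eq_iff)
  ultimately have "transpose (scaled_frolov B n u) *v ?x = w"
    using dual_matrix_inverse(1)[OF B]
    by (simp add: scaled_frolov_eq matrix_transpose_mul del: transpose_matrix_vector flip: matrix_vector_mul_assoc)
  with dual_matrix_inverse(2)[OF invertible_scaled_frolov[of B n u, OF B n u], of ?x]
  show ?thesis by (simp del: transpose_matrix_vector)
qed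

section \<open>Counting nodes and lattice points\<close>

lemma card_bounded_int_vec:
  "card {m :: int^'n::finite. \<forall>i. \<bar>m $ i\<bar> \<le> N} \<le> nat (2 * N + 1) ^ CARD('n)"
proof -
  have "{m :: int^'n. \<forall>i. \<bar>m $ i\<bar> \<le> N} \<subseteq> vec_lambda ` (PiE UNIV (\<lambda>_. {-N..N}))"
  proof
    fix m :: "int^'n" assume "m \<in> {m. \<forall>i. \<bar>m $ i\<bar> \<le> N}"
    then have "\<bar>m $ i\<bar> \<le> N" for i by simp
    then have "- N \<le> m $ i \<and> m $ i \<le> N" for i using abs_le_iff minus_le_iff by blast
    then have "($) m \<in> PiE UNIV (\<lambda>_. {-N..N})" by (simp add: PiE_UNIV_domain)
    then show "m \<in> vec_lambda ` (PiE UNIV (\<lambda>_. {-N..N}))"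
      by (intro image_eqI[where x="($) m"]) simp_all
  qed
  then have "card {m :: int^'n. \<forall>i. \<bar>m $ i\<bar> \<le> N} \<le> card (vec_lambda ` (PiE (UNIV :: 'n set) (\<lambda>_. {-N..N})))"
    by (intro card_mono finite_imageI finite_PiE) auto
  also have "\<dots> \<le> card (PiE (UNIV :: 'n set) (\<lambda>_. {-N..N}))"
    by (intro card_image_le finite_PiE) auto
  also have "\<dots> = nat (2 * N + 1) ^ CARD('n)" by (simp add: card_PiE algebra_simps)
  finally show ?thesis .
qed

text \<open>A node x in the cube satisfies m + v = S^T x, so each coordinate of m is at most a
  constant times n^(1/d), and a box of that size holds at most a constant times n integer vectors.
  The factor 2 in K bounds the coordinates of u.\<close>

lemma card_node_set:
  fixes B :: "real^'n::finite^'n"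
  assumes B: "invertible B" and n: "n \<ge> 1" and u: "u \<in> dilation_cube" and v: "v \<in> unit_cube"
  defines "K \<equiv> 2 * (\<Sum>i\<in>UNIV. \<Sum>j\<in>UNIV. \<bar>B $ i $ j\<bar>)"
  shows "finite (node_set (scaled_frolov B n u) v) \<and>
    real (card (node_set (scaled_frolov B n u) v)) \<le> real n * (2 * K + 3) ^ CARD('n)"
proof -
  let ?S = "scaled_frolov B n u"
  define c where "c = real n powr (1 / real CARD('n))"
  have c: "c \<ge> 1" using n unfolding c_def by (intro ge_one_powr_ge_zero) auto
  have K: "K \<ge> 0" unfolding K_def by (simp add: sum_nonneg)
  have uj: "1 \<le> u $ j" "u $ j \<le> 2" for j
    using dilation_cubeD[OF u] two_powr_le_2[where 'n='n] order_trans by blast+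
  have u0: "u $ j \<noteq> 0" for j using uj[of j] by auto
  have inv: "invertible ?S" by (rule invertible_scaled_frolov[OF B n u0])
  \<comment> \<open>The summand 1 absorbs the shift v, whose coordinates lie in [0,1].\<close>
  define N where "N = \<lfloor>c * K + 1\<rfloor>"
  have "node_set ?S v \<subseteq> {m. \<forall>i. \<bar>m $ i\<bar> \<le> N}"
  proof safe
    fix m i assume m: "m \<in> node_set ?S v"
    let ?x = "dual_matrix ?S *v (real_vec m + v)"
    have x: "0 \<le> ?x $ j" "?x $ j \<le> 1" for j
      using m unfolding node_set_def mem_Collect_eq mem_box_cart by (simp_all del: transpose_matrix_vector)
    have "real_vec m + v = transpose ?S *v ?x" by (simp only: dual_matrix_inverse[OF inv])
    then have "(real_vec m + v) $ i = (transpose ?S *v ?x) $ i" by simp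
    also have "\<dots> = (\<Sum>j\<in>UNIV. (c * u $ j * B $ j $ i) * ?x $ j)"
      unfolding matrix_vector_mult_def[of "transpose ?S"]
      by (simp add: transpose_def scaled_frolov_eq diag_matrix_def matrix_matrix_mult_def dilation_def c_def
          if_distrib[of "\<lambda>z. z * _"] cong: if_cong)
    finally have "\<bar>(real_vec m + v) $ i\<bar> \<le> (\<Sum>j\<in>UNIV. \<bar>(c * u $ j * B $ j $ i) * ?x $ j\<bar>)"
      by (simp only: sum_abs)
    also have "\<dots> \<le> (\<Sum>j\<in>UNIV. c * 2 * \<bar>B $ j $ i\<bar> * 1)"
    proof (rule sum_mono)
      fix j
      have "\<bar>(c * u $ j * B $ j $ i) * ?x $ j\<bar> = c * \<bar>u $ j\<bar> * \<bar>B $ j $ i\<bar> * \<bar>?x $ j\<bar>"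
        using c by (simp only: abs_mult abs_of_nonneg)
      also have "\<dots> \<le> c * 2 * \<bar>B $ j $ i\<bar> * 1"
        using c x[of j] uj[of j] by (intro mult_mono mult_nonneg_nonneg) auto
      finally show "\<bar>(c * u $ j * B $ j $ i) * ?x $ j\<bar> \<le> c * 2 * \<bar>B $ j $ i\<bar> * 1" .
    qed
    also have "\<dots> \<le> (\<Sum>j\<in>UNIV. c * 2 * (\<Sum>i\<in>UNIV. \<bar>B $ j $ i\<bar>))"
      using c by (intro sum_mono) (auto intro!: mult_left_mono member_le_sum)
    also have "\<dots> = c * K" by (simp add: K_def sum_distrib_left mult_ac)
    finally have "\<bar>real_of_int (m $ i) + v $ i\<bar> \<le> c * K" by (simp add: real_vec_def)
    moreover have "0 \<le> v $ i" "v $ i \<le> 1" using v by (auto simp: mem_box_cart)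
    ultimately have "\<bar>real_of_int (m $ i)\<bar> \<le> c * K + 1" by linarith
    then show "\<bar>m $ i\<bar> \<le> N" unfolding N_def by linarith
  qed
  moreover have fin: "finite {m :: int^'n. \<forall>i. \<bar>m $ i\<bar> \<le> N}" by (rule finite_bounded_int_vec)
  ultimately have "finite (node_set ?S v)" and card: "card (node_set ?S v) \<le> card {m :: int^'n. \<forall>i. \<bar>m $ i\<bar> \<le> N}"
    by (auto intro: finite_subset card_mono)
  moreover have "real (card (node_set ?S v)) \<le> real n * (2 * K + 3) ^ CARD('n)"
  proof -
    have N: "real_of_int N \<le> c * K + 1" "N \<ge> 0" using K c by (auto simp: N_def)
    have "real (card (node_set ?S v)) \<le> real (nat (2 * N + 1) ^ CARD('n))"
      using card card_bounded_int_vec[where 'n='n and N=N] by linarith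
    also have "\<dots> = (2 * real_of_int N + 1) ^ CARD('n)" using N by simp
    also have "\<dots> \<le> (c * (2 * K + 3)) ^ CARD('n)"
    proof (rule power_mono)
      have "2 * real_of_int N + 1 \<le> 2 * (c * K) + 3" using N by linarith
      also have "\<dots> \<le> 2 * (c * K) + 3 * c" using c by linarith
      finally show "2 * real_of_int N + 1 \<le> c * (2 * K + 3)" by (simp add: algebra_simps)
    qed (use N in auto)
    also have "\<dots> = real n * (2 * K + 3) ^ CARD('n)"
      using n by (simp add: power_mult_distrib c_def powr_inverse_card_power)
    finally show ?thesis .
  qed
  ultimately show ?thesis by blast
qed

text \<open>The norm dominates every coordinate, so its power -2s is at most the product over the d
  coordinates of max(1,|m_i|) to the power -a, where a = 2s/d. The sum then factors into d copies of
  a one-dimensional series, convergent because s > d/2 means a > 1.\<close>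

lemma sum_inverse_norm_bounded:
  assumes "real s > real CARD('n::finite) / 2"
  obtains Z where "Z \<ge> 0" "\<And>A. finite A \<Longrightarrow> 0 \<notin> A \<Longrightarrow> (\<Sum>m\<in>A. 1 / norm (real_vec m :: real^'n) ^ (2 * s)) \<le> Z"
proof -
  define a where "a = 2 * real s / real CARD('n)"
  have a: "a > 1" using assms by (simp add: a_def field_simps)
  \<comment> \<open>The maximum with 1 handles zero coordinates: \<open>0 powr (-a)\<close> is 0 and
    would make the majorant vanish.\<close>
  define f where "f = (\<lambda>k::int. (max 1 \<bar>real_of_int k\<bar>) powr (-a))"
  define Z1 where "Z1 = 1 + 2 * (\<Sum>k. real (Suc k) powr (-a))"
  have summ: "summable (\<lambda>k. real (Suc k) powr (-a))"
    using a by (subst summable_Suc_iff) (simp add: summable_real_powr_iff)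
  have f0: "f k \<ge> 0" for k by (simp add: f_def)
  have Z1: "(\<Sum>k\<in>{-int N..int N}. f k) \<le> Z1" for N :: nat
  proof -
    have "(\<Sum>k\<in>{-int N..int N}. f k) = f 0 + (\<Sum>k<N. f (int (Suc k)) + f (- int (Suc k)))"
    proof (induction N)
      case (Suc N)
      have "{-int (Suc N)..int (Suc N)} = insert (- int (Suc N)) (insert (int (Suc N)) {-int N..int N})" by auto
      then show ?case using Suc by simp
    qed simp
    also have "(\<Sum>k<N. f (int (Suc k)) + f (- int (Suc k))) = (\<Sum>k<N. 2 * real (Suc k) powr (-a))"
      by (rule sum.cong) (auto simp: f_def max_def add.commute)
    also have "\<dots> = 2 * (\<Sum>k<N. real (Suc k) powr (-a))" by (rule sum_distrib_left[symmetric])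
    also have "\<dots> \<le> 2 * (\<Sum>k. real (Suc k) powr (-a))"
      by (intro mult_left_mono sum_le_suminf summ) auto
    finally show ?thesis by (simp add: Z1_def f_def)
  qed
  have "(\<Sum>m\<in>A. 1 / norm (real_vec m :: real^'n) ^ (2 * s)) \<le> Z1 ^ CARD('n)" if A: "finite A" "0 \<notin> A" for A
  proof -
    obtain N :: nat where N: "\<And>m i. m \<in> A \<Longrightarrow> \<bar>m $ i\<bar> \<le> int N"
    proof -
      have "finite ((\<lambda>(m,i). nat \<bar>m $ i\<bar>) ` (A \<times> UNIV))" using A(1) by simp
      from finite_nat_set_iff_bounded_le[THEN iffD1, OF this]
      obtain N where N: "\<forall>x \<in> (\<lambda>(m,i). nat \<bar>m $ i\<bar>) ` (A \<times> UNIV). x \<le> N" ..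
      have "\<bar>m $ i\<bar> \<le> int N" if "m \<in> A" for m i
        using N[rule_format, of "nat \<bar>m $ i\<bar>"] that by force
      then show ?thesis by (rule that)
    qed
    have "(\<Sum>m\<in>A. 1 / norm (real_vec m :: real^'n) ^ (2 * s)) \<le> (\<Sum>m\<in>A. \<Prod>i\<in>UNIV. f (m $ i))"
    proof (rule sum_mono)
      fix m assume "m \<in> A"
      then have "m \<noteq> 0" using A(2) by blast
      then obtain i where "m $ i \<noteq> 0" by (auto simp: vec_eq_iff)
      let ?r = "norm (real_vec m :: real^'n)"
      have comp: "\<bar>real_of_int (m $ j)\<bar> \<le> ?r" for j
        using component_le_norm_cart[of "real_vec m :: real^'n" j] by (simp add: real_vec_def)
      have "1 \<le> \<bar>real_of_int (m $ i)\<bar>" using \<open>m $ i \<noteq> 0\<close> by linarith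
      then have r: "1 \<le> ?r" using comp[of i] by linarith
      have "1 / ?r ^ (2 * s) = ?r powr (- (2 * real s))"
      proof -
        have "?r powr real (2 * s) = ?r ^ (2 * s)" using r by (intro powr_realpow) linarith
        then show ?thesis by (simp add: powr_minus divide_inverse)
      qed
      also have "\<dots> = (?r powr (-a)) ^ CARD('n)"
      proof -
        have "?r \<noteq> 0" using r by linarith
        then have "?r powr (-a) > 0" unfolding powr_gt_zero .
        then have "(?r powr (-a)) ^ CARD('n) = (?r powr (-a)) powr real CARD('n)" by (simp add: powr_realpow)
        then show ?thesis by (simp add: powr_powr a_def)
      qed
      also have "\<dots> = (\<Prod>i::'n\<in>UNIV. ?r powr (-a))" by simp
      also have "\<dots> \<le> (\<Prod>i\<in>UNIV. f (m $ i))"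
        unfolding f_def using a comp r by (intro prod_mono conjI powr_mono2') auto
      finally show "1 / ?r ^ (2 * s) \<le> (\<Prod>i\<in>UNIV. f (m $ i))" .
    qed
    also have "\<dots> = (\<Sum>g\<in>vec_nth ` A. \<Prod>i\<in>UNIV. f (g i))"
      by (subst sum.reindex) (auto simp: inj_on_def vec_eq_iff)
    also have "\<dots> \<le> (\<Sum>g\<in>PiE (UNIV :: 'n set) (\<lambda>_. {-int N..int N}). \<Prod>i\<in>UNIV. f (g i))"
    proof (intro sum_mono2 finite_PiE prod_nonneg)
      show "vec_nth ` A \<subseteq> PiE UNIV (\<lambda>_. {- int N..int N})"
      proof (rule image_subsetI)
        fix m assume "m \<in> A"
        then have "- int N \<le> m $ i \<and> m $ i \<le> int N" for i using N[of m i] by linarith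
        then show "($) m \<in> PiE UNIV (\<lambda>_. {- int N..int N})" by (simp add: PiE_UNIV_domain)
      qed
    qed (auto simp: f0)
    also have "\<dots> = (\<Prod>i::'n\<in>UNIV. \<Sum>k\<in>{-int N..int N}. f k)"
      by (rule prod_sum_PiE[symmetric]) auto
    also have "\<dots> \<le> (\<Prod>i::'n\<in>UNIV. Z1)"
      by (intro prod_mono conjI Z1 sum_nonneg f0)
    finally show ?thesis by simp
  qed
  moreover have "Z1 \<ge> 0" unfolding Z1_def by (intro add_nonneg_nonneg mult_nonneg_nonneg suminf_nonneg summ) auto
  ultimately show ?thesis by (intro that[of "Z1 ^ CARD('n)"]) auto
qed

text \<open>If \<xi> = S m for a dilation u, then (B m)_j lies between \<xi>_j / c and \<xi>_j / (c
  q) with c = n^(1/d) and q = 2^(1/d), so all these points lie in one box of volume at most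
  \<Prod>|\<xi>_j| / n. The Frolov count adds 1, which is at most \<Prod>|\<xi>_j| / n by the
  assumption on \<xi>; hence the factor 2.\<close>

lemma frolov_count:
  fixes B :: "real^'n::finite^'n"
  assumes F: "frolov_matrix B" and n: "n \<ge> 1" and \<xi>: "real n \<le> (\<Prod>j\<in>UNIV. \<bar>\<xi> $ j\<bar>)"
    and A: "finite A"
    and mem: "\<And>m. m \<in> A \<Longrightarrow> m \<noteq> 0 \<and> (\<exists>u\<in>dilation_cube. \<xi> = scaled_frolov B n u *v real_vec m)"
  shows "real (card A) \<le> 2 * (\<Prod>j\<in>UNIV. \<bar>\<xi> $ j\<bar>) / real n"
proof -
  define c where "c = real n powr (1 / real CARD('n))"
  define q where "q = (2::real) powr (1 / real CARD('n))"
  have c: "c > 0" "c ^ CARD('n) = real n" using n by (simp_all add: c_def powr_inverse_card_power)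
  have q: "q \<ge> 1" unfolding q_def by (rule one_le_two_powr)
  define x where "x = (\<chi> j. \<xi> $ j / c)"
  define y where "y = (\<chi> j. \<xi> $ j / (c * q))"
  define P where "P = {z \<in> range (\<lambda>m. B *v real_vec m).
                       \<forall>j. min (x $ j) (y $ j) \<le> z $ j \<and> z $ j \<le> max (x $ j) (y $ j)}"
  have P: "finite P" "real (card P) \<le> (\<Prod>j\<in>UNIV. \<bar>x $ j - y $ j\<bar>) + 1"
    using F unfolding frolov_matrix_def P_def Let_def by blast+
  have B: "invertible B" using F by (simp add: frolov_matrix_def)
  have inj: "inj (\<lambda>m. B *v real_vec m)"
  proof (rule injI)
    fix m k :: "int^'n" assume "B *v real_vec m = B *v real_vec k"
    then have "matrix_inv B *v (B *v real_vec m) = matrix_inv B *v (B *v real_vec k)" by simp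
    then have "real_vec m = (real_vec k :: real^'n)"
      by (simp add: matrix_vector_mul_assoc matrix_inv_mult[OF B])
    then show "m = k" by (simp add: real_vec_def vec_eq_iff)
  qed
  have "(\<lambda>m. B *v real_vec m) ` A \<subseteq> P"
  proof
    fix z assume "z \<in> (\<lambda>m. B *v real_vec m) ` A"
    then obtain m where m: "m \<in> A" "z = B *v real_vec m" by blast
    then obtain u where u: "u \<in> dilation_cube" "\<xi> = scaled_frolov B n u *v real_vec m" using mem by blast
    have "min (x $ j) (y $ j) \<le> z $ j \<and> z $ j \<le> max (x $ j) (y $ j)" for j
    proof -
      have uj: "1 \<le> u $ j" "u $ j \<le> q" using dilation_cubeD[OF u(1), of j] by (auto simp: q_def)
      have "\<xi> $ j = c * u $ j * z $ j" by (simp add: u(2) m(2) scaled_frolov_apply dilation_def c_def)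
      then have xj: "x $ j = u $ j * z $ j" and yj: "y $ j = u $ j * z $ j / q"
        using c q by (auto simp: x_def y_def)
      show ?thesis
      \<comment> \<open>Which of x_j and y_j is the larger depends on the sign of the lattice
        coordinate.\<close>
      proof (cases "z $ j \<ge> 0")
        case True
        have "1 * z $ j \<le> u $ j * z $ j" "u $ j * z $ j \<le> q * z $ j"
          by (intro mult_right_mono uj True)+
        then have "z $ j \<le> x $ j" "y $ j \<le> z $ j" unfolding xj yj using q
          by (simp_all add: divide_le_eq mult.commute)
        then show ?thesis by (simp add: min_le_iff_disj le_max_iff_disj)
      next
        case False
        have "u $ j * z $ j \<le> 1 * z $ j" "q * z $ j \<le> u $ j * z $ j"
          by (intro mult_right_mono_neg uj; use False in simp)+
        then have "x $ j \<le> z $ j" "z $ j \<le> y $ j" unfolding xj yj using q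
          by (simp_all add: le_divide_eq mult.commute)
        then show ?thesis by (simp add: min_le_iff_disj le_max_iff_disj)
      qed
    qed
    then show "z \<in> P" using m by (auto simp: P_def)
  qed
  then have "card A \<le> card P"
    using P(1) card_mono card_image[OF inj_on_subset[OF inj subset_UNIV], of A] by metis
  then have "real (card A) \<le> (\<Prod>j\<in>UNIV. \<bar>x $ j - y $ j\<bar>) + 1" using P(2) by linarith
  also have "(\<Prod>j\<in>UNIV. \<bar>x $ j - y $ j\<bar>) \<le> (\<Prod>j\<in>UNIV. \<bar>\<xi> $ j\<bar> / c)"
  proof (intro prod_mono conjI)
    fix j
    have "x $ j - y $ j = \<xi> $ j / c * (1 - 1 / q)" using c q by (simp add: x_def y_def field_simps)
    then have "\<bar>x $ j - y $ j\<bar> = \<bar>\<xi> $ j\<bar> / c * \<bar>1 - 1 / q\<bar>" using c by (simp add: abs_mult)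
    also have "\<dots> \<le> \<bar>\<xi> $ j\<bar> / c * 1" using c q by (intro mult_left_mono) (auto simp: abs_le_iff)
    finally show "\<bar>x $ j - y $ j\<bar> \<le> \<bar>\<xi> $ j\<bar> / c" by simp
  qed simp
  also have "(\<Prod>j\<in>UNIV. \<bar>\<xi> $ j\<bar> / c) = (\<Prod>j\<in>UNIV. \<bar>\<xi> $ j\<bar>) / real n" by (simp add: prod_dividef c)
  finally show ?thesis using n \<xi> by (simp add: field_simps)
qed

text \<open>For fixed m the substitution \<xi> = S m in u has Jacobian p = |\<Prod>\<gamma>_j|, and
  \<Prod>|\<xi>_j| lies between p and 2p because \<Prod>u_j lies between 1 and 2. So 1/p \<le> 2 /
  \<Prod>|\<xi>_j|, and p \<ge> n confines \<xi> to D. Summing over m, \<open>frolov_count\<close>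
  contributes 2 \<Prod>|\<xi>_j| / n; the products cancel and 4/n remains.\<close>

lemma frolov_average:
  fixes B :: "real^'n::finite^'n" and \<Phi> :: "real^'n \<Rightarrow> ennreal"
  assumes F: "frolov_matrix B" and n: "n \<ge> 1" and [measurable]: "\<Phi> \<in> borel_measurable borel"
  shows "(\<integral>\<^sup>+u. indicator dilation_cube u *
      (\<integral>\<^sup>+m. \<Phi> (scaled_frolov B n u *v real_vec m) \<partial>count_space (- {0})) \<partial>lborel)
    \<le> ennreal (4 / real n) * (\<integral>\<^sup>+\<xi>. indicator {\<xi>. real n \<le> (\<Prod>j\<in>UNIV. \<bar>\<xi> $ j\<bar>)} \<xi> * \<Phi> \<xi> \<partial>lborel)"
proof -
  define c where "c = real n powr (1 / real CARD('n))"
  have c: "c > 0" "c ^ CARD('n) = real n" using n by (simp_all add: c_def powr_inverse_card_power)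
  define \<gamma> where "\<gamma> = (\<lambda>m j. c * (B *v real_vec m) $ j)"
  define D where "D = {\<xi>::real^'n. real n \<le> (\<Prod>j\<in>UNIV. \<bar>\<xi> $ j\<bar>)}"
  have [measurable]: "D \<in> sets borel"
    unfolding D_def by (intro borel_closed closed_Collect_le continuous_intros)
  \<comment> \<open>The Frolov property keeps nonzero lattice points off the coordinate hyperplanes:
    the diagonal substitution is invertible and its Jacobian is at least n.\<close>
  have \<gamma>n: "real n \<le> \<bar>\<Prod>j\<in>UNIV. \<gamma> m j\<bar>" if "m \<noteq> 0" for m
  proof -
    have "\<bar>\<Prod>j\<in>UNIV. (B *v real_vec m) $ j\<bar> \<ge> 1" using F that by (simp add: frolov_matrix_def)
    then have "real n * 1 \<le> real n * \<bar>\<Prod>j\<in>UNIV. (B *v real_vec m) $ j\<bar>" by (intro mult_left_mono) auto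
    then show ?thesis by (simp add: \<gamma>_def prod.distrib c abs_mult)
  qed
  have \<gamma>0: "\<gamma> m j \<noteq> 0" if "m \<noteq> 0" for m j
  proof
    assume "\<gamma> m j = 0"
    then have "(\<Prod>j\<in>UNIV. \<gamma> m j) = 0" by (intro prod_zero) auto
    with \<gamma>n[OF that] n show False by simp
  qed
  \<comment> \<open>For m \<noteq> 0, \<open>E m\<close> marks the frequencies that S m reaches for
    some dilation in the cube.\<close>
  define E where "E = (\<lambda>m \<xi>. indicator dilation_cube (\<chi> j. \<xi> $ j / \<gamma> m j) :: ennreal)"
  have [measurable]: "E m \<in> borel_measurable borel" for m
  proof -
    have "(\<lambda>\<xi>::real^'n. \<chi> j. \<xi> $ j / \<gamma> m j) \<in> borel_measurable borel"
      by (intro borel_measurable_continuous_onI) (auto simp: divide_inverse intro!: continuous_intros)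
    then show ?thesis unfolding E_def by measurable
  qed
  have S\<gamma>: "scaled_frolov B n u *v real_vec m = (\<chi> j. \<gamma> m j * u $ j)" for u m
    by (simp add: scaled_frolov_apply dilation_def \<gamma>_def c_def mult_ac)
  have E_iff: "(\<chi> j. \<xi> $ j / \<gamma> m j) \<in> dilation_cube \<Longrightarrow> m \<noteq> 0 \<Longrightarrow>
      \<exists>u\<in>dilation_cube. \<xi> = scaled_frolov B n u *v real_vec m" for m \<xi>
    by (intro bexI[of _ "\<chi> j. \<xi> $ j / \<gamma> m j"]) (auto simp: S\<gamma> \<gamma>0 vec_eq_iff)
  have per_m: "(\<integral>\<^sup>+u. indicator dilation_cube u * \<Phi> (scaled_frolov B n u *v real_vec m) \<partial>lborel) \<le>
      (\<integral>\<^sup>+\<xi>. E m \<xi> * (indicator D \<xi> * (ennreal (2 / (\<Prod>j\<in>UNIV. \<bar>\<xi> $ j\<bar>)) * \<Phi> \<xi>)) \<partial>lborel)" if m: "m \<in> - {0}" for m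
  proof -
    have m0: "m \<noteq> 0" using m by simp
    let ?p = "\<bar>\<Prod>j\<in>UNIV. \<gamma> m j\<bar>"
    have "real n > 0" using n by simp
    with \<gamma>n[OF m0] have p: "?p \<ge> real n" "?p > 0" by linarith+
    have "ennreal ?p * (\<integral>\<^sup>+u. E m (\<chi> j. \<gamma> m j * u $ j) * \<Phi> (\<chi> j. \<gamma> m j * u $ j) \<partial>lborel) = (\<integral>\<^sup>+\<xi>. E m \<xi> * \<Phi> \<xi> \<partial>lborel)"
      by (rule nn_integral_diagonal) (auto simp: \<gamma>0[OF m0])
    moreover have "E m (\<chi> j. \<gamma> m j * u $ j) = indicator dilation_cube u" for u
    proof -
      have "(\<chi> j. (\<chi> j. \<gamma> m j * u $ j) $ j / \<gamma> m j) = u" using \<gamma>0[OF m0] by (simp add: vec_eq_iff)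
      then show ?thesis by (simp only: E_def)
    qed
    ultimately have "ennreal ?p * (\<integral>\<^sup>+u. indicator dilation_cube u * \<Phi> (scaled_frolov B n u *v real_vec m) \<partial>lborel) = (\<integral>\<^sup>+\<xi>. E m \<xi> * \<Phi> \<xi> \<partial>lborel)"
      by (simp only: S\<gamma>)
    then have "ennreal (1 / ?p) * (ennreal ?p * (\<integral>\<^sup>+u. indicator dilation_cube u * \<Phi> (scaled_frolov B n u *v real_vec m) \<partial>lborel)) = ennreal (1 / ?p) * (\<integral>\<^sup>+\<xi>. E m \<xi> * \<Phi> \<xi> \<partial>lborel)"
      by simp
    then have "(\<integral>\<^sup>+u. indicator dilation_cube u * \<Phi> (scaled_frolov B n u *v real_vec m) \<partial>lborel) = ennreal (1 / ?p) * (\<integral>\<^sup>+\<xi>. E m \<xi> * \<Phi> \<xi> \<partial>lborel)"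
      using p(2) by (simp add: mult.assoc[symmetric] ennreal_mult[symmetric] del: ennreal_mult_right_cong)
    also have "\<dots> = (\<integral>\<^sup>+\<xi>. ennreal (1 / ?p) * (E m \<xi> * \<Phi> \<xi>) \<partial>lborel)"
      by (rule nn_integral_cmult[symmetric]) measurable
    also have "\<dots> \<le> (\<integral>\<^sup>+\<xi>. E m \<xi> * (indicator D \<xi> * (ennreal (2 / (\<Prod>j\<in>UNIV. \<bar>\<xi> $ j\<bar>)) * \<Phi> \<xi>)) \<partial>lborel)"
    proof (rule nn_integral_mono)
      fix \<xi> :: "real^'n"
      show "ennreal (1 / ?p) * (E m \<xi> * \<Phi> \<xi>) \<le> E m \<xi> * (indicator D \<xi> * (ennreal (2 / (\<Prod>j\<in>UNIV. \<bar>\<xi> $ j\<bar>)) * \<Phi> \<xi>))"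
      proof (cases "(\<chi> j. \<xi> $ j / \<gamma> m j) \<in> dilation_cube")
        case True
        have r: "1 \<le> \<xi> $ j / \<gamma> m j" "\<xi> $ j / \<gamma> m j \<le> 2 powr (1 / real CARD('n))" for j
          using dilation_cubeD[OF True, of j] by simp_all
        have \<xi>: "\<bar>\<xi> $ j\<bar> = \<xi> $ j / \<gamma> m j * \<bar>\<gamma> m j\<bar>" for j
        proof -
          have "\<bar>\<xi> $ j\<bar> = \<bar>\<xi> $ j / \<gamma> m j\<bar> * \<bar>\<gamma> m j\<bar>" using \<gamma>0[OF m0, of j] by (simp add: abs_divide)
          moreover have "\<bar>\<xi> $ j / \<gamma> m j\<bar> = \<xi> $ j / \<gamma> m j"
            using r(1)[of j] by (intro abs_of_nonneg) linarith
          ultimately show ?thesis by (simp only:)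
        qed
        have "(\<Prod>j\<in>UNIV. \<bar>\<xi> $ j\<bar>) = (\<Prod>j\<in>UNIV. \<xi> $ j / \<gamma> m j) * ?p"
          by (simp only: \<xi> prod.distrib abs_prod)
        moreover have "1 \<le> (\<Prod>j\<in>UNIV. \<xi> $ j / \<gamma> m j)" by (intro prod_ge_1 r)
        moreover have "(\<Prod>j\<in>UNIV. \<xi> $ j / \<gamma> m j) \<le> (\<Prod>j::'n\<in>UNIV. 2 powr (1 / real CARD('n)))"
          by (intro prod_mono conjI r order_trans[OF zero_le_one])
        moreover have "(\<Prod>j::'n\<in>UNIV. (2::real) powr (1 / real CARD('n))) = 2"
          by (simp add: powr_inverse_card_power)
        ultimately have "?p \<le> (\<Prod>j\<in>UNIV. \<bar>\<xi> $ j\<bar>)" "(\<Prod>j\<in>UNIV. \<bar>\<xi> $ j\<bar>) \<le> 2 * ?p"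
          using mult_right_mono[of 1 "\<Prod>j\<in>UNIV. \<xi> $ j / \<gamma> m j" ?p] mult_right_mono[of "\<Prod>j\<in>UNIV. \<xi> $ j / \<gamma> m j" 2 ?p] abs_ge_zero[of "\<Prod>j\<in>UNIV. \<gamma> m j"]
          by linarith+
        moreover have "1 / p \<le> 2 / X" if "0 < p" "p \<le> X" "X \<le> 2 * p" for p X :: real
          using that by (simp add: field_simps)
        ultimately have "\<xi> \<in> D" "1 / ?p \<le> 2 / (\<Prod>j\<in>UNIV. \<bar>\<xi> $ j\<bar>)"
          using p unfolding D_def by auto
        then show ?thesis using True by (simp add: E_def mult_right_mono ennreal_leI)
      qed (simp add: E_def)
    qed
    finally show ?thesis .
  qed
  have sumE: "(\<integral>\<^sup>+m. E m \<xi> \<partial>count_space (- {0})) \<le> ennreal (2 * (\<Prod>j\<in>UNIV. \<bar>\<xi> $ j\<bar>) / real n)" if "\<xi> \<in> D" for \<xi>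
  proof (rule nn_integral_count_space_int_vec_le)
    fix A :: "(int^'n) set" assume A: "finite A" "A \<subseteq> - {0}"
    let ?A = "{m\<in>A. (\<chi> j. \<xi> $ j / \<gamma> m j) \<in> dilation_cube}"
    have "(\<Sum>m\<in>A. E m \<xi>) = (\<Sum>m\<in>?A. 1)"
      using A(1) by (intro sum.mono_neutral_cong_right) (auto simp: E_def)
    also have "\<dots> = ennreal (real (card ?A))" by (simp add: ennreal_of_nat_eq_real_of_nat)
    also have "real (card ?A) \<le> 2 * (\<Prod>j\<in>UNIV. \<bar>\<xi> $ j\<bar>) / real n"
      by (rule frolov_count[OF F n]) (use that A E_iff in \<open>auto simp: D_def\<close>)
    finally show "(\<Sum>m\<in>A. E m \<xi>) \<le> ennreal (2 * (\<Prod>j\<in>UNIV. \<bar>\<xi> $ j\<bar>) / real n)"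
      by (simp add: ennreal_leI)
  qed
  have "(\<integral>\<^sup>+u. indicator dilation_cube u * (\<integral>\<^sup>+m. \<Phi> (scaled_frolov B n u *v real_vec m) \<partial>count_space (- {0})) \<partial>lborel) =
     (\<integral>\<^sup>+u. (\<integral>\<^sup>+m. indicator dilation_cube u * \<Phi> (scaled_frolov B n u *v real_vec m) \<partial>count_space (- {0})) \<partial>lborel)"
    by (intro nn_integral_cong nn_integral_cmult[symmetric]) auto
  also have "\<dots> = (\<integral>\<^sup>+m. (\<integral>\<^sup>+u. indicator dilation_cube u * \<Phi> (scaled_frolov B n u *v real_vec m) \<partial>lborel) \<partial>count_space (- {0}))"
  proof (intro nn_integral_count_space_nn_integral countable_subset[OF subset_UNIV countable_UNIV_int_vec])
    fix m :: "int^'n"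
    have [measurable]: "(\<lambda>u. \<chi> j. \<gamma> m j * u $ j) \<in> borel_measurable borel"
      by (intro borel_measurable_continuous_onI continuous_intros)
    show "(\<lambda>u. indicator dilation_cube u * \<Phi> (scaled_frolov B n u *v real_vec m)) \<in> borel_measurable lborel"
      unfolding S\<gamma> by measurable
  qed
  also have "\<dots> \<le> (\<integral>\<^sup>+m. (\<integral>\<^sup>+\<xi>. E m \<xi> * (indicator D \<xi> * (ennreal (2 / (\<Prod>j\<in>UNIV. \<bar>\<xi> $ j\<bar>)) * \<Phi> \<xi>)) \<partial>lborel) \<partial>count_space (- {0}))"
    by (intro nn_integral_mono per_m) simp
  also have "\<dots> = (\<integral>\<^sup>+\<xi>. (\<integral>\<^sup>+m. E m \<xi> * (indicator D \<xi> * (ennreal (2 / (\<Prod>j\<in>UNIV. \<bar>\<xi> $ j\<bar>)) * \<Phi> \<xi>)) \<partial>count_space (- {0})) \<partial>lborel)"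
  proof -
    have [measurable]: "(\<lambda>\<xi>::real^'n. \<Prod>j\<in>UNIV. \<bar>\<xi> $ j\<bar>) \<in> borel_measurable borel"
      by (intro borel_measurable_continuous_onI continuous_intros)
    show ?thesis
      by (intro nn_integral_count_space_nn_integral[symmetric] countable_subset[OF subset_UNIV countable_UNIV_int_vec]) measurable
  qed
  also have "\<dots> = (\<integral>\<^sup>+\<xi>. (\<integral>\<^sup>+m. E m \<xi> \<partial>count_space (- {0})) * (indicator D \<xi> * (ennreal (2 / (\<Prod>j\<in>UNIV. \<bar>\<xi> $ j\<bar>)) * \<Phi> \<xi>)) \<partial>lborel)"
    by (intro nn_integral_cong nn_integral_multc) auto
  also have "\<dots> \<le> (\<integral>\<^sup>+\<xi>. ennreal (4 / real n) * (indicator D \<xi> * \<Phi> \<xi>) \<partial>lborel)"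
  proof (rule nn_integral_mono)
    fix \<xi> :: "real^'n"
    show "(\<integral>\<^sup>+m. E m \<xi> \<partial>count_space (- {0})) * (indicator D \<xi> * (ennreal (2 / (\<Prod>j\<in>UNIV. \<bar>\<xi> $ j\<bar>)) * \<Phi> \<xi>)) \<le>
       ennreal (4 / real n) * (indicator D \<xi> * \<Phi> \<xi>)"
    proof (cases "\<xi> \<in> D")
      case True
      then have "real n \<le> (\<Prod>j\<in>UNIV. \<bar>\<xi> $ j\<bar>)" by (simp add: D_def)
      moreover have "real n > 0" using n by simp
      ultimately have pos: "(\<Prod>j\<in>UNIV. \<bar>\<xi> $ j\<bar>) > 0" by linarith
      have "(\<integral>\<^sup>+m. E m \<xi> \<partial>count_space (- {0})) * (ennreal (2 / (\<Prod>j\<in>UNIV. \<bar>\<xi> $ j\<bar>)) * \<Phi> \<xi>) \<le>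
         ennreal (2 * (\<Prod>j\<in>UNIV. \<bar>\<xi> $ j\<bar>) / real n) * (ennreal (2 / (\<Prod>j\<in>UNIV. \<bar>\<xi> $ j\<bar>)) * \<Phi> \<xi>)"
        by (intro mult_right_mono sumE True) simp
      also have "\<dots> = ennreal (4 / real n) * \<Phi> \<xi>"
      proof -
        have r: "2 * X / real n * (2 / X) = 4 / real n" if "X > 0" for X :: real
          using that by (simp add: field_simps)
        have "ennreal (2 * (\<Prod>j\<in>UNIV. \<bar>\<xi> $ j\<bar>) / real n) * ennreal (2 / (\<Prod>j\<in>UNIV. \<bar>\<xi> $ j\<bar>)) = ennreal (4 / real n)"
          unfolding r[OF pos, symmetric] using pos by (intro ennreal_mult''[symmetric]) (rule divide_nonneg_pos, simp)
        then show ?thesis by (simp only: mult.assoc[symmetric])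
      qed
      finally show ?thesis using True by simp
    qed simp
  qed
  also have "\<dots> = ennreal (4 / real n) * (\<integral>\<^sup>+\<xi>. indicator D \<xi> * \<Phi> \<xi> \<partial>lborel)"
    by (rule nn_integral_cmult) measurable
  finally show ?thesis by (simp only: D_def)
qed

section \<open>The change of variables\<close>

locale smooth_step =
  fixes \<psi> :: "real \<Rightarrow> real"
  assumes smooth_psi: "smooth_real_on UNIV \<psi>"
    and psi_neg: "\<And>t. t < 0 \<Longrightarrow> \<psi> t = 0"
    and psi_gt_1: "\<And>t. t > 1 \<Longrightarrow> \<psi> t = 1"
    and diffeo: "diffeomorphism_real {0<..<1} {0<..<1} \<psi>"
begin

definition D :: "nat \<Rightarrow> real \<Rightarrow> real" where "D k = (deriv ^^ k) \<psi>"

lemma D_0: "D 0 = \<psi>" and D_1: "D (Suc 0) = deriv \<psi>"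
  by (simp_all add: D_def)

lemma D_deriv: "(D k has_real_derivative D (Suc k) t) (at t)"
  using smooth_psi by (simp add: smooth_real_on_def D_def DERIV_deriv_iff_real_differentiable)

lemma continuous_D: "continuous_on S (D k)"
  by (rule continuous_at_imp_continuous_on) (use D_deriv DERIV_isCont in blast)

lemma psi_le_0: "t \<le> 0 \<Longrightarrow> \<psi> t = 0"
proof (cases "t = 0")
  case True
  have "(\<psi> \<longlongrightarrow> \<psi> 0) (at_left 0)"
    using continuous_D[of UNIV 0] by (simp add: D_0 continuous_on_def filterlim_at_split)
  moreover have "(\<psi> \<longlongrightarrow> 0) (at_left 0)"
    by (rule tendsto_eventually) (auto simp: eventually_at_left[of "-1"] psi_neg intro!: exI[of _ "-1"])
  ultimately have "\<psi> 0 = 0" by (intro tendsto_unique) auto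
  with True show ?thesis by simp
qed (simp add: psi_neg)

lemma psi_ge_1: "t \<ge> 1 \<Longrightarrow> \<psi> t = 1"
proof (cases "t = 1")
  case True
  have "(\<psi> \<longlongrightarrow> \<psi> 1) (at_right 1)"
    using continuous_D[of UNIV 0] by (simp add: D_0 continuous_on_def filterlim_at_split)
  moreover have "(\<psi> \<longlongrightarrow> 1) (at_right 1)"
    by (rule tendsto_eventually) (auto simp: eventually_at_right[of 1 2] psi_gt_1 intro!: exI[of _ 2])
  ultimately have "\<psi> 1 = 1" by (intro tendsto_unique) auto
  with True show ?thesis by simp
qed (simp add: psi_gt_1)

lemma psi_open: "0 < t \<Longrightarrow> t < 1 \<Longrightarrow> 0 < \<psi> t \<and> \<psi> t < 1"
  using diffeo unfolding diffeomorphism_real_def bij_betw_def by force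

lemma psi_range: "0 \<le> \<psi> t" "\<psi> t \<le> 1"
  using psi_open[of t] psi_le_0[of t] psi_ge_1[of t] by (cases "t \<le> 0"; cases "t \<ge> 1"; simp)+

text \<open>A continuous injective function on an interval is strictly monotone. The diffeomorphism
  does not fix the direction, but \<psi> 1 = 1 is the largest possible value and excludes a
  decrease; this is why the interval {x..1} includes its endpoint.\<close>

lemma psi_mono: "x \<le> y \<Longrightarrow> \<psi> x \<le> \<psi> y"
proof -
  assume xy: "x \<le> y"
  consider "x = y" | "x \<le> 0" | "y \<ge> 1" | "0 < x" "x < y" "y < 1" using xy by linarith
  then show ?thesis
  proof cases
    case 4
    have "inj_on \<psi> {x..1}"
    proof (rule inj_onI)
      fix a b assume ab: "a \<in> {x..1}" "b \<in> {x..1}" "\<psi> a = \<psi> b"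
      have i: "inj_on \<psi> {0<..<1}" using diffeo by (simp add: diffeomorphism_real_def bij_betw_def)
      show "a = b"
      proof (cases "a < 1 \<and> b < 1")
        case True
        then show ?thesis using ab 4 inj_onD[OF i ab(3)] by auto
      next
        case False
        have "a = 1 \<or> a < 1" "b = 1 \<or> b < 1" using ab by auto
        with False show ?thesis using ab 4 psi_open[of a] psi_open[of b] psi_ge_1[of 1] by auto
      qed
    qed
    from continuous_inj_imp_mono[OF _ _ _ this, of y] 4 continuous_D[of "{x..1}" 0]
    have "(\<psi> x < \<psi> y \<and> \<psi> y < \<psi> 1) \<or> (\<psi> 1 < \<psi> y \<and> \<psi> y < \<psi> x)" by (simp add: D_0)
    then show ?thesis using psi_range[of y] psi_ge_1[of 1] by auto
  qed (use psi_le_0[of x] psi_ge_1[of y] psi_range in auto)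
qed

lemma deriv_psi_nonneg: "0 \<le> deriv \<psi> t"
proof (rule ccontr)
  assume "\<not> 0 \<le> deriv \<psi> t"
  then have "deriv \<psi> t < 0" by simp
  moreover have "(\<psi> has_real_derivative deriv \<psi> t) (at t)" using D_deriv[of 0 t] by (simp add: D_0 D_1)
  ultimately obtain d where d: "d > 0" "\<forall>h>0. h < d \<longrightarrow> \<psi> (t + h) < \<psi> t"
    using DERIV_neg_dec_right by blast
  have "\<psi> (t + d/2) < \<psi> t" using d(1) by (intro d(2)[rule_format]) auto
  with psi_mono[of t "t + d/2"] d(1) show False by simp
qed

section \<open>Derivatives of the step function and the algebra they generate\<close>

lemma D_outside:
  assumes "t \<notin> {0..1}"
  shows "D (Suc k) t = 0"
  using assms
proof (induction k arbitrary: t)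
  case 0
  have "(\<psi> has_real_derivative 0) (at t)"
  proof (cases "t < 0")
    case True
    have "((\<lambda>_. 0) has_real_derivative 0) (at t)" by simp
    then show ?thesis
      by (rule has_field_derivative_transform_within_open[where S="{..<0}"]) (use True psi_neg in auto)
  next
    case False
    have "((\<lambda>_. 1) has_real_derivative 0) (at t)" by simp
    then show ?thesis
      by (rule has_field_derivative_transform_within_open[where S="{1<..}"]) (use False 0 psi_gt_1 in auto)
  qed
  then show ?case using D_deriv[of 0 t] DERIV_unique by (auto simp: D_0)
next
  case (Suc k)
  have "((\<lambda>_. 0) has_real_derivative 0) (at t)" by simp
  then have "(D (Suc k) has_real_derivative 0) (at t)"
    by (rule has_field_derivative_transform_within_open[where S="{..<0} \<union> {1<..}"]) (use Suc in auto)
  then show ?case using D_deriv DERIV_unique by blast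
qed

text \<open>The algebra generated by the derivatives of \<psi>. Order zero is left out, so that
  every member vanishes off the unit interval. Being closed under \<open>deriv\<close>, it holds all
  coefficients that the chain and product rules produce.\<close>

inductive bump :: "(real \<Rightarrow> real) \<Rightarrow> bool" where
  zero: "bump (\<lambda>_. 0)"
| D: "bump (D (Suc k))"
| add: "bump c \<Longrightarrow> bump d \<Longrightarrow> bump (\<lambda>t. c t + d t)"
| mult: "bump c \<Longrightarrow> bump d \<Longrightarrow> bump (\<lambda>t. c t * d t)"

lemma bump_deriv: "bump c \<Longrightarrow> bump (deriv c) \<and> (\<forall>t. (c has_real_derivative deriv c t) (at t))"
proof (induction rule: bump.induct)
  case zero
  then show ?case by (simp add: bump.zero)
next
  case (D k)
  have "deriv (D (Suc k)) = D (Suc (Suc k))" by (rule ext) (rule DERIV_imp_deriv[OF D_deriv])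
  then show ?case using D_deriv by (simp add: bump.D)
next
  case (add c d)
  then have "((\<lambda>t. c t + d t) has_real_derivative deriv c t + deriv d t) (at t)" for t
    by (intro DERIV_add) auto
  moreover from this have "deriv (\<lambda>t. c t + d t) = (\<lambda>t. deriv c t + deriv d t)"
    by (intro ext DERIV_imp_deriv)
  ultimately show ?case using add by (simp add: bump.add)
next
  case (mult c d)
  then have "((\<lambda>t. c t * d t) has_real_derivative deriv c t * d t + deriv d t * c t) (at t)" for t
    by (intro DERIV_mult) auto
  moreover from this have "deriv (\<lambda>t. c t * d t) = (\<lambda>t. deriv c t * d t + deriv d t * c t)"
    by (intro ext DERIV_imp_deriv)
  ultimately show ?case using mult by (simp add: bump.add bump.mult)
qed

lemma bump_outside: "bump c \<Longrightarrow> t \<notin> {0..1} \<Longrightarrow> c t = 0"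
  by (induction rule: bump.induct) (auto simp del: atLeastAtMost_iff intro: D_outside)

lemma continuous_bump: "bump c \<Longrightarrow> continuous_on S c"
  by (rule continuous_at_imp_continuous_on) (use bump_deriv DERIV_isCont in blast)

lemma bounded_bump:
  assumes "bump c"
  obtains M where "M \<ge> 0" "\<And>t. \<bar>c t\<bar> \<le> M"
proof -
  have "compact (c ` {0..1})" by (intro compact_continuous_image continuous_bump assms) simp
  then obtain M where M: "\<And>t. t \<in> {0..1} \<Longrightarrow> \<bar>c t\<bar> \<le> M"
    using compact_imp_bounded bounded_iff by (metis imageI real_norm_def)
  show ?thesis
  proof (rule that)
    show "\<bar>c t\<bar> \<le> max 0 M" for t using M[of t] bump_outside[OF assms, of t] by (cases "t \<in> {0..1}") auto
  qed simp
qed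

text \<open>As \<psi>' has integral 1, taking \<kappa> to be the integral of c^2 gives c^2 -
  \<kappa> \<psi>' mean zero. Its antiderivative then vanishes on both sides of the unit interval
  and leaves no boundary term in an integration by parts.\<close>

lemma bump_antiderivative:
  assumes "bump c"
  obtains b \<kappa> where "\<kappa> \<ge> 0" "\<And>t. (b has_real_derivative (c t)\<^sup>2 - \<kappa> * deriv \<psi> t) (at t)"
    "\<And>t. t \<notin> {0..1} \<Longrightarrow> b t = 0"
proof -
  \<comment> \<open>Starting at -1 instead of 0 makes every t \<ge> 0 an interior point, so the
    derivative there is two-sided.\<close>
  let ?q = "\<lambda>t. integral {-1..t} (\<lambda>t. (c t)\<^sup>2)"
  have cont: "continuous_on S (\<lambda>t. (c t)\<^sup>2)" for S by (intro continuous_intros continuous_bump assms)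
  have q0: "?q t = 0" if "t < 0" for t
  proof -
    have "?q t = integral {-1..t} (\<lambda>_. 0)"
      by (rule Henstock_Kurzweil_Integration.integral_cong) (use that bump_outside[OF assms] in auto)
    then show ?thesis by simp
  qed
  have dq: "(?q has_real_derivative (c t)\<^sup>2) (at t)" for t
  proof (cases "t < 0")
    case True
    have "((\<lambda>_. 0) has_real_derivative (c t)\<^sup>2) (at t)" using True bump_outside[OF assms, of t] by simp
    then show ?thesis
      by (rule has_field_derivative_transform_within_open[where S="{..<0}"]) (use True q0 in auto)
  next
    case False
    have "(?q has_real_derivative (c t)\<^sup>2) (at t within {-1..t+1})"
      by (rule integral_has_real_derivative[OF cont]) (use False in auto)
    then show ?thesis using False by (simp add: at_within_Icc_at)
  qed
  have q1: "?q t = ?q 1" if "t \<ge> 1" for t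
  proof -
    have "?q t = ?q 1 + integral {1..t} (\<lambda>t. (c t)\<^sup>2)"
      by (rule Henstock_Kurzweil_Integration.integral_combine[symmetric]) (use that in \<open>auto intro!: integrable_continuous_real cont\<close>)
    also have "integral {1..t} (\<lambda>t. (c t)\<^sup>2) = integral {1..t} (\<lambda>_. 0)"
      by (rule integral_spike[where S="{1}"]) (use bump_outside[OF assms] in auto)
    finally show ?thesis by simp
  qed
  show ?thesis
  proof (rule that[of "?q 1" "\<lambda>t. ?q t - ?q 1 * \<psi> t"])
    show "?q 1 \<ge> 0" by (intro Henstock_Kurzweil_Integration.integral_nonneg integrable_continuous_real cont) auto
    show "((\<lambda>t. ?q t - ?q 1 * \<psi> t) has_real_derivative (c t)\<^sup>2 - ?q 1 * deriv \<psi> t) (at t)" for t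
      using D_deriv[of 0 t] by (intro DERIV_diff dq DERIV_cmult) (simp add: D_0 D_1)
    show "?q t - ?q 1 * \<psi> t = 0" if "t \<notin> {0..1}" for t
      using that q0[of t] q1[of t] psi_neg[of t] psi_gt_1[of t] by (cases "t < 0") auto
  qed
qed

section \<open>Integrals under the substitution by \<Psi>\<close>

lemma nn_integral_psi_substitution:
  fixes g :: "real \<Rightarrow> real"
  assumes [measurable]: "g \<in> borel_measurable borel"
  shows "(\<integral>\<^sup>+t. ennreal (g (\<psi> t) * deriv \<psi> t) \<partial>lborel) = (\<integral>\<^sup>+t. ennreal (g t * indicator {0..1} t) \<partial>lborel)"
proof -
  have "(\<integral>\<^sup>+t. ennreal (g t * indicator {0..1} t) \<partial>lborel) = (\<integral>\<^sup>+t. g t * indicator {\<psi> 0..\<psi> 1} t \<partial>lborel)"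
    by (intro nn_integral_cong) (simp add: psi_le_0 psi_ge_1)
  also have "\<dots> = (\<integral>\<^sup>+t. g (\<psi> t) * deriv \<psi> t * indicator {0..1} t \<partial>lborel)"
  proof (rule nn_integral_substitution)
    show "(\<psi> has_real_derivative deriv \<psi> t) (at t)" for t using D_deriv[of 0 t] by (simp add: D_0 D_1)
    show "continuous_on {0..1} (deriv \<psi>)" using continuous_D[of _ "Suc 0"] by (simp add: D_1)
    show "set_borel_measurable borel {\<psi> 0..\<psi> 1} g" unfolding set_borel_measurable_def by measurable
  qed (auto intro: deriv_psi_nonneg)
  also have "\<dots> = (\<integral>\<^sup>+t. ennreal (g (\<psi> t) * deriv \<psi> t) \<partial>lborel)"
    using D_outside[of _ 0] by (intro nn_integral_cong) (auto simp: indicator_def D_1)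
  finally show ?thesis ..
qed

lemma continuous_Psi: "continuous_on S (Psi \<psi> :: real^'n::finite \<Rightarrow> real^'n)"
proof -
  have "continuous_on S (\<lambda>x::real^'n. \<chi> j. \<psi> (x $ j))"
    by (intro continuous_intros continuous_on_compose2[OF continuous_D[of UNIV 0, unfolded D_0]]) auto
  then show ?thesis by (simp add: Psi_def[abs_def])
qed

lemma continuous_Psi_det: "continuous_on S (Psi_det \<psi> :: real^'n::finite \<Rightarrow> real)"
proof -
  have "continuous_on S (\<lambda>x::real^'n. \<Prod>j\<in>UNIV. deriv \<psi> (x $ j))"
    by (intro continuous_intros continuous_on_compose2[OF continuous_D[of UNIV "Suc 0", unfolded D_1]]) auto
  then show ?thesis by (simp add: Psi_det_def[abs_def])
qed

lemma Psi_measurable [measurable]: "(Psi \<psi> :: real^'n::finite \<Rightarrow> real^'n) \<in> borel_measurable borel"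
  and Psi_det_measurable [measurable]: "(Psi_det \<psi> :: real^'n::finite \<Rightarrow> real) \<in> borel_measurable borel"
  by (intro borel_measurable_continuous_onI continuous_Psi continuous_Psi_det)+

lemma Psi_det_nonneg: "Psi_det \<psi> x \<ge> 0"
  unfolding Psi_det_def by (intro prod_nonneg deriv_psi_nonneg)

lemma Psi_in_cube: "Psi \<psi> x \<in> unit_cube"
  by (simp add: Psi_def mem_box_cart psi_range)

lemma Psi_det_outside:
  assumes "x \<notin> unit_cube" shows "Psi_det \<psi> x = 0"
proof -
  obtain j where "x $ j \<notin> {0..1}" using assms by (auto simp: mem_box_cart)
  then have "deriv \<psi> (x $ j) = 0" using D_outside[of "x $ j" 0] by (simp add: D_1)
  then show ?thesis unfolding Psi_det_def by (intro prod_zero) auto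
qed

text \<open>Outside the cube \<Psi> collapses onto the boundary, but the density |D\<Psi>| vanishes
  there. On boxes both measures factor over the coordinates, which reduces the claim to the
  one-dimensional substitution, and boxes determine the measure.\<close>

lemma distr_Psi:
  "distr (density lborel (Psi_det \<psi>)) borel (Psi \<psi> :: real^'n::finite \<Rightarrow> real^'n) =
    density lborel (indicator unit_cube)"
proof (rule measure_eqI_generator_eq)
  let ?E = "range (\<lambda>(a, b). box a b :: (real^'n) set)"
  show "Int_stable ?E" by (auto simp: Int_stable_def box_Int_box)
  show "?E \<subseteq> Pow UNIV" by simp
  show "sets (distr (density lborel (Psi_det \<psi>)) borel (Psi \<psi> :: real^'n \<Rightarrow> real^'n)) = sigma_sets UNIV ?E"
    "sets (density lborel (indicator unit_cube) :: (real^'n) measure) = sigma_sets UNIV ?E"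
    by (simp_all add: borel_eq_box)
  let ?A = "\<lambda>n::nat. box (- (real n *\<^sub>R One)) (real n *\<^sub>R One) :: (real^'n) set"
  show "range ?A \<subseteq> ?E" by auto
  show "(\<Union>n. ?A n) = UNIV" by (rule UN_box_eq_UNIV)
  have le: "emeasure (density lborel (indicator unit_cube)) X \<le> 1" if "X \<in> sets borel" for X :: "(real^'n) set"
  proof -
    have "emeasure (density lborel (indicator unit_cube)) X = emeasure lborel (unit_cube \<inter> X)"
      using that by (simp add: emeasure_density indicator_inter_arith[symmetric])
    also have "\<dots> \<le> emeasure lborel (unit_cube :: (real^'n) set)" using that by (intro emeasure_mono) auto
    also have "\<dots> = 1"
      using emeasure_eq_ennreal_measure[of lborel "unit_cube :: (real^'n) set"] by (simp add: emeasure_lborel_cbox_eq)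
    finally show ?thesis .
  qed
  show eq: "emeasure (distr (density lborel (Psi_det \<psi>)) borel (Psi \<psi>)) X = emeasure (density lborel (indicator unit_cube)) X"
    if "X \<in> ?E" for X :: "(real^'n) set"
  proof -
    obtain l u where X: "X = box l u" using \<open>X \<in> ?E\<close> by auto
    let ?i = "\<lambda>b. indicator {l \<bullet> b<..<u \<bullet> b} :: real \<Rightarrow> real"
    have ind: "indicator (box l u) y = (\<Prod>b\<in>Basis. ?i b (y \<bullet> b))" for y :: "real^'n"
    proof (cases "y \<in> box l u")
      case True
      then show ?thesis by (simp add: mem_box prod.neutral)
    next
      case False
      then obtain b where "b \<in> Basis" "y \<bullet> b \<notin> {l \<bullet> b<..<u \<bullet> b}" by (auto simp: mem_box)
      then have "(\<Prod>b\<in>Basis. ?i b (y \<bullet> b)) = 0" by (intro prod_zero bexI[of _ b]) (auto simp: indicator_def)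
      then show ?thesis using False by simp
    qed
    have [measurable]: "\<psi> \<in> borel_measurable borel" "deriv \<psi> \<in> borel_measurable borel"
      using continuous_D[of UNIV 0] continuous_D[of UNIV "Suc 0"]
      by (simp_all add: borel_measurable_continuous_onI D_0 D_1)
    have m: "(Psi \<psi> :: real^'n \<Rightarrow> real^'n) -` box l u \<in> sets borel"
      using measurable_sets[OF Psi_measurable, of "box l u"] by simp
    have Psi_b: "Psi \<psi> x \<bullet> b = \<psi> (x \<bullet> b)" if "b \<in> Basis" for x b :: "real^'n"
      using that by (auto simp: Basis_vec_def inner_axis Psi_def)
    have det: "Psi_det \<psi> x = (\<Prod>b\<in>Basis. deriv \<psi> (x \<bullet> b))" for x :: "real^'n"
      by (subst prod.reindex_bij_betw[OF bij_betw_axis_Basis, symmetric]) (simp add: Psi_det_def inner_axis)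
    have "emeasure (distr (density lborel (Psi_det \<psi>)) borel (Psi \<psi>)) X = emeasure (density lborel (Psi_det \<psi>)) (Psi \<psi> -` X)"
      by (subst emeasure_distr) (auto simp: X)
    also have "\<dots> = (\<integral>\<^sup>+x. ennreal (indicator (box l u) (Psi \<psi> x) * Psi_det \<psi> x) \<partial>lborel)"
      by (subst emeasure_density) (auto simp: X m indicator_def intro!: nn_integral_cong)
    also have "\<dots> = (\<integral>\<^sup>+x. (\<Prod>b\<in>Basis. ennreal (?i b (\<psi> (x \<bullet> b)) * deriv \<psi> (x \<bullet> b))) \<partial>lborel)"
      unfolding ind det by (simp add: Psi_b prod.distrib[symmetric] prod_ennreal deriv_psi_nonneg)
    also have "\<dots> = (\<Prod>b\<in>Basis. \<integral>\<^sup>+t. ennreal (?i b (\<psi> t) * deriv \<psi> t) \<partial>lborel)"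
      by (rule nn_integral_lborel_prod) auto
    also have "\<dots> = (\<Prod>b\<in>Basis. \<integral>\<^sup>+t. ennreal (?i b t * indicator {0..1} t) \<partial>lborel)"
      by (intro prod.cong nn_integral_psi_substitution) auto
    also have "\<dots> = (\<integral>\<^sup>+x. (\<Prod>b\<in>Basis. ennreal (?i b (x \<bullet> b) * indicator {0..1} (x \<bullet> b))) \<partial>(lborel :: (real^'n) measure))"
      by (rule nn_integral_lborel_prod[symmetric]) auto
    also have "\<dots> = (\<integral>\<^sup>+x. ennreal (indicator (box l u) x * indicator unit_cube x) \<partial>lborel)"
      unfolding ind indicator_unit_cube_prod by (simp add: prod.distrib[symmetric] prod_ennreal)
    also have "\<dots> = emeasure (density lborel (indicator unit_cube)) X"
      by (subst emeasure_density) (auto simp: X intro!: nn_integral_cong simp: indicator_def)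
    finally show ?thesis .
  qed
  show "emeasure (distr (density lborel (Psi_det \<psi>)) borel (Psi \<psi>)) (?A n) \<noteq> \<infinity>" for n
    using le[of "?A n"] by (subst eq) (auto simp: top_unique intro: order_trans)
qed

end

text \<open>\<open>F j k\<close> stands for the pure derivative \<open>\<partial>\<^sub>j\<^sup>k F\<close>; mixed derivatives are never needed.\<close>

definition smooth_family :: "('n::finite \<Rightarrow> nat \<Rightarrow> real^'n \<Rightarrow> real) \<Rightarrow> bool" where
  "smooth_family F \<longleftrightarrow> (\<forall>j k. continuous_on UNIV (F j k) \<and> has_pderiv j (F j k) (F j (Suc k))) \<and>
     (\<forall>i j. F i 0 = F j 0)"

lemma smooth_familyD:
  assumes "smooth_family F"
  shows "continuous_on S (F j k)" "has_pderiv j (F j k) (F j (Suc k))" "F i 0 = F j 0"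
  using assms continuous_on_subset unfolding smooth_family_def by blast+

section \<open>Derivatives of the transformed integrand and their L2 norms\<close>

context smooth_step begin

lemma integral_Psi:
  fixes H :: "real^'n::finite \<Rightarrow> real"
  assumes H: "continuous_on UNIV H"
  shows "integral unit_cube (\<lambda>x. H (Psi \<psi> x) * Psi_det \<psi> x) = integral unit_cube H"
proof -
  have [measurable]: "H \<in> borel_measurable borel" by (rule borel_measurable_continuous_onI[OF H])
  have HP: "continuous_on UNIV (\<lambda>x. H (Psi \<psi> x))"
    by (rule continuous_on_compose2[OF H continuous_Psi]) simp
  have "integral unit_cube (\<lambda>x. H (Psi \<psi> x) * Psi_det \<psi> x) = (LINT x|lborel. H (Psi \<psi> x) * Psi_det \<psi> x)"
    by (rule lborel_integral_eq_integral_cube[symmetric])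
      (auto intro!: continuous_intros HP continuous_Psi_det simp: Psi_det_outside)
  also have "\<dots> = (LINT y|distr (density lborel (Psi_det \<psi>)) borel (Psi \<psi>). H y)"
    by (simp add: integral_distr integral_density Psi_det_nonneg mult.commute)
  also have "\<dots> = (LINT y|density lborel (\<lambda>y. ennreal (indicator unit_cube y)). H y)"
    unfolding distr_Psi by (simp add: ennreal_indicator)
  also have "\<dots> = (LINT y|lborel. indicator unit_cube y *\<^sub>R H y)"
    by (rule integral_density) auto
  also have "\<dots> = integral unit_cube H"
    using H by (intro lborel_integral_cube) (rule continuous_on_subset, auto)
  finally show ?thesis .
qed

text \<open>\<Psi> acts coordinatewise, so moving x along axis j moves \<Psi> x along the same axis,
  merely reparametrized. Hence pure derivatives of the composition involve only pure derivatives of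
  F.\<close>

lemma has_pderiv_Psi:
  assumes "has_pderiv j F (F' :: real^'n::finite \<Rightarrow> real)"
  shows "has_pderiv j (\<lambda>x. F (Psi \<psi> x)) (\<lambda>x. F' (Psi \<psi> x) * deriv \<psi> (x $ j))"
  unfolding has_pderiv_def
proof
  fix x :: "real^'n"
  let ?\<tau> = "\<lambda>t. \<psi> (x $ j + t) - \<psi> (x $ j)"
  have Psi_eq: "Psi \<psi> (x + t *\<^sub>R axis j 1) = Psi \<psi> x + ?\<tau> t *\<^sub>R axis j 1" for t
    by (simp add: Psi_def vec_eq_iff axis_def)
  have "((\<lambda>t. \<psi> (x $ j + t)) has_real_derivative deriv \<psi> (x $ j)) (at 0)"
    using DERIV_shift[of \<psi> "deriv \<psi> (x$j)" 0 "x $ j"] D_deriv[of 0 "x $ j"] by (simp add: add.commute D_0 D_1)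
  then have "(?\<tau> has_real_derivative deriv \<psi> (x $ j)) (at 0)"
    by (auto intro!: derivative_eq_intros)
  moreover have "((\<lambda>t. F (Psi \<psi> x + t *\<^sub>R axis j 1)) has_real_derivative F' (Psi \<psi> x)) (at (?\<tau> 0))"
    using assms by (simp add: has_pderiv_def has_real_derivative_iff_has_vector_derivative)
  ultimately have "((\<lambda>t. F (Psi \<psi> x + ?\<tau> t *\<^sub>R axis j 1)) has_real_derivative F' (Psi \<psi> x) * deriv \<psi> (x $ j)) (at 0)"
    by (intro DERIV_chain2[where f="\<lambda>t. F (Psi \<psi> x + t *\<^sub>R axis j 1)" and g="?\<tau>"])
  then show "((\<lambda>t. F (Psi \<psi> (x + t *\<^sub>R axis j 1))) has_vector_derivative F' (Psi \<psi> x) * deriv \<psi> (x $ j)) (at 0)"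
    by (simp only: Psi_eq has_real_derivative_iff_has_vector_derivative)
qed

text \<open>The part of |D\<Psi>| that \<partial>_j treats as a constant.\<close>

definition cofactor :: "'n::finite \<Rightarrow> real^'n \<Rightarrow> real" where
  "cofactor j x = (\<Prod>i\<in>UNIV - {j}. deriv \<psi> (x $ i))"

lemma Psi_det_cofactor: "Psi_det \<psi> x = deriv \<psi> (x $ j) * cofactor j x"
  unfolding Psi_det_def cofactor_def by (rule prod.remove) auto

lemma has_pderiv_cofactor: "has_pderiv j (cofactor j) (\<lambda>_. 0)"
  by (rule has_pderiv_indep) (auto simp: cofactor_def axis_def intro!: prod.cong)

lemma cofactor_nonneg: "cofactor j x \<ge> 0"
  unfolding cofactor_def by (intro prod_nonneg deriv_psi_nonneg ballI)

lemma continuous_cofactor: "continuous_on S (cofactor j :: real^'n::finite \<Rightarrow> real)"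
proof -
  have "continuous_on S (\<lambda>x::real^'n. \<Prod>i\<in>UNIV - {j}. deriv \<psi> (x $ i))"
    by (intro continuous_intros continuous_on_compose2[OF continuous_D[of UNIV "Suc 0", unfolded D_1]]) auto
  then show ?thesis by (simp add: cofactor_def[abs_def])
qed

text \<open>Outside the cube either x_j leaves the unit interval and c vanishes, or another
  coordinate does and its factor \<psi>' in the cofactor vanishes.\<close>

lemma bump_times_cofactor_outside:
  assumes "\<And>t. t \<notin> {0..1} \<Longrightarrow> c t = 0" "x \<notin> unit_cube"
  shows "c (x $ j) * cofactor j x = 0"
proof (cases "x $ j \<in> {0..1}")
  case True
  obtain i where i: "x $ i \<notin> {0..1}" using assms(2) by (auto simp: mem_box_cart)
  then have "deriv \<psi> (x $ i) = 0" using D_outside[of "x $ i" 0] by (simp add: D_1)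
  moreover have "i \<noteq> j" using i True by auto
  ultimately have "cofactor j x = 0" unfolding cofactor_def by (intro prod_zero) auto
  then show ?thesis by simp
qed (simp add: assms(1))

text \<open>
  The weight \<open>c\<^sup>2\<close> need not be dominated by the Jacobian factor \<open>\<psi>'\<close>. Writing it as
  \<open>b' + \<kappa> \<psi>'\<close> and integrating the first term by parts produces, by the chain rule, the missing factor \<open>\<psi>'\<close> at the cost of one
  derivative of \<open>F\<close>.
\<close>

lemma weighted_L2_bound:
  assumes c: "bump c"
  obtains K where "K \<ge> 0"
    "\<And>F F' :: real^'n::finite \<Rightarrow> real. continuous_on UNIV F \<Longrightarrow> continuous_on UNIV F' \<Longrightarrow> has_pderiv j F F' \<Longrightarrow>
      integral unit_cube (\<lambda>x. (c (x $ j))\<^sup>2 * (F (Psi \<psi> x))\<^sup>2 * cofactor j x) \<le>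
      K * (integral unit_cube (\<lambda>x. (F x)\<^sup>2) + integral unit_cube (\<lambda>x. (F' x)\<^sup>2))"
proof -
  obtain \<kappa> b where \<kappa>: "\<kappa> \<ge> 0" and b: "\<And>t. (b has_real_derivative (c t)\<^sup>2 - \<kappa> * deriv \<psi> t) (at t)"
    and b0: "\<And>t. t \<notin> {0..1} \<Longrightarrow> b t = 0"
    by (rule bump_antiderivative[OF c], rule that)
  have contb: "continuous_on S b" for S
    by (rule continuous_at_imp_continuous_on) (use b DERIV_isCont in blast)
  have "compact (b ` {0..1})" by (intro compact_continuous_image contb) simp
  then obtain \<beta>0 where \<beta>0: "\<And>t. t \<in> {0..1} \<Longrightarrow> \<bar>b t\<bar> \<le> \<beta>0"
    using compact_imp_bounded bounded_iff by (metis imageI real_norm_def)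
  define \<beta> where "\<beta> = max 0 \<beta>0"
  have \<beta>: "\<beta> \<ge> 0" "\<bar>b t\<bar> \<le> \<beta>" for t
    using \<beta>0[of t] b0[of t] by (cases "t \<in> {0..1}"; auto simp: \<beta>_def)+
  show ?thesis
  proof (rule that[of "\<kappa> + \<beta>"])
    show "\<kappa> + \<beta> \<ge> 0" using \<kappa> \<beta> by simp
    fix F F' :: "real^'n \<Rightarrow> real"
    assume F: "continuous_on UNIV F" and F': "continuous_on UNIV F'" and d: "has_pderiv j F F'"
    let ?F = "\<lambda>x. F (Psi \<psi> x)" and ?F' = "\<lambda>x. F' (Psi \<psi> x)" and ?P = "cofactor j" and ?D = "Psi_det \<psi>"
    have cF: "continuous_on S ?F" "continuous_on S ?F'" for S
      by (rule continuous_on_compose2[OF F continuous_Psi] continuous_on_compose2[OF F' continuous_Psi]; simp)+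
    have cc: "continuous_on S (\<lambda>x::real^'n. c (x $ j))" "continuous_on S (\<lambda>x::real^'n. b (x $ j))"
      "continuous_on S (\<lambda>x::real^'n. deriv \<psi> (x $ j))" for S
      by (intro continuous_on_compose2[OF continuous_bump[OF c, of UNIV]] continuous_on_compose2[OF contb[of UNIV]]
          continuous_on_compose2[OF continuous_D[of UNIV "Suc 0", unfolded D_1]] continuous_intros; simp)+
    let ?W = "\<lambda>x. (b (x $ j) * (?F x * ?F x)) * ?P x"
    \<comment> \<open>This is the shape that the product rule yields, with the zero derivative of
      the cofactor left in, so that \<open>has_pderiv_mult\<close> applies as it stands.\<close>
    let ?W' = "\<lambda>x. (b (x $ j) * (?F x * ?F x)) * 0 + (b (x $ j) * (?F x * (?F' x * deriv \<psi> (x $ j)) + (?F' x * deriv \<psi> (x $ j)) * ?F x)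
        + ((c (x $ j))\<^sup>2 - \<kappa> * deriv \<psi> (x $ j)) * (?F x * ?F x)) * ?P x"
    have W0: "integral unit_cube ?W' = 0"
    proof (rule integral_pderiv_eq_0)
      show "continuous_on UNIV ?W" "continuous_on UNIV ?W'"
        by (intro continuous_intros cF cc continuous_cofactor)+
      show "has_pderiv j ?W ?W'"
        by (intro has_pderiv_mult has_pderiv_cofactor has_pderiv_Psi[OF d] has_pderiv_coord b)
      show "?W x = 0" if "x \<notin> unit_cube" for x
        using bump_times_cofactor_outside[where c=b and j=j, OF b0 that] by auto
    qed
    \<comment> \<open>Solving \<open>?W'\<close> for its c^2 term leaves \<kappa> F^2 |D\<Psi>| and
      the cross term -2 b F F' |D\<Psi>|, which is at most \<beta> (F^2 + F'^2) |D\<Psi>|. The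
      Jacobian in each term lets \<open>integral_Psi\<close> undo the substitution.\<close>
    have "integral unit_cube (\<lambda>x. (c (x $ j))\<^sup>2 * (?F x)\<^sup>2 * ?P x) \<le>
       integral unit_cube (\<lambda>x. ?W' x + ((\<kappa> + \<beta>) * ((?F x)\<^sup>2 * ?D x) + \<beta> * ((?F' x)\<^sup>2 * ?D x)))"
    proof (rule integral_le)
      fix x :: "real^'n"
      have "- (2 * b (x $ j) * ?F x * ?F' x) \<le> \<beta> * ((?F x)\<^sup>2 + (?F' x)\<^sup>2)"
      proof -
        have "- (2 * b (x $ j) * ?F x * ?F' x) \<le> \<bar>b (x $ j)\<bar> * \<bar>2 * ?F x * ?F' x\<bar>"
          unfolding abs_mult[symmetric] using abs_ge_minus_self[of "b (x $ j) * (2 * ?F x * ?F' x)"] by (simp add: mult_ac)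
        also have "\<dots> \<le> \<beta> * ((?F x)\<^sup>2 + (?F' x)\<^sup>2)"
        proof (intro mult_mono \<beta>)
          show "\<bar>2 * ?F x * ?F' x\<bar> \<le> (?F x)\<^sup>2 + (?F' x)\<^sup>2"
            using sum_squares_bound[of "?F x" "?F' x"] sum_squares_bound[of "- ?F x" "?F' x"]
            by (simp add: abs_le_iff)
        qed auto
        finally show ?thesis .
      qed
      then have "- (2 * b (x $ j) * ?F x * ?F' x) * ?D x \<le> \<beta> * ((?F x)\<^sup>2 + (?F' x)\<^sup>2) * ?D x"
        by (rule mult_right_mono) (rule Psi_det_nonneg)
      then show "(c (x $ j))\<^sup>2 * (?F x)\<^sup>2 * ?P x \<le> ?W' x + ((\<kappa> + \<beta>) * ((?F x)\<^sup>2 * ?D x) + \<beta> * ((?F' x)\<^sup>2 * ?D x))"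
        unfolding Psi_det_cofactor[of x j] by (simp add: algebra_simps power2_eq_square)
    qed (intro integrable_continuous continuous_intros cF cc continuous_cofactor continuous_Psi_det)+
    also have "\<dots> = integral unit_cube ?W' + ((\<kappa> + \<beta>) * integral unit_cube (\<lambda>x. (?F x)\<^sup>2 * ?D x) + \<beta> * integral unit_cube (\<lambda>x. (?F' x)\<^sup>2 * ?D x))"
    proof -
      have "integral unit_cube (\<lambda>x. ?W' x + ((\<kappa> + \<beta>) * ((?F x)\<^sup>2 * ?D x) + \<beta> * ((?F' x)\<^sup>2 * ?D x))) =
         integral unit_cube ?W' + (integral unit_cube (\<lambda>x. (\<kappa> + \<beta>) * ((?F x)\<^sup>2 * ?D x)) + integral unit_cube (\<lambda>x. \<beta> * ((?F' x)\<^sup>2 * ?D x)))"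
        by (subst Henstock_Kurzweil_Integration.integral_add, (intro integrable_continuous continuous_intros cF cc continuous_cofactor continuous_Psi_det)+)+ simp
      then show ?thesis by (simp only: integral_mult_right)
    qed
    also have "integral unit_cube (\<lambda>x. (?F x)\<^sup>2 * ?D x) = integral unit_cube (\<lambda>x. (F x)\<^sup>2)"
      using integral_Psi[of "\<lambda>x. (F x)\<^sup>2"] F by (auto intro: continuous_intros)
    also have "integral unit_cube (\<lambda>x. (?F' x)\<^sup>2 * ?D x) = integral unit_cube (\<lambda>x. (F' x)\<^sup>2)"
      using integral_Psi[of "\<lambda>x. (F' x)\<^sup>2"] F' by (auto intro: continuous_intros)
    also note W0
    finally have "integral unit_cube (\<lambda>x. (c (x $ j))\<^sup>2 * (?F x)\<^sup>2 * ?P x) \<le>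
        (\<kappa> + \<beta>) * integral unit_cube (\<lambda>x. (F x)\<^sup>2) + \<beta> * integral unit_cube (\<lambda>x. (F' x)\<^sup>2)" by simp
    also have "\<dots> \<le> (\<kappa> + \<beta>) * integral unit_cube (\<lambda>x. (F x)\<^sup>2) + (\<kappa> + \<beta>) * integral unit_cube (\<lambda>x. (F' x)\<^sup>2)"
      using \<kappa> by (intro add_left_mono mult_right_mono Henstock_Kurzweil_Integration.integral_nonneg integrable_continuous continuous_intros continuous_on_subset[OF F']) auto
    finally show "integral unit_cube (\<lambda>x. (c (x $ j))\<^sup>2 * (?F x)\<^sup>2 * ?P x) \<le>
        (\<kappa> + \<beta>) * (integral unit_cube (\<lambda>x. (F x)\<^sup>2) + integral unit_cube (\<lambda>x. (F' x)\<^sup>2))"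
      by (simp add: distrib_left)
  qed
qed

text \<open>\<open>coef l k\<close> multiplies the k-th derivative of F in the l-th derivative of
  F(\<psi>(t)) \<psi>'(t). The start \<psi>' is the factor of the Jacobian that depends on
  coordinate j; each further derivative either hits the coefficient or raises k by one and yields a
  factor \<psi>'.\<close>

primrec coef :: "nat \<Rightarrow> nat \<Rightarrow> real \<Rightarrow> real" where
  "coef 0 = (\<lambda>k. if k = 0 then deriv \<psi> else (\<lambda>_. 0))"
| "coef (Suc l) = (\<lambda>k t. deriv (coef l k) t + (case k of 0 \<Rightarrow> 0 | Suc k' \<Rightarrow> deriv \<psi> t * coef l k' t))"

lemma bump_deriv_psi: "bump (deriv \<psi>)"
  using bump.D[of 0] by (simp add: D_1)

lemma bump_coef: "bump (coef l k)"
proof (induction l arbitrary: k)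
  case 0
  then show ?case using bump_deriv_psi bump.zero by simp
next
  case IH: (Suc l)
  show ?case
  proof (cases k)
    case 0
    then show ?thesis using bump_deriv[OF IH] by simp
  next
    case (Suc k')
    have "bump (\<lambda>t. deriv (coef l k) t + deriv \<psi> t * coef l k' t)"
      by (intro bump.add bump.mult bump_deriv_psi IH bump_deriv[THEN conjunct1])
    then show ?thesis using Suc by simp
  qed
qed

lemma coef_gt: "l < k \<Longrightarrow> coef l k = (\<lambda>_. 0)"
proof (induction l arbitrary: k)
  case (Suc l)
  then obtain k' where "k = Suc k'" "l < k'" by (cases k) auto
  then have z: "coef l k = (\<lambda>_. 0)" "coef l k' = (\<lambda>_. 0)" by (auto intro: Suc.IH)
  have "coef (Suc l) k = (\<lambda>t. deriv (coef l k) t + deriv \<psi> t * coef l k' t)"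
    using \<open>k = Suc k'\<close> by simp
  then show ?case by (simp add: z)
qed simp

text \<open>The powers of \<psi>' in the top coefficient supply the weight |D\<Psi>| at the highest
  order, where F has no derivative to spare.\<close>

lemma coef_diag: "coef l l = (\<lambda>t. deriv \<psi> t ^ Suc l)"
  by (induction l) (auto simp: coef_gt)

text \<open>\<open>\<partial>\<^sub>j\<^sup>l\<close> of \<open>(F \<circ> \<Psi>) |D\<Psi>|\<close>, expanded by the chain and product rules.\<close>

definition transformed :: "('n::finite \<Rightarrow> nat \<Rightarrow> real^'n \<Rightarrow> real) \<Rightarrow> 'n \<Rightarrow> nat \<Rightarrow> real^'n \<Rightarrow> real" where
  "transformed F j l x = (\<Sum>k\<le>l. coef l k (x $ j) * F j k (Psi \<psi> x)) * cofactor j x"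

lemma transformed_0: "transformed F j 0 x = F j 0 (Psi \<psi> x) * Psi_det \<psi> x"
  by (simp add: transformed_def Psi_det_cofactor[of x j])

lemma has_pderiv_transformed:
  assumes F: "smooth_family F"
  shows "has_pderiv j (transformed F j l) (transformed F j (Suc l))"
proof -
  let ?F = "\<lambda>k x. F j k (Psi \<psi> x)"
  have "has_pderiv j (\<lambda>x. (\<Sum>k\<le>l. coef l k (x $ j) * ?F k x) * cofactor j x)
    (\<lambda>x. (\<Sum>k\<le>l. coef l k (x $ j) * ?F k x) * 0 +
      (\<Sum>k\<le>l. coef l k (x $ j) * (?F (Suc k) x * deriv \<psi> (x $ j)) + deriv (coef l k) (x $ j) * ?F k x) * cofactor j x)"
    by (intro has_pderiv_mult has_pderiv_sum has_pderiv_cofactor has_pderiv_coord has_pderiv_Psi smooth_familyD[OF F])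
      (use bump_deriv[OF bump_coef] in blast)
  moreover have eq: "(\<Sum>k\<le>Suc l. coef (Suc l) k t * G k) =
      (\<Sum>k\<le>l. coef l k t * (G (Suc k) * deriv \<psi> t) + deriv (coef l k) t * G k)" for t and G :: "nat \<Rightarrow> real"
  proof -
    have "(\<Sum>k\<le>Suc l. coef (Suc l) k t * G k) = (\<Sum>k\<le>Suc l. deriv (coef l k) t * G k) +
        (\<Sum>k\<le>Suc l. (case k of 0 \<Rightarrow> 0 | Suc k' \<Rightarrow> deriv \<psi> t * coef l k' t) * G k)"
      by (simp only: coef.simps distrib_right sum.distrib)
    also have "(\<Sum>k\<le>Suc l. deriv (coef l k) t * G k) = (\<Sum>k\<le>l. deriv (coef l k) t * G k)"
      by (simp add: coef_gt)
    also have "(\<Sum>k\<le>Suc l. (case k of 0 \<Rightarrow> 0 | Suc k' \<Rightarrow> deriv \<psi> t * coef l k' t) * G k) = (\<Sum>k\<le>l. deriv \<psi> t * coef l k t * G (Suc k))"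
      by (subst sum.atMost_Suc_shift) simp
    finally show ?thesis by (simp add: sum.distrib mult_ac)
  qed
  ultimately show ?thesis
    by (simp only: transformed_def[abs_def] eq mult_zero_right add_0_left)
qed

lemma cube_function_transformed:
  assumes F: "smooth_family F"
  shows "cube_function (transformed F j l)"
  unfolding cube_function_def
proof (intro conjI allI impI)
  have "continuous_on UNIV (\<lambda>x. F j k (Psi \<psi> x))" for k
    by (rule continuous_on_compose2[OF smooth_familyD(1)[OF F, of UNIV] continuous_Psi]) simp
  then show "continuous_on UNIV (transformed F j l)"
    unfolding transformed_def[abs_def]
    by (intro continuous_intros continuous_cofactor continuous_on_compose2[OF continuous_bump[OF bump_coef, of UNIV]]) auto
  fix x :: "real^'a" assume x: "x \<notin> unit_cube"
  have "coef l k (x $ j) * F j k (Psi \<psi> x) * cofactor j x = 0" for k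
    using bump_times_cofactor_outside[where c="coef l k" and j=j, OF _ x] bump_outside[OF bump_coef] by auto
  then show "transformed F j l x = 0" by (simp only: transformed_def sum_distrib_right sum.neutral_const)
qed

text \<open>Cauchy-Schwarz reduces the claim to single terms of the expansion. For k < s,
  \<open>weighted_L2_bound\<close> may spend one more derivative of F, still of order at most s. For
  k = s none is left, but the square of \<open>coef s s\<close> is \<psi>' to the power 2s + 2, and
  one of these factors completes the cofactor to the Jacobian.\<close>

lemma transformed_L2_bound:
  obtains K where "K \<ge> 0" "\<And>F. smooth_family F \<Longrightarrow>
    integral unit_cube (\<lambda>x. (transformed F j s x)\<^sup>2) \<le> K * (\<Sum>k\<le>s. integral unit_cube (\<lambda>x::real^'n::finite. (F j k x)\<^sup>2))"
proof -
  obtain M where M: "M \<ge> 0" "\<And>t. \<bar>deriv \<psi> t\<bar> \<le> M" using bounded_bump[OF bump_deriv_psi] by blast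
  have ex: "\<exists>K\<ge>0. \<forall>F. smooth_family F \<longrightarrow> integral unit_cube (\<lambda>x. (coef s k (x $ j))\<^sup>2 * (F j k (Psi \<psi> x))\<^sup>2 * cofactor j x) \<le>
      K * (\<Sum>k\<le>s. integral unit_cube (\<lambda>x::real^'n. (F j k x)\<^sup>2))" if k: "k \<le> s" for k
  proof (cases "k = s")
    case True
    show ?thesis
    proof (intro exI[of _ "M ^ Suc (2 * s)"] conjI allI impI)
      show "M ^ Suc (2 * s) \<ge> 0" using M by simp
      fix F :: "'n \<Rightarrow> nat \<Rightarrow> real^'n \<Rightarrow> real" assume F: "smooth_family F"
      note cont = smooth_familyD(1)[OF F, of _ j]
      have cF: "continuous_on S (\<lambda>x. F j s (Psi \<psi> x))" for S
        by (rule continuous_on_compose2[OF cont[of UNIV] continuous_Psi]) simp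
      have "integral unit_cube (\<lambda>x. (coef s s (x $ j))\<^sup>2 * (F j s (Psi \<psi> x))\<^sup>2 * cofactor j x) \<le>
         integral unit_cube (\<lambda>x. M ^ Suc (2 * s) * ((F j s (Psi \<psi> x))\<^sup>2 * Psi_det \<psi> x))"
      proof (rule integral_le)
        fix x :: "real^'n"
        let ?p = "deriv \<psi> (x $ j)"
        have p: "0 \<le> ?p" "?p \<le> M" using deriv_psi_nonneg M(2)[of "x $ j"] by auto
        have "(coef s s (x $ j))\<^sup>2 = ?p ^ Suc (2 * s) * ?p" by (simp add: coef_diag power_mult[symmetric] power_mult_distrib power2_eq_square mult_2 power_add)
        also have "\<dots> \<le> M ^ Suc (2 * s) * ?p" using p by (intro mult_right_mono power_mono)
        finally have "(coef s s (x $ j))\<^sup>2 * ((F j s (Psi \<psi> x))\<^sup>2 * cofactor j x) \<le> M ^ Suc (2 * s) * ?p * ((F j s (Psi \<psi> x))\<^sup>2 * cofactor j x)"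
          by (rule mult_right_mono) (simp add: cofactor_nonneg)
        then show "(coef s s (x $ j))\<^sup>2 * (F j s (Psi \<psi> x))\<^sup>2 * cofactor j x \<le> M ^ Suc (2 * s) * ((F j s (Psi \<psi> x))\<^sup>2 * Psi_det \<psi> x)"
          by (simp only: Psi_det_cofactor[of x j] mult_ac)
      qed (intro integrable_continuous continuous_intros cF continuous_cofactor continuous_Psi_det
          continuous_on_compose2[OF continuous_bump[OF bump_coef, of UNIV]]; simp)+
      also have "\<dots> = M ^ Suc (2 * s) * integral unit_cube (\<lambda>x. (F j s x)\<^sup>2)"
        using integral_Psi[of "\<lambda>x. (F j s x)\<^sup>2"] cont by (auto intro: continuous_intros)
      also have "\<dots> \<le> M ^ Suc (2 * s) * (\<Sum>k\<le>s. integral unit_cube (\<lambda>x. (F j k x)\<^sup>2))"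
        using M by (intro mult_left_mono member_le_sum Henstock_Kurzweil_Integration.integral_nonneg integrable_continuous continuous_intros cont) auto
      finally show "integral unit_cube (\<lambda>x. (coef s k (x $ j))\<^sup>2 * (F j k (Psi \<psi> x))\<^sup>2 * cofactor j x) \<le>
         M ^ Suc (2 * s) * (\<Sum>k\<le>s. integral unit_cube (\<lambda>x. (F j k x)\<^sup>2))"
        using True by simp
    qed
  next
    case False
    obtain K where K: "K \<ge> 0"
      "\<And>F F' :: real^'n \<Rightarrow> real. continuous_on UNIV F \<Longrightarrow> continuous_on UNIV F' \<Longrightarrow> has_pderiv j F F' \<Longrightarrow>
      integral unit_cube (\<lambda>x. (coef s k (x $ j))\<^sup>2 * (F (Psi \<psi> x))\<^sup>2 * cofactor j x) \<le>
      K * (integral unit_cube (\<lambda>x. (F x)\<^sup>2) + integral unit_cube (\<lambda>x. (F' x)\<^sup>2))"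
      using weighted_L2_bound[OF bump_coef] by blast
    show ?thesis
    proof (intro exI[of _ K] conjI allI impI K(1))
      fix F :: "'n \<Rightarrow> nat \<Rightarrow> real^'n \<Rightarrow> real" assume F: "smooth_family F"
      note cont = smooth_familyD(1)[OF F, of _ j]
      have "integral unit_cube (\<lambda>x. (F j k x)\<^sup>2) + integral unit_cube (\<lambda>x. (F j (Suc k) x)\<^sup>2) =
          (\<Sum>k\<in>{k, Suc k}. integral unit_cube (\<lambda>x. (F j k x)\<^sup>2))" by simp
      also have "\<dots> \<le> (\<Sum>k\<le>s. integral unit_cube (\<lambda>x. (F j k x)\<^sup>2))"
        using False k by (intro sum_mono2 Henstock_Kurzweil_Integration.integral_nonneg integrable_continuous continuous_intros cont) auto
      finally show "integral unit_cube (\<lambda>x. (coef s k (x $ j))\<^sup>2 * (F j k (Psi \<psi> x))\<^sup>2 * cofactor j x) \<le>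
         K * (\<Sum>k\<le>s. integral unit_cube (\<lambda>x. (F j k x)\<^sup>2))"
        using K(2)[OF cont cont smooth_familyD(2)[OF F], of k] K(1) by (meson mult_left_mono order_trans)
    qed
  qed
  let ?Q = "\<lambda>k K. K \<ge> 0 \<and> (\<forall>F. smooth_family F \<longrightarrow> integral unit_cube (\<lambda>x. (coef s k (x $ j))\<^sup>2 * (F j k (Psi \<psi> x))\<^sup>2 * cofactor j x) \<le>
      K * (\<Sum>k\<le>s. integral unit_cube (\<lambda>x::real^'n. (F j k x)\<^sup>2)))"
  have "\<forall>k. \<exists>K. k \<le> s \<longrightarrow> ?Q k K" using ex by blast
  from choice[OF this] obtain K where "\<forall>k. k \<le> s \<longrightarrow> ?Q k (K k)" ..
  then have K0: "\<And>k. k \<le> s \<Longrightarrow> K k \<ge> 0" and K: "\<And>k F. k \<le> s \<Longrightarrow> smooth_family F \<Longrightarrow>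
     integral unit_cube (\<lambda>x. (coef s k (x $ j))\<^sup>2 * (F j k (Psi \<psi> x))\<^sup>2 * cofactor j x) \<le>
      K k * (\<Sum>k\<le>s. integral unit_cube (\<lambda>x::real^'n. (F j k x)\<^sup>2))" by blast+
  \<comment> \<open>The cofactor occurs squared, while the bounds above contain it once; the other
    copy is bounded by \<open>M'\<close>.\<close>
  define M' where "M' = M ^ card (UNIV - {j})"
  have P: "cofactor j x \<le> M'" for x
    unfolding cofactor_def M'_def prod_constant[symmetric]
    using M(2) deriv_psi_nonneg by (intro prod_mono) (auto simp: abs_le_iff)
  have M': "M' \<ge> 0" using M by (simp add: M'_def)
  show ?thesis
  proof (rule that[of "real (Suc s) * M' * (\<Sum>k\<le>s. K k)"])
    show "real (Suc s) * M' * (\<Sum>k\<le>s. K k) \<ge> 0" using M' K0 by (intro mult_nonneg_nonneg sum_nonneg) auto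
    fix F :: "'n \<Rightarrow> nat \<Rightarrow> real^'n \<Rightarrow> real" assume F: "smooth_family F"
    note cont = smooth_familyD(1)[OF F, of _ j]
    have cF: "continuous_on S (\<lambda>x. F j k (Psi \<psi> x))" for S k
      by (rule continuous_on_compose2[OF cont[of UNIV] continuous_Psi]) simp
    have cc: "continuous_on S (\<lambda>x::real^'n. coef s k (x $ j))" for S k
      by (rule continuous_on_compose2[OF continuous_bump[OF bump_coef, of UNIV]]) (auto intro: continuous_intros)
    let ?t = "\<lambda>k x. (coef s k (x $ j))\<^sup>2 * (F j k (Psi \<psi> x))\<^sup>2 * cofactor j x"
    have "integral unit_cube (\<lambda>x. (transformed F j s x)\<^sup>2) \<le> integral unit_cube (\<lambda>x. real (Suc s) * M' * (\<Sum>k\<le>s. ?t k x))"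
    proof (rule integral_le)
      fix x :: "real^'n"
      let ?a = "\<lambda>k. coef s k (x $ j) * F j k (Psi \<psi> x)"
      have "(\<Sum>k\<le>s. ?a k)\<^sup>2 \<le> real (Suc s) * (\<Sum>k\<le>s. (?a k)\<^sup>2)"
        using Cauchy_Schwarz_ineq_sum[of "\<lambda>_. 1" ?a "{..s}"] by simp
      moreover have "(cofactor j x)\<^sup>2 \<le> M' * cofactor j x"
        unfolding power2_eq_square by (intro mult_right_mono P cofactor_nonneg)
      ultimately have "(\<Sum>k\<le>s. ?a k)\<^sup>2 * (cofactor j x)\<^sup>2 \<le> (real (Suc s) * (\<Sum>k\<le>s. (?a k)\<^sup>2)) * (M' * cofactor j x)"
        by (intro mult_mono) (auto intro!: mult_nonneg_nonneg sum_nonneg)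
      also have "\<dots> = real (Suc s) * M' * (\<Sum>k\<le>s. ?t k x)"
        by (simp add: sum_distrib_left sum_distrib_right power_mult_distrib mult_ac)
      finally show "(transformed F j s x)\<^sup>2 \<le> real (Suc s) * M' * (\<Sum>k\<le>s. ?t k x)"
        by (simp only: transformed_def power_mult_distrib)
    qed (intro integrable_continuous continuous_intros cF cc continuous_cofactor cube_functionD[OF cube_function_transformed[OF F]])+
    also have "\<dots> = real (Suc s) * M' * (\<Sum>k\<le>s. integral unit_cube (?t k))"
      by (simp only: integral_mult_right)
        (subst Henstock_Kurzweil_Integration.integral_sum, auto intro!: integrable_continuous continuous_intros cF cc continuous_cofactor)
    also have "\<dots> \<le> real (Suc s) * M' * (\<Sum>k\<le>s. K k * (\<Sum>k\<le>s. integral unit_cube (\<lambda>x::real^'n. (F j k x)\<^sup>2)))"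
      using M' by (intro mult_left_mono sum_mono K F) auto
    finally show "integral unit_cube (\<lambda>x. (transformed F j s x)\<^sup>2) \<le>
        real (Suc s) * M' * (\<Sum>k\<le>s. K k) * (\<Sum>k\<le>s. integral unit_cube (\<lambda>x. (F j k x)\<^sup>2))"
      by (simp only: sum_distrib_right mult.assoc)
  qed
qed

end

section \<open>Mollification of Sobolev functions\<close>

text \<open>Connects the Frechet derivative behind \<open>smooth\<close> and
  \<open>multi_deriv\<close> with the derivative along an axis on which the estimates rest.\<close>

lemma partial_deriv_eq:
  assumes "h differentiable (at x)" "has_pderiv j h h'"
  shows "partial_deriv j h x = h' x"
proof -
  let ?f' = "frechet_derivative h (at x)"
  have d: "(h has_derivative ?f') (at x)" using assms(1) by (simp add: frechet_derivative_works)
  have "((\<lambda>t. x + t *\<^sub>R axis j 1) has_derivative (\<lambda>t. t *\<^sub>R axis j 1)) (at 0)"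
    by (auto intro!: derivative_eq_intros)
  from has_derivative_compose[OF this, of h ?f'] d
  have "((\<lambda>t. h (x + t *\<^sub>R axis j 1)) has_derivative (\<lambda>t. ?f' (t *\<^sub>R axis j 1))) (at 0)" by simp
  moreover have "?f' (t *\<^sub>R axis j 1) = t *\<^sub>R ?f' (axis j 1)" for t
    using has_derivative_linear[OF d] by (rule linear_scale)
  ultimately have "((\<lambda>t. h (x + t *\<^sub>R axis j 1)) has_vector_derivative ?f' (axis j 1)) (at 0)"
    by (simp add: has_vector_derivative_def)
  moreover have "((\<lambda>t. h (x + t *\<^sub>R axis j 1)) has_vector_derivative h' x) (at 0)"
    using assms(2) by (simp add: has_pderiv_def)
  ultimately show ?thesis
    unfolding partial_deriv_def by (rule vector_derivative_unique_at)
qed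

lemma cube_integral_eq_integral:
  assumes "continuous_on unit_cube f"
  shows "cube_integral f = integral unit_cube f"
  unfolding cube_integral_def
  by (intro lebesgue_integral_eq_integral continuous_imp_integrable assms) auto

lemma nn_integral_affine:
  fixes f :: "real^'n::finite \<Rightarrow> ennreal"
  assumes [measurable]: "f \<in> borel_measurable borel" and a: "a \<noteq> 0"
  shows "ennreal (\<bar>a\<bar> ^ CARD('n)) * (\<integral>\<^sup>+x. f (c + a *\<^sub>R x) \<partial>lborel) = (\<integral>\<^sup>+x. f x \<partial>lborel)"
proof -
  have "ennreal \<bar>\<Prod>i::'n\<in>UNIV. a\<bar> * (\<integral>\<^sup>+x. f (c + (\<chi> i. a * x $ i)) \<partial>lborel) = (\<integral>\<^sup>+x. f (c + x) \<partial>lborel)"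
    by (rule nn_integral_diagonal[where f="\<lambda>x. f (c + x)"]) (use a in auto)
  moreover have "(\<chi> i. a * x $ i) = a *\<^sub>R x" for x :: "real^'n" by (simp add: vec_eq_iff)
  moreover have "(\<integral>\<^sup>+x. f (c + x) \<partial>lborel) = (\<integral>\<^sup>+x. f x \<partial>lborel)"
    using nn_integral_distr[of "(+) c" lborel borel f] lborel_distr_plus[of c] by simp
  ultimately show ?thesis by (simp add: power_abs)
qed

lemma nn_integral_cube_eq_integral:
  fixes f :: "real^'n::finite \<Rightarrow> real"
  assumes f: "continuous_on unit_cube f" and nn: "\<And>x. f x \<ge> 0"
  shows "(\<integral>\<^sup>+x. ennreal (f x) * indicator unit_cube x \<partial>lborel) = ennreal (integral unit_cube f)"
proof -
  have "(\<integral>\<^sup>+x. ennreal (indicator unit_cube x *\<^sub>R f x) \<partial>lborel) = ennreal (LINT x|lborel. indicator unit_cube x *\<^sub>R f x)"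
    using nn by (intro nn_integral_eq_integral borel_integrable_compact f) auto
  also have "(\<integral>\<^sup>+x. ennreal (indicator unit_cube x *\<^sub>R f x) \<partial>lborel) = (\<integral>\<^sup>+x. ennreal (f x) * indicator unit_cube x \<partial>lborel)"
    by (intro nn_integral_cong) (auto simp: indicator_def)
  finally show ?thesis unfolding lborel_integral_cube[OF f] .
qed

context smooth_step begin

text \<open>The Jacobian \<open>|D\<Psi>|\<close>, a smooth bump of mass one, serves as the mollifier; \<open>kernel j k\<close> is \<open>\<partial>\<^sub>j\<^sup>k\<close> of it.\<close>

definition kernel :: "'n::finite \<Rightarrow> nat \<Rightarrow> real^'n \<Rightarrow> real" where
  "kernel j k w = D (Suc k) (w $ j) * cofactor j w"

lemma kernel_0: "kernel j 0 = Psi_det \<psi>"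
  by (rule ext) (simp add: kernel_def D_1 Psi_det_cofactor[of _ j])

lemma continuous_kernel: "continuous_on S (kernel j k)"
  unfolding kernel_def[abs_def]
  by (intro continuous_intros continuous_cofactor continuous_on_compose2[OF continuous_D[of UNIV]]) auto

lemma has_pderiv_kernel: "has_pderiv j (kernel j k) (kernel j (Suc k))"
proof -
  have "has_pderiv j (\<lambda>w. D (Suc k) (w $ j) * cofactor j w)
     (\<lambda>w. D (Suc k) (w $ j) * 0 + D (Suc (Suc k)) (w $ j) * cofactor j w)"
    by (intro has_pderiv_mult has_pderiv_cofactor has_pderiv_coord D_deriv)
  then show ?thesis by (simp add: kernel_def[abs_def])
qed

text \<open>All partial derivatives of the product kernel stay in one explicit family indexed by the
  orders c. The formula depends only on how often each coordinate occurs in the list, so it is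
  insensitive to the order of differentiation chosen by \<open>multi_deriv\<close>.\<close>

lemma foldr_partial_deriv_product:
  fixes z :: "real^'n::finite" and \<epsilon> :: real
  defines "\<Phi> \<equiv> \<lambda>c (y::real^'n). \<Prod>i\<in>UNIV. (-1/\<epsilon>) ^ c i * D (Suc (c i)) ((z $ i - y $ i) / \<epsilon>)"
  shows "foldr partial_deriv is (\<Phi> c) = \<Phi> (\<lambda>i. c i + count_list is i)" "\<Phi> c differentiable (at x)"
proof -
  have d: "((\<lambda>t. (-1/\<epsilon>) ^ a * D (Suc a) ((u - t) / \<epsilon>)) has_real_derivative (-1/\<epsilon>) ^ Suc a * D (Suc (Suc a)) ((u - t) / \<epsilon>)) (at t)" for a u t
  proof -
    have "((\<lambda>t. (u - t) / \<epsilon>) has_real_derivative - 1 / \<epsilon>) (at t)"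
      by (auto intro!: derivative_eq_intros simp: divide_inverse)
    from DERIV_chain2[OF D_deriv[of "Suc a" "(u - t) / \<epsilon>"] this]
    have "((\<lambda>t. D (Suc a) ((u - t) / \<epsilon>)) has_real_derivative D (Suc (Suc a)) ((u - t) / \<epsilon>) * (- 1 / \<epsilon>)) (at t)" .
    from DERIV_cmult[OF this, of "(-1/\<epsilon>) ^ a"] show ?thesis by (simp add: mult_ac)
  qed
  show diff: "\<Phi> c differentiable (at x)" for c x
  proof -
    have "((\<lambda>y. (-1/\<epsilon>) ^ c i * D (Suc (c i)) ((z $ i - y $ i) / \<epsilon>)) has_derivative
       (\<lambda>h. h $ i * ((-1/\<epsilon>) ^ Suc (c i) * D (Suc (Suc (c i))) ((z $ i - x $ i) / \<epsilon>)))) (at x)" for i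
      using has_derivative_compose[OF bounded_linear.has_derivative[OF bounded_linear_vec_nth has_derivative_ident]
        d[of "c i" "z $ i" "x $ i", unfolded has_field_derivative_def]]
      by (simp add: mult.commute)
    then have "(\<Phi> c has_derivative (\<lambda>h. \<Sum>i\<in>UNIV. (h $ i * ((-1/\<epsilon>) ^ Suc (c i) * D (Suc (Suc (c i))) ((z $ i - x $ i) / \<epsilon>))) *
        (\<Prod>j\<in>UNIV - {i}. (-1/\<epsilon>) ^ c j * D (Suc (c j)) ((z $ j - x $ j) / \<epsilon>)))) (at x)"
      unfolding \<Phi>_def by (rule has_derivative_prod)
    then show ?thesis by (rule differentiableI)
  qed
  have pd: "partial_deriv i (\<Phi> c) = \<Phi> (c(i := Suc (c i)))" for i c
  proof (rule ext, rule partial_deriv_eq[OF diff])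
    let ?h = "\<lambda>a i y. (-1/\<epsilon>) ^ a * D (Suc a) ((z $ i - y) / \<epsilon>)"
    let ?rest = "\<lambda>y. \<Prod>j\<in>UNIV - {i}. ?h (c j) j (y $ j)"
    have "has_pderiv i (\<lambda>y. ?h (c i) i (y $ i) * ?rest y) (\<lambda>y. ?h (c i) i (y $ i) * 0 + ?h (Suc (c i)) i (y $ i) * ?rest y)"
      by (intro has_pderiv_mult has_pderiv_coord d has_pderiv_indep) (auto simp: axis_def intro!: prod.cong)
    moreover have "\<Phi> c = (\<lambda>y. ?h (c i) i (y $ i) * ?rest y)"
      unfolding \<Phi>_def by (rule ext) (rule prod.remove; simp)
    moreover have "\<Phi> (c(i := Suc (c i))) = (\<lambda>y. ?h (Suc (c i)) i (y $ i) * ?rest y)"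
      unfolding \<Phi>_def by (rule ext, subst prod.remove[of _ i]) (auto intro!: prod.cong)
    ultimately show "has_pderiv i (\<Phi> c) (\<Phi> (c(i := Suc (c i))))" by simp
  qed
  show "foldr partial_deriv is (\<Phi> c) = \<Phi> (\<lambda>i. c i + count_list is i)"
  proof (induction "is")
    case (Cons i is')
    have "foldr partial_deriv (i # is') (\<Phi> c) = \<Phi> ((\<lambda>i. c i + count_list is' i)(i := Suc (c i + count_list is' i)))"
      by (simp add: Cons pd)
    also have "(\<lambda>i. c i + count_list is' i)(i := Suc (c i + count_list is' i)) = (\<lambda>j. c j + count_list (i # is') j)"
      by auto
    finally show ?case .
  qed simp
qed

abbreviation shifted_kernel :: "real \<Rightarrow> real^'n::finite \<Rightarrow> 'n \<Rightarrow> nat \<Rightarrow> real^'n \<Rightarrow> real" where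
  "shifted_kernel \<epsilon> z j k y \<equiv> kernel j k ((1/\<epsilon>) *\<^sub>R (z - y))"

lemma Psi_det_scaled:
  "Psi_det \<psi> ((1/\<epsilon>) *\<^sub>R (z - y)) = (\<Prod>i\<in>UNIV. (-1/\<epsilon>) ^ 0 * D (Suc 0) ((z $ i - y $ i) / \<epsilon>))"
  by (simp add: Psi_det_def D_1)

text \<open>\<psi>' vanishes off [0,1], so the kernel at z sees only y with coordinates in
  [z_i - \<epsilon>, z_i]; hence the asymmetric conditions on z.\<close>

lemma test_function_kernel:
  fixes z :: "real^'n::finite"
  assumes \<epsilon>: "\<epsilon> > 0" and z: "\<And>i. \<epsilon> < z $ i" "\<And>i. z $ i < 1"
  shows "test_function (\<lambda>y. Psi_det \<psi> ((1/\<epsilon>) *\<^sub>R (z - y)))"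
  unfolding test_function_def
proof
  show "smooth (\<lambda>y. Psi_det \<psi> ((1/\<epsilon>) *\<^sub>R (z - y)))"
    unfolding smooth_def Psi_det_scaled foldr_partial_deriv_product(1)[where \<epsilon>=\<epsilon> and z=z and c="\<lambda>_. 0"]
    by (intro allI foldr_partial_deriv_product(2)[where c="\<lambda>i. 0 + count_list l i" for l])
  let ?K = "cbox (z - vec \<epsilon>) z"
  have "?K \<subseteq> box (vec 0) (vec 1)"
  proof
    fix y assume y: "y \<in> ?K"
    have "0 < y $ i \<and> y $ i < 1" for i
      using y[unfolded mem_box_cart, rule_format, of i] z(1)[of i] z(2)[of i] by simp
    then show "y \<in> box (vec 0) (vec 1)" by (simp add: mem_box_cart)
  qed
  moreover have "Psi_det \<psi> ((1/\<epsilon>) *\<^sub>R (z - y)) = 0" if "y \<notin> ?K" for y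
  proof (rule Psi_det_outside)
    show "(1/\<epsilon>) *\<^sub>R (z - y) \<notin> unit_cube"
    proof
      assume *: "(1/\<epsilon>) *\<^sub>R (z - y) \<in> unit_cube"
      have "z $ i - \<epsilon> \<le> y $ i \<and> y $ i \<le> z $ i" for i
        using *[unfolded mem_box_cart, rule_format, of i] \<epsilon> by (simp add: field_simps)
      then have "y \<in> ?K" by (simp add: mem_box_cart)
      with that show False by blast
    qed
  qed
  ultimately show "\<exists>K. compact K \<and> K \<subseteq> box (vec 0) (vec 1) \<and> (\<forall>x. x \<notin> K \<longrightarrow> Psi_det \<psi> ((1/\<epsilon>) *\<^sub>R (z - x)) = 0)"
    by (intro exI[of _ ?K]) auto
qed

lemma multi_deriv_kernel:
  fixes z :: "real^'n::finite"
  assumes \<alpha>: "\<alpha> = (\<lambda>i. if i = j then k else 0)"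
  shows "multi_deriv \<alpha> (\<lambda>y. Psi_det \<psi> ((1/\<epsilon>) *\<^sub>R (z - y))) = (\<lambda>y. (-1/\<epsilon>) ^ k * shifted_kernel \<epsilon> z j k y)"
proof -
  \<comment> \<open>Only the multiplicities of the chosen list matter; \<open>replicate k j\<close>
    shows that a list with these multiplicities exists.\<close>
  let ?is = "SOME is. \<forall>i. count_list is i = \<alpha> i"
  have "count_list (replicate k j) i = (if i = j then k else 0)" for i
    by (induction k) auto
  then have "\<forall>i. count_list (replicate k j) i = \<alpha> i" by (simp add: \<alpha>)
  then have "\<exists>is. \<forall>i. count_list is i = \<alpha> i" by blast
  then have "\<forall>i. count_list ?is i = \<alpha> i" by (rule someI_ex)
  then have cnt: "count_list ?is i = \<alpha> i" for i by blast
  have "multi_deriv \<alpha> (\<lambda>y. Psi_det \<psi> ((1/\<epsilon>) *\<^sub>R (z - y))) =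
      (\<lambda>y. \<Prod>i\<in>UNIV. (-1/\<epsilon>) ^ \<alpha> i * D (Suc (\<alpha> i)) ((z $ i - y $ i) / \<epsilon>))"
    unfolding multi_deriv_def Psi_det_scaled foldr_partial_deriv_product(1)[where \<epsilon>=\<epsilon> and z=z and c="\<lambda>_. 0"]
    by (simp only: cnt add_0_left)
  also have "\<dots> = (\<lambda>y. (-1/\<epsilon>) ^ k * shifted_kernel \<epsilon> z j k y)"
  proof
    fix y
    have "(\<Prod>i\<in>UNIV. (-1/\<epsilon>) ^ \<alpha> i * D (Suc (\<alpha> i)) ((z $ i - y $ i) / \<epsilon>)) =
      ((-1/\<epsilon>) ^ \<alpha> j * D (Suc (\<alpha> j)) ((z $ j - y $ j) / \<epsilon>)) * (\<Prod>i\<in>UNIV-{j}. (-1/\<epsilon>) ^ \<alpha> i * D (Suc (\<alpha> i)) ((z $ i - y $ i) / \<epsilon>))"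
      by (rule prod.remove) auto
    also have "(\<Prod>i\<in>UNIV-{j}. (-1/\<epsilon>) ^ \<alpha> i * D (Suc (\<alpha> i)) ((z $ i - y $ i) / \<epsilon>)) = cofactor j ((1/\<epsilon>) *\<^sub>R (z - y))"
      unfolding cofactor_def by (rule prod.cong) (auto simp: \<alpha> D_1)
    finally show "(\<Prod>i\<in>UNIV. (-1/\<epsilon>) ^ \<alpha> i * D (Suc (\<alpha> i)) ((z $ i - y $ i) / \<epsilon>)) = (-1/\<epsilon>) ^ k * shifted_kernel \<epsilon> z j k y"
      by (simp add: kernel_def \<alpha>)
  qed
  finally show ?thesis .
qed

text \<open>The kernel, as a function of y, is the test function. Each derivative in y gives a
  factor -1/\<epsilon>, and the signs cancel against the (-1)^k in the definition of the weak
  derivative.\<close>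

lemma weak_deriv_kernel:
  fixes z :: "real^'n::finite"
  assumes g: "L2_weak_deriv (\<lambda>i. if i = j then k else 0) f g" and f: "continuous_on unit_cube f"
    and \<epsilon>: "\<epsilon> > 0" and z: "\<And>i. \<epsilon> < z $ i" "\<And>i. z $ i < 1"
  shows "integral unit_cube (\<lambda>y. f y * shifted_kernel \<epsilon> z j k y) =
    \<epsilon> ^ k * cube_integral (\<lambda>y. g y * Psi_det \<psi> ((1/\<epsilon>) *\<^sub>R (z - y)))"
proof -
  have c: "continuous_on S (shifted_kernel \<epsilon> z j k)" for S
    by (intro continuous_on_compose2[OF continuous_kernel[of UNIV]] continuous_intros) auto
  have "cube_integral (\<lambda>y. f y * multi_deriv (\<lambda>i. if i = j then k else 0) (\<lambda>y. Psi_det \<psi> ((1/\<epsilon>) *\<^sub>R (z - y))) y) =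
      (-1) ^ multi_order (\<lambda>i. if i = j then k else 0) * cube_integral (\<lambda>y. g y * Psi_det \<psi> ((1/\<epsilon>) *\<^sub>R (z - y)))"
    using g test_function_kernel[OF \<epsilon> z] unfolding L2_weak_deriv_def by blast
  also have "multi_order (\<lambda>i. if i = j then k else 0) = k" by (simp add: multi_order_def)
  finally have "cube_integral (\<lambda>y. f y * ((-1/\<epsilon>) ^ k * shifted_kernel \<epsilon> z j k y)) = (-1) ^ k * cube_integral (\<lambda>y. g y * Psi_det \<psi> ((1/\<epsilon>) *\<^sub>R (z - y)))"
    by (simp only: multi_deriv_kernel[OF refl])
  also have "cube_integral (\<lambda>y. f y * ((-1/\<epsilon>) ^ k * shifted_kernel \<epsilon> z j k y)) = integral unit_cube (\<lambda>y. (-1/\<epsilon>) ^ k * (f y * shifted_kernel \<epsilon> z j k y))"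
  proof -
    have "cube_integral (\<lambda>y. f y * ((-1/\<epsilon>) ^ k * shifted_kernel \<epsilon> z j k y)) = integral unit_cube (\<lambda>y. f y * ((-1/\<epsilon>) ^ k * shifted_kernel \<epsilon> z j k y))"
      by (intro cube_integral_eq_integral continuous_intros f c)
    then show ?thesis by (simp only: mult.left_commute)
  qed
  also have "\<dots> = (-1/\<epsilon>) ^ k * integral unit_cube (\<lambda>y. f y * shifted_kernel \<epsilon> z j k y)" by (rule integral_mult_right)
  finally have "(-\<epsilon>) ^ k * ((-1/\<epsilon>) ^ k * integral unit_cube (\<lambda>y. f y * shifted_kernel \<epsilon> z j k y)) =
     (-\<epsilon>) ^ k * ((-1) ^ k * cube_integral (\<lambda>y. g y * Psi_det \<psi> ((1/\<epsilon>) *\<^sub>R (z - y))))" by simp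
  moreover have "(-\<epsilon>) ^ k * (-1/\<epsilon>) ^ k = 1" "(-\<epsilon>) ^ k * (-1) ^ k = \<epsilon> ^ k"
    using \<epsilon> by (simp_all flip: power_mult_distrib)
  ultimately show ?thesis by (simp only: mult.assoc[symmetric] mult_1)
qed

text \<open>A reflected and scaled copy of |D\<Psi>|, which has mass one. The conditions on z keep
  the whole support inside the cube, so no mass is lost.\<close>

lemma kernel_mass:
  fixes z :: "real^'n::finite"
  assumes \<epsilon>: "\<epsilon> > 0" and z: "\<And>i. \<epsilon> \<le> z $ i" "\<And>i. z $ i \<le> 1"
  shows "((\<lambda>y. Psi_det \<psi> ((1/\<epsilon>) *\<^sub>R (z - y))) has_integral \<epsilon> ^ CARD('n)) unit_cube"
proof -
  have "integral unit_cube (Psi_det \<psi> :: real^'n \<Rightarrow> real) = 1"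
    using integral_Psi[of "\<lambda>_. 1 :: real"] by simp
  then have "((Psi_det \<psi> :: real^'n \<Rightarrow> real) has_integral 1) unit_cube"
    using integrable_integral[OF integrable_continuous[OF continuous_Psi_det]] by metis
  from has_integral_affinity[OF this, of "-1/\<epsilon>" "(1/\<epsilon>) *\<^sub>R z"] \<epsilon>
  have 1: "((\<lambda>y. Psi_det \<psi> ((1/\<epsilon>) *\<^sub>R (z - y))) has_integral \<epsilon> ^ CARD('n))
     ((\<lambda>x. (1 / (-1/\<epsilon>)) *\<^sub>R x + -((1 / (-1/\<epsilon>)) *\<^sub>R ((1/\<epsilon>) *\<^sub>R z))) ` unit_cube)"
    by (simp add: scaleR_diff_right power_one_over abs_divide power_divide)
  have eq: "(1 / (-1/\<epsilon>)) *\<^sub>R x + -((1 / (-1/\<epsilon>)) *\<^sub>R ((1/\<epsilon>) *\<^sub>R z)) = z - \<epsilon> *\<^sub>R x" for x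
    using \<epsilon> by (simp add: vec_eq_iff)
  show ?thesis
  proof (rule has_integral_on_superset[OF 1[unfolded eq]])
    show "Psi_det \<psi> ((1/\<epsilon>) *\<^sub>R (z - y)) = 0" if "y \<notin> (\<lambda>x. z - \<epsilon> *\<^sub>R x) ` unit_cube" for y
    proof (rule Psi_det_outside, rule notI)
      assume "(1/\<epsilon>) *\<^sub>R (z - y) \<in> unit_cube"
      moreover have "y = z - \<epsilon> *\<^sub>R ((1/\<epsilon>) *\<^sub>R (z - y))" using \<epsilon> by simp
      ultimately show False using that by blast
    qed
    show "(\<lambda>x. z - \<epsilon> *\<^sub>R x) ` unit_cube \<subseteq> unit_cube"
    proof (rule image_subsetI)
      fix x :: "real^'n" assume x: "x \<in> unit_cube"
      have "0 \<le> z $ i - \<epsilon> * x $ i \<and> z $ i - \<epsilon> * x $ i \<le> 1" for i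
      proof -
        have xi: "0 \<le> x $ i" "x $ i \<le> 1" using x[unfolded mem_box_cart, rule_format, of i] by auto
        have "\<epsilon> * x $ i \<le> \<epsilon> * 1" "0 \<le> \<epsilon> * x $ i" using \<epsilon> xi by (intro mult_left_mono mult_nonneg_nonneg; simp)+
        then show ?thesis using z(1)[of i] z(2)[of i] by linarith
      qed
      then show "z - \<epsilon> *\<^sub>R x \<in> unit_cube" by (simp add: mem_box_cart)
    qed
  qed
qed

text \<open>Evaluating at the contracted point keeps the support of the mollifier inside the open cube.\<close>

definition contraction :: "real \<Rightarrow> real^'n::finite \<Rightarrow> real^'n" where
  "contraction \<epsilon> x = vec (2 * \<epsilon>) + (1 - 3 * \<epsilon>) *\<^sub>R x"

text \<open>The k-th pure derivative of the mollification of f at the contracted point: (1 - 3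
  \<epsilon>)/\<epsilon> is the chain-rule factor of contraction and scaling, and
  \<open>\<epsilon> ^ CARD('n)\<close> normalizes the kernel to mass one. All derivatives fall on
  the kernel.\<close>

definition mollified :: "real \<Rightarrow> (real^'n::finite \<Rightarrow> real) \<Rightarrow> 'n \<Rightarrow> nat \<Rightarrow> real^'n \<Rightarrow> real" where
  "mollified \<epsilon> f j k x = ((1 - 3 * \<epsilon>) / \<epsilon>) ^ k / \<epsilon> ^ CARD('n) *
     integral unit_cube (\<lambda>y. f y * shifted_kernel \<epsilon> (contraction \<epsilon> x) j k y)"

lemma smooth_family_mollified:
  fixes f :: "real^'n::finite \<Rightarrow> real"
  assumes f: "continuous_on unit_cube f"
  shows "smooth_family (mollified \<epsilon> f)"
proof -
  let ?r = "(1 - 3 * \<epsilon>) / \<epsilon>"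
  have cz: "continuous_on S (contraction \<epsilon> :: real^'n \<Rightarrow> real^'n)" for S
    unfolding contraction_def by (intro continuous_intros)
  have cont: "continuous_on UNIV (mollified \<epsilon> f j k)" for j k
  proof -
    have "continuous_on UNIV (\<lambda>x. integral unit_cube (\<lambda>y. f y * shifted_kernel \<epsilon> (contraction \<epsilon> x) j k y))"
      by (rule integral_continuous_on_param)
        (auto simp: split_beta intro!: continuous_intros continuous_on_compose2[OF f]
          continuous_on_compose2[OF continuous_kernel[of UNIV]] continuous_on_compose2[OF cz[of UNIV]])
    then show ?thesis unfolding mollified_def[abs_def] by (intro continuous_intros)
  qed
  have pd: "has_pderiv j (mollified \<epsilon> f j k) (mollified \<epsilon> f j (Suc k))" for j k
    unfolding has_pderiv_def
  proof
    fix x :: "real^'n"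
    let ?e = "axis j 1 :: real^'n" and ?w = "\<lambda>y. (1/\<epsilon>) *\<^sub>R (contraction \<epsilon> x - y)"
    have arg: "(1/\<epsilon>) *\<^sub>R (contraction \<epsilon> (x + t *\<^sub>R ?e) - y) = ?w y + (t * ?r) *\<^sub>R ?e" for t y
      by (simp add: contraction_def algebra_simps scaleR_diff_left divide_inverse)
    have dk: "((\<lambda>t. f y * kernel j k (?w y + (t * ?r) *\<^sub>R ?e)) has_vector_derivative
        f y * (?r * kernel j (Suc k) (?w y + (t * ?r) *\<^sub>R ?e))) (at t within UNIV)" for t y
    proof -
      have "((\<lambda>t. t * ?r) has_vector_derivative ?r) (at t)"
        unfolding has_real_derivative_iff_has_vector_derivative[symmetric]
        by (rule DERIV_cmult_right[OF DERIV_ident, unfolded mult_1])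
      from vector_diff_chain_at[OF this has_pderivD[OF has_pderiv_kernel, of j k "?w y" "t * ?r" UNIV]]
      have "((\<lambda>t. kernel j k (?w y + (t * ?r) *\<^sub>R ?e)) has_vector_derivative ?r * kernel j (Suc k) (?w y + (t * ?r) *\<^sub>R ?e)) (at t)"
        by (simp add: o_def)
      then show ?thesis by (intro has_vector_derivative_mult_right) simp
    qed
    have "((\<lambda>t. integral unit_cube (\<lambda>y. f y * kernel j k (?w y + (t * ?r) *\<^sub>R ?e))) has_vector_derivative
      integral unit_cube (\<lambda>y. f y * (?r * kernel j (Suc k) (?w y + (0 * ?r) *\<^sub>R ?e)))) (at 0 within UNIV)"
    proof (rule leibniz_rule_vector_derivative[OF dk])
      show "(\<lambda>y. f y * kernel j k (?w y + (t * ?r) *\<^sub>R ?e)) integrable_on unit_cube" for t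
        by (intro integrable_continuous continuous_intros f continuous_on_compose2[OF continuous_kernel[of UNIV]]) auto
      show "continuous_on (UNIV \<times> unit_cube) (\<lambda>(t, y). f y * (?r * kernel j (Suc k) (?w y + (t * ?r) *\<^sub>R ?e)))"
        unfolding split_beta
        by (intro continuous_intros continuous_on_compose2[OF f] continuous_on_compose2[OF continuous_kernel[of UNIV]]) auto
    qed auto
    from has_vector_derivative_mult_right[OF this, of "?r ^ k / \<epsilon> ^ CARD('n)"]
    have "((\<lambda>t. mollified \<epsilon> f j k (x + t *\<^sub>R ?e)) has_vector_derivative
      ?r ^ k / \<epsilon> ^ CARD('n) * integral unit_cube (\<lambda>y. f y * (?r * kernel j (Suc k) (?w y + (0 * ?r) *\<^sub>R ?e)))) (at 0)"
      by (simp only: mollified_def arg)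
    also have "integral unit_cube (\<lambda>y. f y * (?r * kernel j (Suc k) (?w y + (0 * ?r) *\<^sub>R ?e))) =
      ?r * integral unit_cube (\<lambda>y. f y * kernel j (Suc k) (?w y))"
      unfolding integral_mult_right[symmetric] by (simp add: mult.left_commute)
    finally show "((\<lambda>t. mollified \<epsilon> f j k (x + t *\<^sub>R ?e)) has_vector_derivative mollified \<epsilon> f j (Suc k) x) (at 0)"
      by (rule has_vector_derivative_eq_rhs) (simp add: mollified_def mult_ac)
  qed
  show ?thesis
    unfolding smooth_family_def using cont pd by (auto simp: mollified_def fun_eq_iff kernel_0)
qed

text \<open>On the cube the contracted coordinates lie in [2 \<epsilon>, 1 - \<epsilon>], so the
  support of the kernel keeps a distance \<epsilon> from the boundary.\<close>

lemma contraction_bounds: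
  assumes \<epsilon>: "0 < \<epsilon>" "\<epsilon> \<le> 1/6" and x: "x \<in> unit_cube"
  shows "\<epsilon> < contraction \<epsilon> x $ i" "contraction \<epsilon> x $ i < 1" "\<bar>contraction \<epsilon> x $ i - x $ i\<bar> \<le> 2 * \<epsilon>"
proof -
  have xi: "0 \<le> x $ i" "x $ i \<le> 1" using x[unfolded mem_box_cart, rule_format, of i] by auto
  have "\<epsilon> * x $ i \<le> \<epsilon> * 1" "0 \<le> \<epsilon> * x $ i" using \<epsilon> xi by (intro mult_nonneg_nonneg mult_left_mono; simp)+
  moreover have "x $ i - 3 * (\<epsilon> * x $ i) \<le> 1 - 3 * \<epsilon>" "0 \<le> x $ i - 3 * (\<epsilon> * x $ i)"
    using mult_left_mono[of "x $ i" 1 "1 - 3 * \<epsilon>"] mult_nonneg_nonneg[of "1 - 3 * \<epsilon>" "x $ i"] \<epsilon> xi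
    by (simp_all add: left_diff_distrib mult.assoc)
  moreover have "contraction \<epsilon> x $ i = 2 * \<epsilon> + x $ i - 3 * (\<epsilon> * x $ i)"
    by (simp add: contraction_def left_diff_distrib mult.assoc)
  ultimately show "\<epsilon> < contraction \<epsilon> x $ i" "contraction \<epsilon> x $ i < 1" "\<bar>contraction \<epsilon> x $ i - x $ i\<bar> \<le> 2 * \<epsilon>"
    using \<epsilon>(1) unfolding abs_le_iff by linarith+
qed

text \<open>The mollification averages f against a kernel of mass one whose support stays within 3
  \<epsilon> of x in each coordinate: 2 \<epsilon> from the contraction and \<epsilon> from the
  kernel. The factor \<open>CARD('n)\<close> passes from coordinates to the norm.\<close>

lemma mollified_close:
  fixes f :: "real^'n::finite \<Rightarrow> real"
  assumes f: "continuous_on unit_cube f" and \<epsilon>: "0 < \<epsilon>" "\<epsilon> \<le> 1/6" and x: "x \<in> unit_cube"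
    and close: "\<And>y. y \<in> unit_cube \<Longrightarrow> dist y x \<le> 3 * \<epsilon> * real CARD('n) \<Longrightarrow> \<bar>f y - f x\<bar> \<le> e"
  shows "\<bar>mollified \<epsilon> f j 0 x - f x\<bar> \<le> e"
proof -
  let ?z = "contraction \<epsilon> x" and ?d = "CARD('n)"
  let ?p = "\<lambda>y. Psi_det \<psi> ((1/\<epsilon>) *\<^sub>R (?z - y))"
  have cp: "continuous_on S ?p" for S
    by (intro continuous_on_compose2[OF continuous_Psi_det[of UNIV]] continuous_intros) auto
  have mass: "(?p has_integral \<epsilon> ^ ?d) unit_cube"
    by (rule kernel_mass) (use contraction_bounds[OF \<epsilon> x] \<epsilon> in \<open>auto intro: less_imp_le\<close>)
  have "((\<lambda>y. f y * ?p y) has_integral integral unit_cube (\<lambda>y. f y * ?p y)) unit_cube"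
    by (intro integrable_integral integrable_continuous continuous_intros f cp)
  then have A: "((\<lambda>y. f y * ?p y - f x * ?p y) has_integral (integral unit_cube (\<lambda>y. f y * ?p y) - f x * \<epsilon> ^ ?d)) unit_cube"
    by (intro has_integral_diff has_integral_mult_right mass)
  have B: "((\<lambda>y. e * ?p y) has_integral e * \<epsilon> ^ ?d) unit_cube"
    by (intro has_integral_mult_right mass)
  have C: "norm (f y * ?p y - f x * ?p y) \<le> e * ?p y" if y: "y \<in> unit_cube" for y
  proof (cases "(1/\<epsilon>) *\<^sub>R (?z - y) \<in> unit_cube")
    case True
    have "\<bar>y $ i - x $ i\<bar> \<le> 3 * \<epsilon>" for i
    proof -
      have "0 \<le> ?z $ i - y $ i" "?z $ i - y $ i \<le> \<epsilon>"
        using True[unfolded mem_box_cart, rule_format, of i] \<epsilon> by (auto simp: field_simps)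
      then show ?thesis using contraction_bounds(3)[OF \<epsilon> x, of i] by linarith
    qed
    then have "norm (y - x) \<le> (\<Sum>i::'n\<in>UNIV. 3 * \<epsilon>)"
      by (intro order_trans[OF norm_le_l1_cart] sum_mono) simp
    then have "\<bar>f y - f x\<bar> \<le> e" by (intro close[OF y]) (simp add: dist_norm mult.commute)
    then have "\<bar>f y - f x\<bar> * ?p y \<le> e * ?p y" by (rule mult_right_mono) (rule Psi_det_nonneg)
    then show ?thesis by (simp add: left_diff_distrib[symmetric] abs_mult Psi_det_nonneg)
  qed (simp add: Psi_det_outside)
  have "norm (integral unit_cube (\<lambda>y. f y * ?p y) - f x * \<epsilon> ^ ?d) \<le> e * \<epsilon> ^ ?d"
    using integral_norm_bound_integral[OF has_integral_integrable[OF A] has_integral_integrable[OF B] C]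
    by (simp only: integral_unique[OF A] integral_unique[OF B])
  then have "\<bar>integral unit_cube (\<lambda>y. f y * ?p y) - f x * \<epsilon> ^ ?d\<bar> / \<epsilon> ^ ?d \<le> e"
    using \<epsilon> by (simp add: pos_divide_le_eq)
  moreover have "mollified \<epsilon> f j 0 x - f x = (integral unit_cube (\<lambda>y. f y * ?p y) - f x * \<epsilon> ^ ?d) / \<epsilon> ^ ?d"
    using \<epsilon> by (simp add: mollified_def kernel_0 diff_divide_distrib)
  ultimately show ?thesis using \<epsilon> by (simp add: abs_divide)
qed

text \<open>Jensen's inequality for the probability density \<rho>, from expanding the nonnegative
  variance of g about its mean m. Integrability holds because \<rho> is bounded on the cube and |g|
  \<le> 1 + g^2.\<close>

lemma kernel_jensen:
  fixes g :: "real^'n::finite \<Rightarrow> real"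
  assumes g: "square_integrable g" and \<epsilon>: "0 < \<epsilon>" and z: "\<And>i. \<epsilon> < z $ i" "\<And>i. z $ i < 1"
  defines "\<rho> \<equiv> \<lambda>y. Psi_det \<psi> ((1/\<epsilon>) *\<^sub>R (z - y)) / \<epsilon> ^ CARD('n)"
  shows "ennreal ((cube_integral (\<lambda>y. g y * \<rho> y))\<^sup>2) \<le> (\<integral>\<^sup>+y. ennreal ((g y)\<^sup>2 * \<rho> y) \<partial>lebesgue_on unit_cube)"
proof -
  let ?\<mu> = "lebesgue_on (unit_cube :: (real^'n) set)"
  have c: "continuous_on S \<rho>" for S
    unfolding \<rho>_def using \<epsilon> by (intro continuous_intros continuous_on_compose2[OF continuous_Psi_det[of UNIV]]) auto
  have \<rho>0: "\<rho> y \<ge> 0" for y unfolding \<rho>_def using \<epsilon> by (simp add: Psi_det_nonneg)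
  have "compact (\<rho> ` unit_cube)" by (intro compact_continuous_image c) simp
  then have "bounded (\<rho> ` unit_cube)" by (rule compact_imp_bounded)
  then obtain C where C: "\<And>y. y \<in> unit_cube \<Longrightarrow> \<bar>\<rho> y\<bar> \<le> C" by (auto simp: bounded_iff)
  have i\<rho>: "integrable ?\<mu> \<rho>" by (intro continuous_imp_integrable c)
  have gm: "g \<in> borel_measurable ?\<mu>" and ig: "integrable ?\<mu> (\<lambda>y. (g y)\<^sup>2)" using g by (auto simp: square_integrable_def)
  note [measurable] = gm borel_measurable_integrable[OF i\<rho>]
  have i1: "integrable ?\<mu> (\<lambda>y. C * (1 + (g y)\<^sup>2))"
    by (intro integrable_mult_right Bochner_Integration.integrable_add ig) (rule continuous_imp_integrable, simp)
  have i2: "integrable ?\<mu> (\<lambda>y. C * (g y)\<^sup>2)" by (intro integrable_mult_right ig)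
  have ig\<rho>: "integrable ?\<mu> (\<lambda>y. g y * \<rho> y)"
  proof (rule Bochner_Integration.integrable_bound[OF i1])
    show "AE y in ?\<mu>. norm (g y * \<rho> y) \<le> norm (C * (1 + (g y)\<^sup>2))"
    proof (rule AE_I2)
      fix y assume "y \<in> space ?\<mu>"
      then have y: "\<bar>\<rho> y\<bar> \<le> C" by (intro C) simp
      have "\<bar>g y\<bar> \<le> 1 + (g y)\<^sup>2" using sum_squares_bound[of 1 "\<bar>g y\<bar>"] by (simp add: power2_abs)
      then have "\<bar>g y\<bar> * \<bar>\<rho> y\<bar> \<le> (1 + (g y)\<^sup>2) * C" using y by (intro mult_mono) auto
      then show "norm (g y * \<rho> y) \<le> norm (C * (1 + (g y)\<^sup>2))" using y by (simp add: abs_mult mult.commute)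
    qed
  qed measurable
  have ig2\<rho>: "integrable ?\<mu> (\<lambda>y. (g y)\<^sup>2 * \<rho> y)"
  proof (rule Bochner_Integration.integrable_bound[OF i2])
    show "AE y in ?\<mu>. norm ((g y)\<^sup>2 * \<rho> y) \<le> norm (C * (g y)\<^sup>2)"
    proof (rule AE_I2)
      fix y assume "y \<in> space ?\<mu>"
      then have y: "\<bar>\<rho> y\<bar> \<le> C" by (intro C) simp
      then have "(g y)\<^sup>2 * \<bar>\<rho> y\<bar> \<le> (g y)\<^sup>2 * C" by (intro mult_left_mono) auto
      then show "norm ((g y)\<^sup>2 * \<rho> y) \<le> norm (C * (g y)\<^sup>2)" using y by (simp add: abs_mult mult.commute)
    qed
  qed measurable
  define m where "m = cube_integral (\<lambda>y. g y * \<rho> y)"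
  have "(\<rho> has_integral \<epsilon> ^ CARD('n) / \<epsilon> ^ CARD('n)) unit_cube"
    unfolding \<rho>_def by (intro has_integral_divide kernel_mass \<epsilon> less_imp_le z)
  then have mass: "integral\<^sup>L ?\<mu> \<rho> = 1"
    using \<epsilon> lebesgue_integral_eq_integral[OF i\<rho>] by (simp add: integral_unique)
  have "0 \<le> integral\<^sup>L ?\<mu> (\<lambda>y. (g y - m)\<^sup>2 * \<rho> y)"
    by (intro Bochner_Integration.integral_nonneg mult_nonneg_nonneg \<rho>0) auto
  also have "(\<lambda>y. (g y - m)\<^sup>2 * \<rho> y) = (\<lambda>y. (g y)\<^sup>2 * \<rho> y - 2 * m * (g y * \<rho> y) + m\<^sup>2 * \<rho> y)"
    by (simp add: fun_eq_iff power2_eq_square algebra_simps)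
  also have "integral\<^sup>L ?\<mu> \<dots> = integral\<^sup>L ?\<mu> (\<lambda>y. (g y)\<^sup>2 * \<rho> y) - 2 * m * integral\<^sup>L ?\<mu> (\<lambda>y. g y * \<rho> y) + m\<^sup>2 * integral\<^sup>L ?\<mu> \<rho>"
    using ig2\<rho> ig\<rho> i\<rho> by simp
  also have "\<dots> = integral\<^sup>L ?\<mu> (\<lambda>y. (g y)\<^sup>2 * \<rho> y) - 2 * m * m + m\<^sup>2 * 1"
    by (simp only: mass m_def cube_integral_def)
  finally have "m\<^sup>2 \<le> integral\<^sup>L ?\<mu> (\<lambda>y. (g y)\<^sup>2 * \<rho> y)" by (simp add: power2_eq_square)
  then have "ennreal (m\<^sup>2) \<le> ennreal (integral\<^sup>L ?\<mu> (\<lambda>y. (g y)\<^sup>2 * \<rho> y))" by (rule ennreal_leI)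
  also have "\<dots> = (\<integral>\<^sup>+y. ennreal ((g y)\<^sup>2 * \<rho> y) \<partial>?\<mu>)"
    by (rule nn_integral_eq_integral[symmetric, OF ig2\<rho>]) (simp add: \<rho>0)
  finally show ?thesis by (simp add: m_def)
qed

lemma nn_integral_Psi_det: "(\<integral>\<^sup>+x. ennreal (Psi_det \<psi> x) \<partial>(lborel :: (real^'n::finite) measure)) = 1"
proof -
  have "(\<integral>\<^sup>+x. ennreal (Psi_det \<psi> x) \<partial>(lborel :: (real^'n) measure)) = (\<integral>\<^sup>+x. ennreal (Psi_det \<psi> x) * indicator unit_cube x \<partial>(lborel :: (real^'n) measure))"
    by (intro nn_integral_cong) (auto simp: indicator_def Psi_det_outside)
  also have "\<dots> = ennreal (integral unit_cube (Psi_det \<psi> :: real^'n \<Rightarrow> real))"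
    by (rule nn_integral_cube_eq_integral[OF continuous_Psi_det Psi_det_nonneg])
  also have "integral unit_cube (Psi_det \<psi> :: real^'n \<Rightarrow> real) = 1"
    using integral_Psi[of "\<lambda>_. 1 :: real"] by simp
  finally show ?thesis by simp
qed

text \<open>On the cube the value is (1 - 3 \<epsilon>)^k times the average of the weak derivative g
  against \<rho>, so Jensen bounds its square by the average of g^2. Integrating over x first,
  \<rho> contributes (1 - 3 \<epsilon>)^(-d), at most 2^d since \<epsilon> \<le> 1/6.\<close>

lemma mollified_L2:
  fixes f :: "real^'n::finite \<Rightarrow> real"
  assumes f: "continuous_on unit_cube f" and \<epsilon>: "0 < \<epsilon>" "\<epsilon> \<le> 1/6"
    and g: "L2_weak_deriv (\<lambda>i. if i = j then k else 0) f g"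
  shows "integral unit_cube (\<lambda>x. (mollified \<epsilon> f j k x)\<^sup>2) \<le> 2 ^ CARD('n) * cube_integral (\<lambda>y. (g y)\<^sup>2)"
proof -
  let ?d = "CARD('n)" and ?r = "1 - 3 * \<epsilon>"
  have r: "1/2 \<le> ?r" "?r \<le> 1" using \<epsilon> by auto
  have sq: "square_integrable g" using g by (simp add: L2_weak_deriv_def)
  define \<rho> where "\<rho> = (\<lambda>x y :: real^'n. Psi_det \<psi> ((1/\<epsilon>) *\<^sub>R (contraction \<epsilon> x - y)) / \<epsilon> ^ ?d :: real)"
  have \<rho>0: "\<rho> x y \<ge> 0" for x y unfolding \<rho>_def using \<epsilon> by (simp add: Psi_det_nonneg)
  have "continuous_on UNIV (\<lambda>(x::real^'n,y). \<rho> x y)"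
    unfolding \<rho>_def contraction_def split_beta using \<epsilon>
    by (intro continuous_intros continuous_on_compose2[OF continuous_Psi_det[of UNIV]]) auto
  then have "(\<lambda>(x,y). \<rho> x y) \<in> borel_measurable borel" by (rule borel_measurable_continuous_onI)
  then have [measurable]: "(\<lambda>(x,y). \<rho> x y) \<in> borel_measurable (lborel \<Otimes>\<^sub>M lborel)" by (simp add: lborel_prod)
  have val: "mollified \<epsilon> f j k x = ?r ^ k * cube_integral (\<lambda>y. g y * \<rho> x y)" if x: "x \<in> unit_cube" for x
  proof -
    have "mollified \<epsilon> f j k x = (?r / \<epsilon>) ^ k / \<epsilon> ^ ?d * (\<epsilon> ^ k * cube_integral (\<lambda>y. g y * Psi_det \<psi> ((1/\<epsilon>) *\<^sub>R (contraction \<epsilon> x - y))))"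
      unfolding mollified_def by (subst weak_deriv_kernel[OF g f \<epsilon>(1) contraction_bounds(1,2)[OF \<epsilon> x]]) simp
    also have "\<dots> = ?r ^ k * (cube_integral (\<lambda>y. g y * Psi_det \<psi> ((1/\<epsilon>) *\<^sub>R (contraction \<epsilon> x - y))) / \<epsilon> ^ ?d)"
      using \<epsilon> by (simp add: power_divide)
    also have "cube_integral (\<lambda>y. g y * Psi_det \<psi> ((1/\<epsilon>) *\<^sub>R (contraction \<epsilon> x - y))) / \<epsilon> ^ ?d = cube_integral (\<lambda>y. g y * \<rho> x y)"
      unfolding cube_integral_def \<rho>_def by simp
    finally show ?thesis .
  qed
  have "(\<lambda>y. ennreal ((g y)\<^sup>2)) \<in> borel_measurable (lebesgue_on unit_cube)"
    using sq by (auto simp: square_integrable_def)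
  then have "(\<lambda>y. ennreal ((g y)\<^sup>2) * indicator unit_cube y) \<in> borel_measurable lebesgue"
    by (subst (asm) borel_measurable_restrict_space_iff_ennreal) auto
  \<comment> \<open>g is only Lebesgue measurable, while the integrals are exchanged over
    \<open>lborel\<close>; u is a Borel version of g^2 cut off to the cube.\<close>
  from completion_ex_borel_measurable[OF this] obtain u where
    u [measurable]: "u \<in> borel_measurable lborel" and ae: "AE y in lborel. ennreal ((g y)\<^sup>2) * indicator unit_cube y = u y" by blast
  have to_u: "(\<integral>\<^sup>+y. ennreal ((g y)\<^sup>2 * h y) \<partial>lebesgue_on unit_cube) = (\<integral>\<^sup>+y. u y * ennreal (h y) \<partial>lborel)"
    if "\<And>y. h y \<ge> 0" for h
  proof -
    have "(\<integral>\<^sup>+y. ennreal ((g y)\<^sup>2 * h y) \<partial>lebesgue_on unit_cube) = (\<integral>\<^sup>+y. ennreal ((g y)\<^sup>2 * h y) * indicator unit_cube y \<partial>lborel)"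
      by (simp add: nn_integral_restrict_space nn_integral_completion)
    also have "\<dots> = (\<integral>\<^sup>+y. u y * ennreal (h y) \<partial>lborel)"
      by (rule nn_integral_cong_AE) (use ae in eventually_elim, auto simp: ennreal_mult that indicator_def split: if_splits)
    finally show ?thesis .
  qed
  have "ennreal (integral unit_cube (\<lambda>x. (mollified \<epsilon> f j k x)\<^sup>2)) = (\<integral>\<^sup>+x. ennreal ((mollified \<epsilon> f j k x)\<^sup>2) * indicator unit_cube x \<partial>lborel)"
    using smooth_familyD(1)[OF smooth_family_mollified[OF f]]
    by (intro nn_integral_cube_eq_integral[symmetric] continuous_intros) auto
  also have "\<dots> \<le> (\<integral>\<^sup>+x. (\<integral>\<^sup>+y. u y * ennreal (\<rho> x y) \<partial>lborel) \<partial>lborel)"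
  proof (rule nn_integral_mono)
    fix x :: "real^'n"
    show "ennreal ((mollified \<epsilon> f j k x)\<^sup>2) * indicator unit_cube x \<le> (\<integral>\<^sup>+y. u y * ennreal (\<rho> x y) \<partial>lborel)"
    proof (cases "x \<in> unit_cube")
      case True
      have "(?r ^ k)\<^sup>2 \<le> 1" using r by (simp add: power_le_one)
      then have "(mollified \<epsilon> f j k x)\<^sup>2 \<le> (cube_integral (\<lambda>y. g y * \<rho> x y))\<^sup>2"
        unfolding val[OF True] power_mult_distrib by (rule mult_left_le_one_le[rotated 2]) auto
      then have "ennreal ((mollified \<epsilon> f j k x)\<^sup>2) \<le> ennreal ((cube_integral (\<lambda>y. g y * \<rho> x y))\<^sup>2)" by (rule ennreal_leI)
      also have "\<dots> \<le> (\<integral>\<^sup>+y. ennreal ((g y)\<^sup>2 * \<rho> x y) \<partial>lebesgue_on unit_cube)"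
        unfolding \<rho>_def by (rule kernel_jensen[OF sq \<epsilon>(1) contraction_bounds(1,2)[OF \<epsilon> True]])
      also have "\<dots> = (\<integral>\<^sup>+y. u y * ennreal (\<rho> x y) \<partial>lborel)" by (rule to_u) (rule \<rho>0)
      finally show ?thesis using True by simp
    qed simp
  qed
  also have "\<dots> = (\<integral>\<^sup>+y. (\<integral>\<^sup>+x. u y * ennreal (\<rho> x y) \<partial>lborel) \<partial>lborel)"
    by (rule lborel_pair.Fubini'[symmetric]) measurable
  also have "\<dots> = (\<integral>\<^sup>+y. u y * ennreal ((1 / ?r) ^ ?d) \<partial>lborel)"
  proof (rule nn_integral_cong)
    fix y :: "real^'n"
    have arg: "(1/\<epsilon>) *\<^sub>R (contraction \<epsilon> x - y) = (1/\<epsilon>) *\<^sub>R (vec (2 * \<epsilon>) - y) + (?r / \<epsilon>) *\<^sub>R x" for x :: "real^'n"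
      by (simp add: contraction_def vec_eq_iff field_simps)
    have "ennreal (\<bar>?r / \<epsilon>\<bar> ^ ?d) * (\<integral>\<^sup>+x. ennreal (Psi_det \<psi> ((1/\<epsilon>) *\<^sub>R (vec (2 * \<epsilon>) - y) + (?r / \<epsilon>) *\<^sub>R x)) \<partial>lborel) =
        (\<integral>\<^sup>+x. ennreal (Psi_det \<psi> x) \<partial>(lborel :: (real^'n) measure))"
      by (rule nn_integral_affine) (use \<epsilon> in auto)
    then have *: "ennreal ((?r / \<epsilon>) ^ ?d) * (\<integral>\<^sup>+x. ennreal (Psi_det \<psi> ((1/\<epsilon>) *\<^sub>R (contraction \<epsilon> x - y))) \<partial>lborel) = 1"
      using \<epsilon> r by (simp only: arg nn_integral_Psi_det) (simp add: abs_of_nonneg)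
    have [measurable]: "(\<lambda>x. \<rho> x y) \<in> borel_measurable borel" "(\<lambda>x. Psi_det \<psi> ((1/\<epsilon>) *\<^sub>R (contraction \<epsilon> x - y))) \<in> borel_measurable borel"
      unfolding \<rho>_def contraction_def using \<epsilon>
      by (intro borel_measurable_continuous_onI continuous_intros continuous_on_compose2[OF continuous_Psi_det[of UNIV]]; simp)+
    have "(\<integral>\<^sup>+x. ennreal (\<rho> x y) \<partial>lborel) = (\<integral>\<^sup>+x. ennreal ((1 / ?r) ^ ?d * (?r / \<epsilon>) ^ ?d) * ennreal (Psi_det \<psi> ((1/\<epsilon>) *\<^sub>R (contraction \<epsilon> x - y))) \<partial>lborel)"
      using r \<epsilon> by (intro nn_integral_cong) (simp add: \<rho>_def power_divide Psi_det_nonneg flip: ennreal_mult)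
    also have "\<dots> = ennreal ((1 / ?r) ^ ?d * (?r / \<epsilon>) ^ ?d) * (\<integral>\<^sup>+x. ennreal (Psi_det \<psi> ((1/\<epsilon>) *\<^sub>R (contraction \<epsilon> x - y))) \<partial>lborel)"
      by (rule nn_integral_cmult) measurable
    also have "\<dots> = ennreal ((1 / ?r) ^ ?d) * (ennreal ((?r / \<epsilon>) ^ ?d) * (\<integral>\<^sup>+x. ennreal (Psi_det \<psi> ((1/\<epsilon>) *\<^sub>R (contraction \<epsilon> x - y))) \<partial>lborel))"
      using r \<epsilon> by (simp add: ennreal_mult mult.assoc)
    also have "\<dots> = ennreal ((1 / ?r) ^ ?d)" by (simp only: * mult_1_right)
    finally show "(\<integral>\<^sup>+x. u y * ennreal (\<rho> x y) \<partial>lborel) = u y * ennreal ((1 / ?r) ^ ?d)"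
      by (subst nn_integral_cmult) auto
  qed
  also have "\<dots> \<le> (\<integral>\<^sup>+y. u y * ennreal (2 ^ ?d) \<partial>lborel)"
  proof (intro nn_integral_mono mult_left_mono ennreal_leI power_mono)
    show "1 / ?r \<le> 2" using r by (simp add: field_simps)
  qed (use r in auto)
  also have "\<dots> = (\<integral>\<^sup>+y. ennreal ((g y)\<^sup>2 * 2 ^ ?d) \<partial>lebesgue_on unit_cube)"
    by (rule to_u[symmetric]) simp
  also have "\<dots> = ennreal (cube_integral (\<lambda>y. (g y)\<^sup>2 * 2 ^ ?d))"
    unfolding cube_integral_def using sq
    by (intro nn_integral_eq_integral) (auto simp: square_integrable_def)
  also have "cube_integral (\<lambda>y. (g y)\<^sup>2 * 2 ^ ?d) = 2 ^ ?d * cube_integral (\<lambda>y. (g y)\<^sup>2)"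
    unfolding cube_integral_def by (simp add: mult.commute)
  finally show ?thesis
    by (rule ennreal_le_iff[THEN iffD1, rotated]) (simp add: cube_integral_def)
qed

text \<open>Uniform continuity supplies the \<epsilon> for the mollification. The derivative bound
  does not depend on e, because each pure weak derivative of order at most s is one summand of the
  Sobolev norm.\<close>

lemma sobolev_approximation:
  fixes f :: "real^'n::finite \<Rightarrow> real"
  assumes f: "f \<in> sobolev s" and e: "e > 0"
  obtains F where "smooth_family F" "\<And>x j. x \<in> unit_cube \<Longrightarrow> \<bar>F j 0 x - f x\<bar> \<le> e"
    "\<And>j k. k \<le> s \<Longrightarrow> integral unit_cube (\<lambda>x. (F j k x)\<^sup>2) \<le> 2 ^ CARD('n) * (sobolev_norm s f)\<^sup>2"
proof -
  have fc: "continuous_on unit_cube f" using f by (simp add: sobolev_def)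
  have "uniformly_continuous_on unit_cube f" by (intro compact_uniformly_continuous fc) simp
  then obtain \<delta> where \<delta>: "\<delta> > 0" "\<And>x y. x \<in> unit_cube \<Longrightarrow> y \<in> unit_cube \<Longrightarrow> dist y x < \<delta> \<Longrightarrow> dist (f y) (f x) < e"
    using e unfolding uniformly_continuous_on_def by metis
  \<comment> \<open>The 6 instead of 3 makes \<open>3 * \<epsilon> * real CARD('n)\<close> strictly
    smaller than \<delta>.\<close>
  define \<epsilon> where "\<epsilon> = min (1/6) (\<delta> / (6 * real CARD('n)))"
  have \<epsilon>: "0 < \<epsilon>" "\<epsilon> \<le> 1/6" using \<delta>(1) by (auto simp: \<epsilon>_def)
  have "3 * \<epsilon> * real CARD('n) \<le> 3 * (\<delta> / (6 * real CARD('n))) * real CARD('n)"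
    by (intro mult_right_mono mult_left_mono) (auto simp: \<epsilon>_def)
  also have "\<dots> < \<delta>" using \<delta>(1) by simp
  finally have \<epsilon>\<delta>: "3 * \<epsilon> * real CARD('n) < \<delta>" .
  show ?thesis
  proof (rule that[of "mollified \<epsilon> f"])
    show "smooth_family (mollified \<epsilon> f)" by (rule smooth_family_mollified[OF fc])
    show "\<bar>mollified \<epsilon> f j 0 x - f x\<bar> \<le> e" if x: "x \<in> unit_cube" for x j
    proof (rule mollified_close[OF fc \<epsilon> x])
      fix y :: "real^'n" assume "y \<in> unit_cube" "dist y x \<le> 3 * \<epsilon> * real CARD('n)"
      then have "dist (f y) (f x) < e" using \<epsilon>\<delta> by (intro \<delta>(2) x) auto
      then show "\<bar>f y - f x\<bar> \<le> e" by (simp add: dist_real_def)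
    qed
    fix j :: 'n and k assume k: "k \<le> s"
    let ?\<alpha> = "\<lambda>i. if i = j then k else 0 :: nat"
    \<comment> \<open>The same choice as in \<open>sobolev_norm\<close>, so its norm is literally
      one of the summands there.\<close>
    let ?g = "SOME g. L2_weak_deriv ?\<alpha> f g"
    have order: "multi_order ?\<alpha> \<le> s" using k by (simp add: multi_order_def)
    then have "\<exists>g. L2_weak_deriv ?\<alpha> f g" using f by (auto simp: sobolev_def)
    then have g: "L2_weak_deriv ?\<alpha> f ?g" by (rule someI_ex)
    have "cube_integral (\<lambda>y. (?g y)\<^sup>2) \<ge> 0" by (simp add: cube_integral_def)
    then have "cube_integral (\<lambda>y. (?g y)\<^sup>2) = (L2_norm_cube ?g)\<^sup>2" by (simp add: L2_norm_cube_def)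
    also have "\<dots> \<le> (\<Sum>\<alpha> | multi_order \<alpha> \<le> s. (L2_norm_cube (SOME g. L2_weak_deriv \<alpha> f g))\<^sup>2)"
      using order by (intro member_le_sum[where f="\<lambda>\<alpha>. (L2_norm_cube (SOME g. L2_weak_deriv \<alpha> f g))\<^sup>2"] finite_multi_order_le) auto
    also have "\<dots> = (sobolev_norm s f)\<^sup>2" by (simp add: sobolev_norm_def sum_nonneg)
    finally have "cube_integral (\<lambda>y. (?g y)\<^sup>2) \<le> (sobolev_norm s f)\<^sup>2" .
    then have "2 ^ CARD('n) * cube_integral (\<lambda>y. (?g y)\<^sup>2) \<le> 2 ^ CARD('n) * (sobolev_norm s f)\<^sup>2"
      by (rule mult_left_mono) simp
    with mollified_L2[OF fc \<epsilon> g] show "integral unit_cube (\<lambda>x. (mollified \<epsilon> f j k x)\<^sup>2) \<le> 2 ^ CARD('n) * (sobolev_norm s f)\<^sup>2"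
      by linarith
  qed
qed

section \<open>Error bounds\<close>

definition pullback :: "(real^'n::finite \<Rightarrow> real) \<Rightarrow> real^'n \<Rightarrow> real" where
  "pullback f x = f (Psi \<psi> x) * Psi_det \<psi> x"

lemma pullback_smooth_family:
  assumes "smooth_family F"
  shows "pullback (F i 0) = transformed F j 0"
proof
  fix x
  have "F i 0 = F j 0" by (rule smooth_familyD(3)[OF assms])
  then show "pullback (F i 0) x = transformed F j 0 x" by (simp add: pullback_def transformed_0)
qed

lemma cube_function_pullback:
  assumes "continuous_on unit_cube f"
  shows "cube_function (pullback f)"
  unfolding cube_function_def pullback_def[abs_def]
proof (intro conjI allI impI)
  show "continuous_on UNIV (\<lambda>x. f (Psi \<psi> x) * Psi_det \<psi> x)"
    by (intro continuous_intros continuous_Psi_det continuous_on_compose2[OF assms continuous_Psi]) (use Psi_in_cube in blast)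
qed (simp add: Psi_det_outside)

lemma quadrature_eq_lattice_rule: "quadrature \<psi> S v f = lattice_rule S (pullback f) v"
  by (simp add: quadrature_def lattice_rule_def periodize_def pullback_def)

lemma ft_transformed:
  assumes F: "smooth_family F"
  shows "ft (transformed F j l) \<xi> = (2 * pi * \<i> * \<xi> $ j) ^ l * ft (transformed F j 0) \<xi>"
proof (induction l)
  case (Suc l)
  have "ft (transformed F j (Suc l)) \<xi> = 2 * pi * \<i> * \<xi> $ j * ft (transformed F j l) \<xi>"
    using cube_functionD[OF cube_function_transformed[OF F]]
    by (intro ft_pderiv has_pderiv_transformed[OF F]) auto
  then show ?case by (simp add: Suc mult_ac)
qed simp

text \<open>Each derivative multiplies the transform by 2 pi i \<xi>_j; the factors 2 pi \<ge> 1 are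
  dropped.\<close>

lemma fourier_decay:
  assumes F: "smooth_family F"
  shows "\<bar>\<xi> $ j\<bar> ^ (2 * s) * (cmod (ft (transformed F j 0) \<xi>))\<^sup>2 \<le> (cmod (ft (transformed F j s) \<xi>))\<^sup>2"
proof -
  have "1 \<le> 2 * pi" using pi_gt3 by linarith
  then have "1 * \<bar>\<xi> $ j\<bar> \<le> 2 * pi * \<bar>\<xi> $ j\<bar>" by (intro mult_right_mono) auto
  then have "\<bar>\<xi> $ j\<bar> ^ (2 * s) \<le> (2 * pi * \<bar>\<xi> $ j\<bar>) ^ (2 * s)" by (intro power_mono) auto
  then have "\<bar>\<xi> $ j\<bar> ^ (2 * s) * (cmod (ft (transformed F j 0) \<xi>))\<^sup>2 \<le> (2 * pi * \<bar>\<xi> $ j\<bar>) ^ (2 * s) * (cmod (ft (transformed F j 0) \<xi>))\<^sup>2"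
    by (rule mult_right_mono) simp
  also have "(2 * pi * \<bar>\<xi> $ j\<bar>) ^ (2 * s) = ((2 * pi * \<bar>\<xi> $ j\<bar>) ^ s)\<^sup>2" by (simp add: power_mult[symmetric] mult.commute)
  also have "\<dots> * (cmod (ft (transformed F j 0) \<xi>))\<^sup>2 = (cmod (ft (transformed F j s) \<xi>))\<^sup>2"
    unfolding ft_transformed[OF F, of j s] by (simp add: norm_mult norm_power power_mult_distrib)
  finally show ?thesis .
qed

text \<open>A uniform error passes to the transform without loss, because |D\<Psi>| has mass
  one.\<close>

lemma ft_pullback_close:
  fixes f h :: "real^'n::finite \<Rightarrow> real"
  assumes f: "continuous_on unit_cube f" and h: "continuous_on unit_cube h"
    and close: "\<And>x. x \<in> unit_cube \<Longrightarrow> \<bar>h x - f x\<bar> \<le> e"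
  shows "cmod (ft (pullback h) \<xi> - ft (pullback f) \<xi>) \<le> e"
proof -
  note c = cube_functionD(1)[OF cube_function_pullback[OF f]] cube_functionD(1)[OF cube_function_pullback[OF h]]
  have A: "((\<lambda>x. of_real (pullback h x) * cis (- (2 * pi * (\<xi> \<bullet> x))) - of_real (pullback f x) * cis (- (2 * pi * (\<xi> \<bullet> x)))) has_integral
     (ft (pullback h) \<xi> - ft (pullback f) \<xi>)) unit_cube"
    by (intro has_integral_diff ft_real_vec_integral c)
  have B: "((\<lambda>x::real^'n. e * Psi_det \<psi> x) has_integral e * 1) unit_cube"
  proof (intro has_integral_mult_right)
    show "((Psi_det \<psi> :: real^'n \<Rightarrow> real) has_integral 1) unit_cube"
    proof -
      have eq: "integral unit_cube (Psi_det \<psi> :: real^'n \<Rightarrow> real) = 1"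
        using integral_Psi[of "\<lambda>_. 1 :: real"] by simp
      have "((Psi_det \<psi> :: real^'n \<Rightarrow> real) has_integral integral unit_cube (Psi_det \<psi> :: real^'n \<Rightarrow> real)) unit_cube"
        by (intro integrable_integral integrable_continuous continuous_Psi_det)
      then show ?thesis unfolding eq .
    qed
  qed
  have C: "norm (of_real (pullback h x) * cis (- (2 * pi * (\<xi> \<bullet> x))) - of_real (pullback f x) * cis (- (2 * pi * (\<xi> \<bullet> x)))) \<le> e * Psi_det \<psi> x" for x
  proof -
    have "norm (of_real (pullback h x) * cis (- (2 * pi * (\<xi> \<bullet> x))) - of_real (pullback f x) * cis (- (2 * pi * (\<xi> \<bullet> x)))) = \<bar>pullback h x - pullback f x\<bar>"
      by (simp add: norm_mult flip: left_diff_distrib of_real_diff)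
    also have "\<dots> = \<bar>h (Psi \<psi> x) - f (Psi \<psi> x)\<bar> * Psi_det \<psi> x"
      by (simp add: pullback_def abs_mult Psi_det_nonneg flip: left_diff_distrib)
    also have "\<dots> \<le> e * Psi_det \<psi> x"
      by (intro mult_right_mono close Psi_in_cube Psi_det_nonneg)
    finally show ?thesis .
  qed
  have "norm (integral unit_cube (\<lambda>x. of_real (pullback h x) * cis (- (2 * pi * (\<xi> \<bullet> x))) - of_real (pullback f x) * cis (- (2 * pi * (\<xi> \<bullet> x))))) \<le>
     integral unit_cube (\<lambda>x::real^'n. e * Psi_det \<psi> x)"
    by (rule integral_norm_bound_integral[OF has_integral_integrable[OF A] has_integral_integrable[OF B] C])
  then show ?thesis by (simp only: integral_unique[OF A] integral_unique[OF B] mult_1_right)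
qed

text \<open>Packages what both error bounds use of the regularity of f: smooth approximants with
  uniformly bounded transformed derivatives, and pointwise convergence of the transforms.\<close>

lemma sobolev_fourier_approximation:
  obtains C where "C \<ge> 0" "\<And>f :: real^'n::finite \<Rightarrow> real. f \<in> sobolev s \<Longrightarrow> \<exists>F. (\<forall>k. smooth_family (F k) \<and>
      (\<Sum>j\<in>UNIV. integral unit_cube (\<lambda>x. (transformed (F k) j s x)\<^sup>2)) \<le> C * (sobolev_norm s f)\<^sup>2) \<and>
      (\<forall>\<xi> j. (\<lambda>k. ft (transformed (F k) j 0) \<xi>) \<longlonglongrightarrow> ft (pullback f) \<xi>)"
proof -
  let ?Q = "\<lambda>j K. K \<ge> 0 \<and> (\<forall>F. smooth_family F \<longrightarrow>
    integral unit_cube (\<lambda>x. (transformed F j s x)\<^sup>2) \<le> K * (\<Sum>k\<le>s. integral unit_cube (\<lambda>x::real^'n. (F j k x)\<^sup>2)))"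
  have "\<forall>j. \<exists>K. ?Q j K"
  proof
    fix j
    show "\<exists>K. ?Q j K" by (rule transformed_L2_bound[where j=j and s=s]) blast
  qed
  from choice[OF this] obtain K where K: "\<forall>j. ?Q j (K j)" ..
  define C where "C = (\<Sum>j\<in>UNIV. K j * (real (Suc s) * 2 ^ CARD('n)))"
  have "C \<ge> 0" using K unfolding C_def by (intro sum_nonneg mult_nonneg_nonneg) auto
  moreover have "\<exists>F. (\<forall>k. smooth_family (F k) \<and>
      (\<Sum>j\<in>UNIV. integral unit_cube (\<lambda>x. (transformed (F k) j s x)\<^sup>2)) \<le> C * (sobolev_norm s f)\<^sup>2) \<and>
      (\<forall>\<xi> j. (\<lambda>k. ft (transformed (F k) j 0) \<xi>) \<longlonglongrightarrow> ft (pullback f) \<xi>)" if f: "f \<in> sobolev s" for f :: "real^'n \<Rightarrow> real"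
  proof -
    let ?R = "sobolev_norm s f"
    have fc: "continuous_on unit_cube f" using f by (simp add: sobolev_def)
    let ?P = "\<lambda>k F. smooth_family F \<and> (\<forall>x\<in>unit_cube. \<forall>j. \<bar>F j 0 x - f x\<bar> \<le> inverse (real (Suc k))) \<and>
       (\<forall>j. \<forall>k\<le>s. integral unit_cube (\<lambda>x. (F j k x)\<^sup>2) \<le> 2 ^ CARD('n) * ?R\<^sup>2)"
    have "\<forall>k. \<exists>F. ?P k F"
    proof
      fix k :: nat
      have "inverse (real (Suc k)) > 0" by simp
      then show "\<exists>F. ?P k F" by (rule sobolev_approximation[OF f]) blast
    qed
    from choice[OF this] obtain F where F: "\<forall>k. ?P k (F k)" ..
    have sm: "smooth_family (F k)" for k using F by blast
    have "(\<Sum>j\<in>UNIV. integral unit_cube (\<lambda>x. (transformed (F k) j s x)\<^sup>2)) \<le> C * ?R\<^sup>2" for k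
    proof -
      have "(\<Sum>j\<in>UNIV. integral unit_cube (\<lambda>x. (transformed (F k) j s x)\<^sup>2)) \<le>
         (\<Sum>j\<in>UNIV. K j * (\<Sum>i\<le>s. integral unit_cube (\<lambda>x. (F k j i x)\<^sup>2)))"
        using K sm by (intro sum_mono) blast
      also have "\<dots> \<le> (\<Sum>j\<in>UNIV. K j * (\<Sum>i\<le>s. 2 ^ CARD('n) * ?R\<^sup>2))"
        using K F by (intro sum_mono mult_left_mono) auto
      also have "\<dots> = C * ?R\<^sup>2" unfolding C_def sum_distrib_right by (intro sum.cong refl) simp
      finally show ?thesis .
    qed
    moreover have "(\<lambda>k. ft (transformed (F k) j 0) \<xi>) \<longlonglongrightarrow> ft (pullback f) \<xi>" for \<xi> j
    proof (rule LIM_zero_cancel, rule Lim_null_comparison[OF _ LIMSEQ_inverse_real_of_nat])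
      show "\<forall>\<^sub>F k in sequentially. norm (ft (transformed (F k) j 0) \<xi> - ft (pullback f) \<xi>) \<le> inverse (real (Suc k))"
      proof (rule always_eventually, rule allI)
        fix k
        have "cmod (ft (pullback (F k j 0)) \<xi> - ft (pullback f) \<xi>) \<le> inverse (real (Suc k))"
          using F by (intro ft_pullback_close fc smooth_familyD(1)[OF sm]) blast
        then show "norm (ft (transformed (F k) j 0) \<xi> - ft (pullback f) \<xi>) \<le> inverse (real (Suc k))"
          unfolding pullback_smooth_family[OF sm, of k j j] .
      qed
    qed
    ultimately show ?thesis using sm by blast
  qed
  ultimately show ?thesis using that by blast
qed

text \<open>If all |\<xi>_j| were below c = n^(1/d), their product would be below n. So some j has
  |\<xi>_j| \<ge> c, and the s-th derivative in that coordinate gains c^(2s); summing over j covers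
  every case. The factor 2 is that of \<open>plancherel_bound\<close>.\<close>

lemma tail_bound_smooth:
  fixes F :: "'n::finite \<Rightarrow> nat \<Rightarrow> real^'n \<Rightarrow> real"
  assumes F: "smooth_family F" and n: "n \<ge> 1"
  shows "(\<integral>\<^sup>+\<xi>. indicator {\<xi>. real n \<le> (\<Prod>j\<in>UNIV. \<bar>\<xi> $ j\<bar>)} \<xi> * ennreal ((cmod (ft (transformed F i 0) \<xi>))\<^sup>2) \<partial>lborel)
    \<le> ennreal (2 * real n powr (- 2 * real s / real CARD('n)) * (\<Sum>j\<in>UNIV. integral unit_cube (\<lambda>x. (transformed F j s x)\<^sup>2)))"
proof -
  define c where "c = real n powr (1 / real CARD('n))"
  have c: "c > 0" "c ^ CARD('n) = real n" using n by (simp_all add: c_def powr_inverse_card_power)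
  \<comment> \<open>Order zero does not depend on the coordinate, so the index may follow whichever
    coordinate of \<xi> is large.\<close>
  have g: "transformed F i 0 = transformed F j 0" for j
    using pullback_smooth_family[OF F, of i i] pullback_smooth_family[OF F, of i j] by simp
  have cont: "continuous_on unit_cube (transformed F j l)" for j l
    using cube_functionD(1)[OF cube_function_transformed[OF F]] .
  have cs: "1 / c ^ (2 * s) = real n powr (- 2 * real s / real CARD('n))"
  proof -
    have "c ^ (2 * s) = c powr real (2 * s)" using powr_realpow[OF c(1), of "2 * s"] by (rule sym)
    then show ?thesis by (simp add: c_def powr_powr powr_minus divide_inverse mult_ac)
  qed
  have pw: "indicator {\<xi>. real n \<le> (\<Prod>j\<in>UNIV. \<bar>\<xi> $ j\<bar>)} \<xi> * ennreal ((cmod (ft (transformed F i 0) \<xi>))\<^sup>2)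
     \<le> ennreal (1 / c ^ (2 * s)) * (\<Sum>j\<in>UNIV. ennreal ((cmod (ft (transformed F j s) \<xi>))\<^sup>2))" for \<xi>
  proof (cases "real n \<le> (\<Prod>j\<in>UNIV. \<bar>\<xi> $ j\<bar>)")
    case True
    have "\<exists>j. c \<le> \<bar>\<xi> $ j\<bar>"
    proof (rule ccontr)
      assume "\<not> ?thesis"
      then have "(\<Prod>j\<in>UNIV. \<bar>\<xi> $ j\<bar>) < (\<Prod>j::'n\<in>UNIV. c)"
        by (intro prod_mono_strict) (auto simp: not_le less_imp_le)
      with True c(2) show False by simp
    qed
    then obtain j where j: "c \<le> \<bar>\<xi> $ j\<bar>" ..
    then have "c ^ (2 * s) \<le> \<bar>\<xi> $ j\<bar> ^ (2 * s)" using c(1) by (intro power_mono) auto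
    then have "c ^ (2 * s) * (cmod (ft (transformed F i 0) \<xi>))\<^sup>2 \<le> \<bar>\<xi> $ j\<bar> ^ (2 * s) * (cmod (ft (transformed F j 0) \<xi>))\<^sup>2"
      unfolding g[of j] by (rule mult_right_mono) simp
    also have "\<dots> \<le> (cmod (ft (transformed F j s) \<xi>))\<^sup>2" by (rule fourier_decay[OF F])
    also have "\<dots> \<le> (\<Sum>j\<in>UNIV. (cmod (ft (transformed F j s) \<xi>))\<^sup>2)"
      by (rule member_le_sum) auto
    finally have "(cmod (ft (transformed F i 0) \<xi>))\<^sup>2 \<le> 1 / c ^ (2 * s) * (\<Sum>j\<in>UNIV. (cmod (ft (transformed F j s) \<xi>))\<^sup>2)"
      using c(1) by (simp add: field_simps)
    then have le: "ennreal ((cmod (ft (transformed F i 0) \<xi>))\<^sup>2) \<le> ennreal (1 / c ^ (2 * s) * (\<Sum>j\<in>UNIV. (cmod (ft (transformed F j s) \<xi>))\<^sup>2))"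
      by (rule ennreal_leI)
    have eq: "ennreal (1 / c ^ (2 * s) * (\<Sum>j\<in>UNIV. (cmod (ft (transformed F j s) \<xi>))\<^sup>2)) =
        ennreal (1 / c ^ (2 * s)) * (\<Sum>j\<in>UNIV. ennreal ((cmod (ft (transformed F j s) \<xi>))\<^sup>2))"
      using c(1) by (subst ennreal_mult) (auto simp: sum_nonneg)
    have ind: "indicator {\<xi>. real n \<le> (\<Prod>j\<in>UNIV. \<bar>\<xi> $ j\<bar>)} \<xi> = (1 :: ennreal)" using True by simp
    show ?thesis unfolding ind mult_1 using le unfolding eq .
  qed simp
  have [measurable]: "ft (transformed F j s) \<in> borel_measurable borel" for j by (rule ft_measurable[OF cont])
  have "(\<integral>\<^sup>+\<xi>. indicator {\<xi>. real n \<le> (\<Prod>j\<in>UNIV. \<bar>\<xi> $ j\<bar>)} \<xi> * ennreal ((cmod (ft (transformed F i 0) \<xi>))\<^sup>2) \<partial>lborel)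
    \<le> (\<integral>\<^sup>+\<xi>. ennreal (1 / c ^ (2 * s)) * (\<Sum>j\<in>UNIV. ennreal ((cmod (ft (transformed F j s) \<xi>))\<^sup>2)) \<partial>lborel)"
    by (rule nn_integral_mono[OF pw])
  also have "\<dots> = ennreal (1 / c ^ (2 * s)) * (\<Sum>j\<in>UNIV. \<integral>\<^sup>+\<xi>. ennreal ((cmod (ft (transformed F j s) \<xi>))\<^sup>2) \<partial>lborel)"
  proof -
    have "(\<integral>\<^sup>+\<xi>. ennreal (1 / c ^ (2 * s)) * (\<Sum>j\<in>UNIV. ennreal ((cmod (ft (transformed F j s) \<xi>))\<^sup>2)) \<partial>lborel) =
      ennreal (1 / c ^ (2 * s)) * (\<integral>\<^sup>+\<xi>. (\<Sum>j\<in>UNIV. ennreal ((cmod (ft (transformed F j s) \<xi>))\<^sup>2)) \<partial>lborel)"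
      by (rule nn_integral_cmult) measurable
    also have "(\<integral>\<^sup>+\<xi>. (\<Sum>j\<in>UNIV. ennreal ((cmod (ft (transformed F j s) \<xi>))\<^sup>2)) \<partial>lborel) = (\<Sum>j\<in>UNIV. \<integral>\<^sup>+\<xi>. ennreal ((cmod (ft (transformed F j s) \<xi>))\<^sup>2) \<partial>lborel)"
      by (rule nn_integral_sum) measurable
    finally show ?thesis .
  qed
  also have "\<dots> \<le> ennreal (1 / c ^ (2 * s)) * (\<Sum>j\<in>UNIV. ennreal (2 * integral unit_cube (\<lambda>x. (transformed F j s x)\<^sup>2)))"
    by (intro mult_left_mono sum_mono plancherel_bound cont) auto
  also have "\<dots> = ennreal (1 / c ^ (2 * s) * (\<Sum>j\<in>UNIV. 2 * integral unit_cube (\<lambda>x. (transformed F j s x)\<^sup>2)))"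
  proof -
    have nn: "0 \<le> 2 * integral unit_cube (\<lambda>x. (transformed F j s x)\<^sup>2)" for j
      by (intro mult_nonneg_nonneg Henstock_Kurzweil_Integration.integral_nonneg integrable_continuous continuous_intros cont) auto
    have "(\<Sum>j\<in>UNIV. ennreal (2 * integral unit_cube (\<lambda>x. (transformed F j s x)\<^sup>2))) = ennreal (\<Sum>j\<in>UNIV. 2 * integral unit_cube (\<lambda>x. (transformed F j s x)\<^sup>2))"
      by (rule sum_ennreal[OF nn])
    moreover have "0 \<le> 1 / c ^ (2 * s)" using c(1) by simp
    ultimately show ?thesis by (simp only: ennreal_mult sum_nonneg nn)
  qed
  also have "1 / c ^ (2 * s) * (\<Sum>j\<in>UNIV. 2 * integral unit_cube (\<lambda>x. (transformed F j s x)\<^sup>2)) =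
     2 * real n powr (- 2 * real s / real CARD('n)) * (\<Sum>j\<in>UNIV. integral unit_cube (\<lambda>x. (transformed F j s x)\<^sup>2))"
    unfolding cs by (simp only: sum_distrib_left mult_ac)
  finally show ?thesis .
qed

text \<open>Cauchy-Schwarz after inserting |S m|^s. In the first factor |S m| is at most sqrt d
  times its largest coordinate, so pure derivatives and \<open>lattice_rule_bessel\<close> apply; in
  the second, |S m| is at least a constant times n^(1/d) |m|, and s > d/2 makes the lattice sum
  finite.\<close>

lemma lattice_sum_bound_smooth:
  fixes B :: "real^'n::finite^'n"
  assumes s: "real s > real CARD('n) / 2" and B: "invertible B"
  obtains C where "C \<ge> 0" "\<And>F n u i A. smooth_family F \<Longrightarrow> n \<ge> 1 \<Longrightarrow> u \<in> dilation_cube \<Longrightarrow> finite A \<Longrightarrow> 0 \<notin> A \<Longrightarrow>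
    (\<Sum>m\<in>A. cmod (ft (transformed F i 0) (scaled_frolov B n u *v real_vec m))) \<le>
      C * real n powr (- real s / real CARD('n)) * sqrt (\<Sum>j\<in>UNIV. integral unit_cube (\<lambda>x. (transformed F j s x)\<^sup>2))"
proof -
  let ?d = "real CARD('n)"
  obtain Z where Z: "Z \<ge> 0" "\<And>A. finite A \<Longrightarrow> 0 \<notin> A \<Longrightarrow> (\<Sum>m\<in>A. 1 / norm (real_vec m :: real^'n) ^ (2 * s)) \<le> Z"
    using sum_inverse_norm_bounded[OF s] by blast
  obtain c0 where c0: "c0 > 0" "\<And>x. norm (matrix_inv B *v x) \<le> norm x * c0"
    using bounded_linear.pos_bounded[OF matrix_vector_mul_bounded_linear[of "matrix_inv B"]] by blast
  define K where "K = 2 * (\<Sum>i\<in>UNIV. \<Sum>j\<in>UNIV. \<bar>B $ i $ j\<bar>)"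
  have K: "K \<ge> 0" unfolding K_def by (simp add: sum_nonneg)
  have detB: "\<bar>det B\<bar> > 0" using B by (simp add: invertible_det_nz)
  \<comment> \<open>Bounds the number of nodes divided by |det S|: the former is at most n (2K +
    3)^d, the latter at least n |det B|, and n cancels.\<close>
  define C1 where "C1 = (2 * K + 3) ^ CARD('n) / \<bar>det B\<bar>"
  have C1: "C1 \<ge> 0" using K detB by (simp add: C1_def)
  define C where "C = sqrt (?d ^ s * C1 * (c0 ^ (2 * s) * Z))"
  show ?thesis
  proof (rule that[of C])
    show "C \<ge> 0" by (simp add: C_def C1 Z(1) c0(1) less_imp_le)
    fix F :: "'n \<Rightarrow> nat \<Rightarrow> real^'n \<Rightarrow> real" and n :: nat and u :: "real^'n" and i and A :: "(int^'n) set"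
    assume F: "smooth_family F" and n: "n \<ge> 1" and u: "u \<in> dilation_cube" and A: "finite A" "0 \<notin> A"
    let ?S = "scaled_frolov B n u"
    let ?T = "\<Sum>j\<in>UNIV. integral unit_cube (\<lambda>x. (transformed F j s x)\<^sup>2)"
    define c where "c = real n powr (1 / ?d)"
    have c: "c > 0" using n by (simp add: c_def)
    have u1: "u $ j \<ge> 1" for j by (rule dilation_cubeD(1)[OF u])
    have u0: "u $ j \<noteq> 0" for j using u1[of j] by auto
    have inv: "invertible ?S" by (rule invertible_scaled_frolov[OF B n u0])
    have g: "transformed F i 0 = transformed F j 0" for j
      using pullback_smooth_family[OF F, of i i] pullback_smooth_family[OF F, of i j] by simp
    have cont: "continuous_on unit_cube (transformed F j l)" for j l
      using cube_functionD(1)[OF cube_function_transformed[OF F]] .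
    have nn: "integral unit_cube (\<lambda>x. (transformed F j s x)\<^sup>2) \<ge> 0" for j
      by (intro Henstock_Kurzweil_Integration.integral_nonneg integrable_continuous continuous_intros cont) auto
    let ?a = "\<lambda>m. cmod (ft (transformed F i 0) (?S *v real_vec m)) * norm (?S *v real_vec m) ^ s"
    let ?b = "\<lambda>m. 1 / norm (?S *v real_vec m) ^ s"
    \<comment> \<open>As u_j \<ge> 1, the dilation only enlarges the coordinates of c B m, and c0
      bounds the inverse of B.\<close>
    have norm_S: "c / c0 * norm (real_vec m :: real^'n) \<le> norm (?S *v real_vec m)" for m
    proof -
      have "norm (c *\<^sub>R (B *v real_vec m)) \<le> norm (?S *v real_vec m)"
      proof (rule norm_le_componentwise_cart)
        fix j
        have "\<bar>c * (B *v real_vec m) $ j\<bar> * 1 \<le> \<bar>c * (B *v real_vec m) $ j\<bar> * u $ j"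
          by (intro mult_left_mono u1) simp
        then show "norm ((c *\<^sub>R (B *v real_vec m)) $ j) \<le> norm ((?S *v real_vec m) $ j)"
          using u1[of j] by (simp add: scaled_frolov_apply dilation_def c_def abs_mult mult_ac)
      qed
      moreover have "norm (real_vec m :: real^'n) \<le> norm (B *v real_vec m) * c0"
        using c0(2)[of "B *v real_vec m"] by (simp add: matrix_vector_mul_assoc matrix_inv_mult[OF B])
      then have "c / c0 * norm (real_vec m :: real^'n) \<le> c / c0 * (norm (B *v real_vec m) * c0)"
        using c c0(1) by (intro mult_left_mono) auto
      ultimately show ?thesis using c c0(1) by simp
    qed
    have pos: "norm (?S *v real_vec m) > 0" if "m \<in> A" for m
    proof -
      have "m \<noteq> 0" using that A(2) by blast
      then have "real_vec m \<noteq> (0 :: real^'n)" by (auto simp: real_vec_def vec_eq_iff)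
      then have "0 < c / c0 * norm (real_vec m :: real^'n)" using c c0(1) by simp
      then show ?thesis using norm_S[of m] by linarith
    qed
    have "(\<Sum>m\<in>A. cmod (ft (transformed F i 0) (?S *v real_vec m)))\<^sup>2 = (\<Sum>m\<in>A. ?a m * ?b m)\<^sup>2"
      using pos by (intro arg_cong[where f="\<lambda>x. x\<^sup>2"] sum.cong refl) (simp add: less_imp_neq)
    also have "\<dots> \<le> (\<Sum>m\<in>A. (?a m)\<^sup>2) * (\<Sum>m\<in>A. (?b m)\<^sup>2)"
      by (rule Cauchy_Schwarz_ineq_sum)
    also have "\<dots> \<le> (?d ^ s * (C1 * ?T)) * (c0 ^ (2 * s) / c ^ (2 * s) * Z)"
    proof (rule mult_mono)
      have "(?a m)\<^sup>2 \<le> ?d ^ s * (\<Sum>j\<in>UNIV. (cmod (ft (transformed F j s) (?S *v real_vec m)))\<^sup>2)" for m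
      proof -
        let ?\<xi> = "?S *v real_vec m"
        \<comment> \<open>A coordinate of maximal modulus, so that |\<xi>|^2 \<le> d
          |\<xi>_j|^2.\<close>
        obtain j where j: "\<And>k. \<bar>?\<xi> $ k\<bar> \<le> \<bar>?\<xi> $ j\<bar>"
        proof -
          have "Max (range (\<lambda>k. \<bar>?\<xi> $ k\<bar>)) \<in> range (\<lambda>k. \<bar>?\<xi> $ k\<bar>)" by (intro Max_in) auto
          then obtain j where "Max (range (\<lambda>k. \<bar>?\<xi> $ k\<bar>)) = \<bar>?\<xi> $ j\<bar>" by blast
          then show ?thesis by (intro that[of j]) (metis Max_ge finite_imageI finite rangeI)
        qed
        have "(norm ?\<xi>)\<^sup>2 = (\<Sum>k\<in>UNIV. \<bar>?\<xi> $ k\<bar>\<^sup>2)"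
          by (simp add: norm_vec_def L2_set_def sum_nonneg)
        also have "\<dots> \<le> (\<Sum>k::'n\<in>UNIV. \<bar>?\<xi> $ j\<bar>\<^sup>2)" by (intro sum_mono power_mono j) simp
        finally have "(norm ?\<xi>)\<^sup>2 \<le> ?d * \<bar>?\<xi> $ j\<bar>\<^sup>2" by simp
        then have "((norm ?\<xi>)\<^sup>2) ^ s \<le> (?d * \<bar>?\<xi> $ j\<bar>\<^sup>2) ^ s" by (rule power_mono) simp
        then have "(norm ?\<xi> ^ s)\<^sup>2 \<le> ?d ^ s * \<bar>?\<xi> $ j\<bar> ^ (2 * s)"
          unfolding power_mult_distrib by (simp only: power_mult[symmetric] mult.commute)
        then have "(?a m)\<^sup>2 \<le> (cmod (ft (transformed F i 0) ?\<xi>))\<^sup>2 * (?d ^ s * \<bar>?\<xi> $ j\<bar> ^ (2 * s))"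
          unfolding power_mult_distrib by (intro mult_left_mono) auto
        also have "\<dots> = ?d ^ s * (\<bar>?\<xi> $ j\<bar> ^ (2 * s) * (cmod (ft (transformed F j 0) ?\<xi>))\<^sup>2)"
          unfolding g[of j] by (simp only: mult_ac)
        also have "\<dots> \<le> ?d ^ s * (cmod (ft (transformed F j s) ?\<xi>))\<^sup>2"
          by (intro mult_left_mono fourier_decay[OF F]) simp
        also have "\<dots> \<le> ?d ^ s * (\<Sum>j\<in>UNIV. (cmod (ft (transformed F j s) ?\<xi>))\<^sup>2)"
          by (intro mult_left_mono member_le_sum) auto
        finally show ?thesis .
      qed
      then have "(\<Sum>m\<in>A. (?a m)\<^sup>2) \<le> (\<Sum>m\<in>A. ?d ^ s * (\<Sum>j\<in>UNIV. (cmod (ft (transformed F j s) (?S *v real_vec m)))\<^sup>2))"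
        by (rule sum_mono)
      also have "\<dots> = ?d ^ s * (\<Sum>j\<in>UNIV. \<Sum>m\<in>A. (cmod (ft (transformed F j s) (?S *v real_vec m)))\<^sup>2)"
        by (subst sum.swap) (simp only: sum_distrib_left)
      also have "\<dots> \<le> ?d ^ s * (\<Sum>j\<in>UNIV. C1 * integral unit_cube (\<lambda>x. (transformed F j s x)\<^sup>2))"
      proof (intro mult_left_mono sum_mono)
        fix j
        have "(\<Sum>m\<in>A. (cmod (ft (transformed F j s) (?S *v real_vec m)))\<^sup>2) \<le>
            (real n * (2 * K + 3) ^ CARD('n)) / \<bar>det ?S\<bar> * integral unit_cube (\<lambda>x. (transformed F j s x)\<^sup>2)"
          by (rule lattice_rule_bessel[OF inv cube_function_transformed[OF F] A(1)])
            (use card_node_set[OF B n u, folded K_def] in blast)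
        also have "\<dots> \<le> C1 * integral unit_cube (\<lambda>x. (transformed F j s x)\<^sup>2)"
        proof (rule mult_right_mono[OF _ nn])
          have "1 \<le> (\<Prod>j\<in>UNIV. u $ j)" by (intro prod_ge_1 u1)
          then have "real n * \<bar>det B\<bar> * 1 \<le> real n * \<bar>det B\<bar> * \<bar>\<Prod>j\<in>UNIV. u $ j\<bar>" by (intro mult_left_mono) auto
          then have d: "real n * \<bar>det B\<bar> \<le> \<bar>det ?S\<bar>" by (simp add: det_scaled_frolov[OF n] abs_mult mult_ac)
          have "real n * (2 * K + 3) ^ CARD('n) / \<bar>det ?S\<bar> \<le> real n * (2 * K + 3) ^ CARD('n) / (real n * \<bar>det B\<bar>)"
          proof (rule divide_left_mono[OF d])
            show "0 \<le> real n * (2 * K + 3) ^ CARD('n)" using K by simp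
            have "0 < real n * \<bar>det B\<bar>" using n detB by simp
            moreover from this have "0 < \<bar>det ?S\<bar>" using d by linarith
            ultimately show "0 < \<bar>det ?S\<bar> * (real n * \<bar>det B\<bar>)" by (rule mult_pos_pos[rotated])
          qed
          then show "real n * (2 * K + 3) ^ CARD('n) / \<bar>det ?S\<bar> \<le> C1" using n by (simp add: C1_def)
        qed
        finally show "(\<Sum>m\<in>A. (cmod (ft (transformed F j s) (?S *v real_vec m)))\<^sup>2) \<le> C1 * integral unit_cube (\<lambda>x. (transformed F j s x)\<^sup>2)" .
      qed simp
      also have "\<dots> = ?d ^ s * (C1 * ?T)" by (simp only: sum_distrib_left)
      finally show "(\<Sum>m\<in>A. (?a m)\<^sup>2) \<le> ?d ^ s * (C1 * ?T)" .
      have "(\<Sum>m\<in>A. (?b m)\<^sup>2) \<le> (\<Sum>m\<in>A. c0 ^ (2 * s) / c ^ (2 * s) * (1 / norm (real_vec m :: real^'n) ^ (2 * s)))"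
      proof (rule sum_mono)
        fix m assume m: "m \<in> A"
        have "m \<noteq> 0" using m A(2) by blast
        then have "real_vec m \<noteq> (0 :: real^'n)" by (auto simp: real_vec_def vec_eq_iff)
        then have p: "0 < c / c0 * norm (real_vec m :: real^'n)" using c c0(1) by simp
        have "(?b m)\<^sup>2 = 1 / norm (?S *v real_vec m) ^ (2 * s)"
          by (simp add: power_divide power_mult[symmetric] mult.commute)
        also have "\<dots> \<le> 1 / (c / c0 * norm (real_vec m :: real^'n)) ^ (2 * s)"
        proof (rule frac_le)
          show "0 < (c / c0 * norm (real_vec m :: real^'n)) ^ (2 * s)" using p by (rule zero_less_power)
          show "(c / c0 * norm (real_vec m :: real^'n)) ^ (2 * s) \<le> norm (?S *v real_vec m) ^ (2 * s)"
            by (intro power_mono norm_S less_imp_le[OF p])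
        qed auto
        also have "\<dots> = c0 ^ (2 * s) / c ^ (2 * s) * (1 / norm (real_vec m :: real^'n) ^ (2 * s))"
          by (simp add: power_mult_distrib power_divide)
        finally show "(?b m)\<^sup>2 \<le> c0 ^ (2 * s) / c ^ (2 * s) * (1 / norm (real_vec m :: real^'n) ^ (2 * s))" .
      qed
      also have "\<dots> \<le> c0 ^ (2 * s) / c ^ (2 * s) * Z"
        unfolding sum_distrib_left[symmetric] using c c0(1) by (intro mult_left_mono Z(2) A) auto
      finally show "(\<Sum>m\<in>A. (?b m)\<^sup>2) \<le> c0 ^ (2 * s) / c ^ (2 * s) * Z" .
      show "0 \<le> ?d ^ s * (C1 * ?T)" using C1 nn by (intro mult_nonneg_nonneg sum_nonneg) auto
      show "0 \<le> (\<Sum>m\<in>A. (?b m)\<^sup>2)" by (simp add: sum_nonneg)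
    qed
    also have "\<dots> = (C * (1 / c ^ s) * sqrt ?T)\<^sup>2"
    proof -
      have "C\<^sup>2 = ?d ^ s * C1 * (c0 ^ (2 * s) * Z)" unfolding C_def using C1 Z(1) c0(1) by simp
      moreover have "(sqrt ?T)\<^sup>2 = ?T" using nn by (simp add: sum_nonneg)
      ultimately show ?thesis
        by (simp add: power_mult_distrib power_divide power_mult[symmetric] mult_ac)
    qed
    finally have "(\<Sum>m\<in>A. cmod (ft (transformed F i 0) (?S *v real_vec m))) \<le> C * (1 / c ^ s) * sqrt ?T"
    proof (rule power2_le_imp_le)
      show "0 \<le> C * (1 / c ^ s) * sqrt ?T"
        by (intro mult_nonneg_nonneg \<open>C \<ge> 0\<close> real_sqrt_ge_zero sum_nonneg nn) (use c in simp)
    qed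
    also have "1 / c ^ s = real n powr (- real s / ?d)"
    proof -
      have "c ^ s = c powr real s" using c by (simp add: powr_realpow)
      then show ?thesis by (simp add: c_def powr_powr powr_minus divide_inverse mult_ac)
    qed
    finally show "(\<Sum>m\<in>A. cmod (ft (transformed F i 0) (?S *v real_vec m))) \<le> C * real n powr (- real s / ?d) * sqrt ?T" .
  qed
qed

end

section \<open>Passage to Sobolev functions and to random dilations and shifts\<close>

lemma frolov_invertible: "frolov_matrix B \<Longrightarrow> invertible B"
  by (simp add: frolov_matrix_def)

lemma borel_measurable_vec_lambda:
  fixes f :: "'a \<Rightarrow> 'n::finite \<Rightarrow> real"
  assumes "\<And>i. (\<lambda>x. f x i) \<in> borel_measurable M"
  shows "(\<lambda>x. \<chi> i. f x i) \<in> borel_measurable M"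
  unfolding borel_measurable_euclidean_space[of "\<lambda>x. \<chi> i. f x i"]
  using assms by (auto simp: Basis_vec_def inner_axis)

text \<open>Independence makes the law of the pair the product of its uniform marginals. The shift
  cube has volume one; the dilation cube in general has not, hence the division.\<close>

lemma random_dilation_shift_nn_integral:
  fixes U V :: "'w \<Rightarrow> real^'n::finite" and h :: "(real^'n) \<times> (real^'n) \<Rightarrow> ennreal"
  assumes R: "random_dilation_shift M U V" and h [measurable]: "h \<in> borel_measurable (borel \<Otimes>\<^sub>M borel)"
  shows "(\<integral>\<^sup>+\<omega>. h (U \<omega>, V \<omega>) \<partial>M) =
    (\<integral>\<^sup>+u. (\<integral>\<^sup>+v. h (u, v) * indicator unit_cube v \<partial>lborel) * indicator dilation_cube u \<partial>lborel)
      / emeasure lborel (dilation_cube :: (real^'n) set)"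
proof -
  interpret prob_space M using R by (simp add: random_dilation_shift_def)
  have dU: "distr M borel U = uniform_measure lborel dilation_cube" and dV: "distr M borel V = uniform_measure lborel unit_cube"
    and ind: "indep_var borel U borel V"
    using R by (auto simp: random_dilation_shift_def)
  have rv [measurable]: "U \<in> borel_measurable M" "V \<in> borel_measurable M"
    and dUV: "distr M borel U \<Otimes>\<^sub>M distr M borel V = distr M (borel \<Otimes>\<^sub>M borel) (\<lambda>\<omega>. (U \<omega>, V \<omega>))"
    using ind by (auto simp: indep_var_distribution_eq)
  interpret V: prob_space "distr M borel V" by (rule prob_space_distr) simp
  have Q: "emeasure lborel (unit_cube :: (real^'n) set) = 1"
    using emeasure_eq_ennreal_measure[of lborel "unit_cube :: (real^'n) set"] by (simp add: emeasure_lborel_cbox_eq)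
  have "(\<integral>\<^sup>+\<omega>. h (U \<omega>, V \<omega>) \<partial>M) = (\<integral>\<^sup>+x. h x \<partial>distr M (borel \<Otimes>\<^sub>M borel) (\<lambda>\<omega>. (U \<omega>, V \<omega>)))"
    by (rule nn_integral_distr[symmetric]) measurable
  also have "\<dots> = (\<integral>\<^sup>+u. (\<integral>\<^sup>+v. h (u, v) \<partial>distr M borel V) \<partial>distr M borel U)"
    unfolding dUV[symmetric] by (rule V.nn_integral_fst[symmetric]) (simp cong: measurable_cong_sets)
  also have "\<dots> = (\<integral>\<^sup>+u. (\<integral>\<^sup>+v. h (u, v) * indicator unit_cube v \<partial>lborel) \<partial>distr M borel U)"
  proof (rule nn_integral_cong)
    fix u
    have "(\<integral>\<^sup>+v. h (u, v) \<partial>distr M borel V) = (\<integral>\<^sup>+v. h (u, v) * indicator unit_cube v \<partial>lborel) / emeasure lborel (unit_cube :: (real^'n) set)"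
      unfolding dV by (rule nn_integral_uniform_measure) auto
    then show "(\<integral>\<^sup>+v. h (u, v) \<partial>distr M borel V) = (\<integral>\<^sup>+v. h (u, v) * indicator unit_cube v \<partial>lborel)"
      unfolding Q by (simp add: divide_ennreal_def)
  qed
  also have "\<dots> = (\<integral>\<^sup>+u. (\<integral>\<^sup>+v. h (u, v) * indicator unit_cube v \<partial>lborel) * indicator dilation_cube u \<partial>lborel)
      / emeasure lborel (dilation_cube :: (real^'n) set)"
    unfolding dU
  proof (rule nn_integral_uniform_measure)
    show "(\<lambda>u. \<integral>\<^sup>+v. h (u, v) * indicator unit_cube v \<partial>lborel) \<in> borel_measurable lborel"
      by measurable
  qed simp
  finally show ?thesis .
qed

context smooth_step begin

lemma integral_pullback:
  fixes f :: "real^'n::finite \<Rightarrow> real"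
  assumes f: "continuous_on unit_cube f"
  shows "integral unit_cube (pullback f) = integral unit_cube f"
proof -
  \<comment> \<open>\<open>clamp\<close> extends f to a continuous function on the whole space, as
    \<open>integral_Psi\<close> requires; \<Psi> takes values in the cube, so the pullback is
    unchanged.\<close>
  let ?f = "\<lambda>x. f (clamp (vec 0) (vec 1) x)"
  have "pullback f = (\<lambda>x. ?f (Psi \<psi> x) * Psi_det \<psi> x)"
    by (intro ext) (simp only: pullback_def clamp_cancel_cbox[OF Psi_in_cube])
  then have "integral unit_cube (pullback f) = integral unit_cube ?f"
    using integral_Psi[OF clamp_continuous_on[OF f]] by simp
  also have "\<dots> = integral unit_cube f"
    by (rule Henstock_Kurzweil_Integration.integral_cong) (simp only: clamp_cancel_cbox)
  finally show ?thesis .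
qed

text \<open>The rule is the pointwise limit of the finite sums q N, which are measurable through the
  explicit formula T for the nodes. For fixed (u, v) the sequence is eventually constant.\<close>

lemma quadrature_measurable:
  fixes B :: "real^'n::finite^'n"
  assumes B: "invertible B" and n: "n \<ge> 1" and f: "continuous_on unit_cube f"
  shows "(\<lambda>(u, v). quadrature \<psi> (scaled_frolov B n u) v f) \<in> borel_measurable (borel \<Otimes>\<^sub>M borel)"
proof -
  let ?g = "pullback f"
  note g = cube_function_pullback[OF f]
  define T where "T = (\<lambda>u w. \<chi> j. (dual_matrix B *v w) $ j / dilation n u $ j)"
  define A where "A = (\<lambda>N::nat. {m::int^'n. \<forall>i. \<bar>m $ i\<bar> \<le> int N})"
  define q where "q = (\<lambda>N (u, v). 1 / \<bar>det (scaled_frolov B n u)\<bar> * (\<Sum>m\<in>A N. ?g (T u (real_vec m + v))))"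
  have [measurable]: "?g \<in> borel_measurable borel"
    by (intro borel_measurable_continuous_onI cube_functionD(1)[OF g])
  have [measurable]: "(\<lambda>x::real^'n. x $ j) \<in> borel_measurable borel" for j
    by (intro borel_measurable_continuous_onI continuous_intros)
  have [measurable]: "(\<lambda>w::real^'n. (dual_matrix B *v (real_vec m + w)) $ j) \<in> borel_measurable borel" for m j
    by (intro borel_measurable_continuous_onI continuous_intros
        continuous_on_compose2[OF matrix_vector_mult_linear_continuous_on[of UNIV "dual_matrix B"]]) auto
  have [measurable]: "(\<lambda>x::(real^'n) \<times> (real^'n). T (fst x) (real_vec m + snd x)) \<in> borel_measurable (borel \<Otimes>\<^sub>M borel)" for m
    unfolding T_def dilation_def vector_scaleR_component
    by (intro borel_measurable_vec_lambda borel_measurable_divide borel_measurable_times) measurable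
  have q_meas: "q N \<in> borel_measurable (borel \<Otimes>\<^sub>M borel)" for N
    unfolding q_def split_beta det_scaled_frolov[OF n] by measurable
  have lim: "(\<lambda>N. q N x) \<longlonglongrightarrow> (case x of (u, v) \<Rightarrow> quadrature \<psi> (scaled_frolov B n u) v f)" for x
  proof -
    obtain u v where x: "x = (u, v)" by fastforce
    show ?thesis
    proof (cases "\<exists>j. u $ j = 0")
      \<comment> \<open>A degenerate dilation has determinant zero; as division by zero gives 0,
        both sides are 0 whatever the nodes are.\<close>
      case True
      then have "(\<Prod>j\<in>UNIV. u $ j) = 0" by (intro prod_zero) auto
      then have "det (scaled_frolov B n u) = 0" by (simp add: det_scaled_frolov[OF n])
      then show ?thesis by (simp add: x q_def quadrature_def)
    next
      case False
      then have u: "\<And>j. u $ j \<noteq> 0" by blast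
      have inv: "invertible (scaled_frolov B n u)" by (rule invertible_scaled_frolov[OF B n u])
      have T: "T u w = dual_matrix (scaled_frolov B n u) *v w" for w
        unfolding dual_scaled_frolov[OF B n u] T_def ..
      obtain R where R: "\<And>w. R < norm w \<Longrightarrow> ?g (dual_matrix (scaled_frolov B n u) *v w) = 0"
        using lattice_support[OF inv g] by blast
      have "q N x = quadrature \<psi> (scaled_frolov B n u) v f" if N: "N \<ge> nat \<lceil>R + norm v\<rceil>" for N
      proof -
        have "?g (T u (real_vec m + v)) = 0" if m: "m \<notin> A N" for m
          unfolding T
        proof (rule R)
          obtain i where "int N < \<bar>m $ i\<bar>" using m by (auto simp: A_def not_le)
          then have "real N < \<bar>real_vec m $ i\<bar>" by (simp add: real_vec_def)
          also have "\<dots> \<le> norm (real_vec m :: real^'n)" by (rule component_le_norm_cart)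
          finally have "R + norm v < norm (real_vec m :: real^'n)" using N by linarith
          then show "R < norm (real_vec m + v)" using norm_diff_ineq[of "real_vec m :: real^'n" v] by linarith
        qed
        then have "(\<Sum>\<^sub>\<infinity>m. ?g (T u (real_vec m + v))) = (\<Sum>\<^sub>\<infinity>m\<in>A N. ?g (T u (real_vec m + v)))"
          by (intro infsum_cong_neutral) auto
        also have "\<dots> = (\<Sum>m\<in>A N. ?g (T u (real_vec m + v)))"
          unfolding A_def by (rule infsum_finite[OF finite_bounded_int_vec])
        finally show ?thesis
          by (simp add: x q_def quadrature_eq_lattice_rule lattice_rule_def periodize_def T)
      qed
      then have "eventually (\<lambda>N. q N x = quadrature \<psi> (scaled_frolov B n u) v f) sequentially"
        unfolding eventually_sequentially by blast
      then show ?thesis unfolding x prod.case by (rule tendsto_eventually)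
    qed
  qed
  show ?thesis by (rule borel_measurable_LIMSEQ_real[OF lim q_meas])
qed

text \<open>The bounds for the approximants are uniform and their transforms converge pointwise, so
  Fatou's lemma carries the bound over to f.\<close>

lemma tail_bound:
  obtains C where "C \<ge> 0" "\<And>(f :: real^'n::finite \<Rightarrow> real) n. f \<in> sobolev s \<Longrightarrow> n \<ge> 1 \<Longrightarrow>
    (\<integral>\<^sup>+\<xi>. indicator {\<xi>. real n \<le> (\<Prod>j\<in>UNIV. \<bar>\<xi> $ j\<bar>)} \<xi> * ennreal ((cmod (ft (pullback f) \<xi>))\<^sup>2) \<partial>lborel)
    \<le> ennreal (C * real n powr (- 2 * real s / real CARD('n)) * (sobolev_norm s f)\<^sup>2)"
proof -
  obtain C where C: "C \<ge> 0" "\<And>f :: real^'n \<Rightarrow> real. f \<in> sobolev s \<Longrightarrow> \<exists>F. (\<forall>k. smooth_family (F k) \<and>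
      (\<Sum>j\<in>UNIV. integral unit_cube (\<lambda>x. (transformed (F k) j s x)\<^sup>2)) \<le> C * (sobolev_norm s f)\<^sup>2) \<and>
      (\<forall>\<xi> j. (\<lambda>k. ft (transformed (F k) j 0) \<xi>) \<longlonglongrightarrow> ft (pullback f) \<xi>)"
    by (rule sobolev_fourier_approximation[where s=s]) blast
  show ?thesis
  proof (rule that[of "2 * C"])
    show "2 * C \<ge> 0" using C(1) by simp
    fix f :: "real^'n \<Rightarrow> real" and n :: nat assume f: "f \<in> sobolev s" and n: "n \<ge> 1"
    define D where "D = {\<xi>::real^'n. real n \<le> (\<Prod>j\<in>UNIV. \<bar>\<xi> $ j\<bar>)}"
    have [measurable]: "D \<in> sets borel"
      unfolding D_def by (intro borel_closed closed_Collect_le continuous_intros)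
    \<comment> \<open>Any coordinate serves: the limit is the same for all of them.\<close>
    fix i0 :: 'n
    from C(2)[OF f] obtain F where sm: "\<And>k. smooth_family (F k)"
      and bd: "\<And>k. (\<Sum>j\<in>UNIV. integral unit_cube (\<lambda>x. (transformed (F k) j s x)\<^sup>2)) \<le> C * (sobolev_norm s f)\<^sup>2"
      and lim: "\<And>\<xi>. (\<lambda>k. ft (transformed (F k) i0 0) \<xi>) \<longlonglongrightarrow> ft (pullback f) \<xi>" by blast
    let ?u = "\<lambda>k \<xi>. indicator D \<xi> * ennreal ((cmod (ft (transformed (F k) i0 0) \<xi>))\<^sup>2)"
    let ?p = "real n powr (- 2 * real s / real CARD('n))"
    have [measurable]: "ft (transformed (F k) i0 0) \<in> borel_measurable borel" for k
      by (rule ft_measurable[OF cube_functionD(1)[OF cube_function_transformed[OF sm]]])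
    have "(\<lambda>k. ?u k \<xi>) \<longlonglongrightarrow> indicator D \<xi> * ennreal ((cmod (ft (pullback f) \<xi>))\<^sup>2)" for \<xi>
    proof -
      have "(\<lambda>k. ennreal ((cmod (ft (transformed (F k) i0 0) \<xi>))\<^sup>2)) \<longlonglongrightarrow> ennreal ((cmod (ft (pullback f) \<xi>))\<^sup>2)"
        by (intro tendsto_ennrealI tendsto_intros lim)
      then show ?thesis by (cases "\<xi> \<in> D") simp_all
    qed
    then have "liminf (\<lambda>k. ?u k \<xi>) = indicator D \<xi> * ennreal ((cmod (ft (pullback f) \<xi>))\<^sup>2)" for \<xi>
      by (intro lim_imp_Liminf) auto
    then have "(\<integral>\<^sup>+\<xi>. indicator D \<xi> * ennreal ((cmod (ft (pullback f) \<xi>))\<^sup>2) \<partial>lborel) = (\<integral>\<^sup>+\<xi>. liminf (\<lambda>k. ?u k \<xi>) \<partial>lborel)"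
      by simp
    also have "\<dots> \<le> liminf (\<lambda>k. \<integral>\<^sup>+\<xi>. ?u k \<xi> \<partial>lborel)"
      by (rule nn_integral_liminf) measurable
    also have "\<dots> \<le> liminf (\<lambda>k::nat. ennreal (2 * C * ?p * (sobolev_norm s f)\<^sup>2))"
    proof (intro Liminf_mono always_eventually allI)
      fix k
      have "(\<integral>\<^sup>+\<xi>. ?u k \<xi> \<partial>lborel) \<le> ennreal (2 * ?p * (\<Sum>j\<in>UNIV. integral unit_cube (\<lambda>x. (transformed (F k) j s x)\<^sup>2)))"
        unfolding D_def by (rule tail_bound_smooth[OF sm n])
      also have "\<dots> \<le> ennreal (2 * ?p * (C * (sobolev_norm s f)\<^sup>2))"
        by (intro ennreal_leI mult_left_mono bd) simp
      finally show "(\<integral>\<^sup>+\<xi>. ?u k \<xi> \<partial>lborel) \<le> ennreal (2 * C * ?p * (sobolev_norm s f)\<^sup>2)"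
        by (simp only: mult_ac)
    qed
    also have "\<dots> = ennreal (2 * C * ?p * (sobolev_norm s f)\<^sup>2)" by (rule Liminf_const) simp
    finally show "(\<integral>\<^sup>+\<xi>. indicator {\<xi>. real n \<le> (\<Prod>j\<in>UNIV. \<bar>\<xi> $ j\<bar>)} \<xi> * ennreal ((cmod (ft (pullback f) \<xi>))\<^sup>2) \<partial>lborel)
      \<le> ennreal (2 * C * ?p * (sobolev_norm s f)\<^sup>2)" unfolding D_def .
  qed
qed

lemma sobolev_continuous: "f \<in> sobolev s \<Longrightarrow> continuous_on unit_cube f"
  by (simp add: sobolev_def)

lemma sobolev_norm_nonneg: "sobolev_norm s f \<ge> 0"
  by (simp add: sobolev_norm_def sum_nonneg)

text \<open>Each finite sum over nonzero frequencies passes from the approximants to f with the same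
  bound, and \<open>lattice_rule_sup\<close> asks only for a common bound on finite sums.\<close>

lemma uniform_error_bound:
  fixes B :: "real^'n::finite^'n"
  assumes s: "real s > real CARD('n) / 2" and B: "invertible B"
  obtains C where "C \<ge> 0" "\<And>(f :: real^'n \<Rightarrow> real) n u v. f \<in> sobolev s \<Longrightarrow> n \<ge> 1 \<Longrightarrow> u \<in> dilation_cube \<Longrightarrow> v \<in> unit_cube \<Longrightarrow>
    \<bar>quadrature \<psi> (scaled_frolov B n u) v f - cube_integral f\<bar> \<le> C * real n powr (- real s / real CARD('n)) * sobolev_norm s f"
proof -
  obtain C1 where C1: "C1 \<ge> 0" "\<And>f :: real^'n \<Rightarrow> real. f \<in> sobolev s \<Longrightarrow> \<exists>F. (\<forall>k. smooth_family (F k) \<and>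
      (\<Sum>j\<in>UNIV. integral unit_cube (\<lambda>x. (transformed (F k) j s x)\<^sup>2)) \<le> C1 * (sobolev_norm s f)\<^sup>2) \<and>
      (\<forall>\<xi> j. (\<lambda>k. ft (transformed (F k) j 0) \<xi>) \<longlonglongrightarrow> ft (pullback f) \<xi>)"
    by (rule sobolev_fourier_approximation[where s=s]) blast
  obtain C2 where C2: "C2 \<ge> 0" "\<And>F n u i A. smooth_family F \<Longrightarrow> n \<ge> 1 \<Longrightarrow> u \<in> dilation_cube \<Longrightarrow> finite A \<Longrightarrow> 0 \<notin> A \<Longrightarrow>
    (\<Sum>m\<in>A. cmod (ft (transformed F i 0) (scaled_frolov B n u *v real_vec m))) \<le>
      C2 * real n powr (- real s / real CARD('n)) * sqrt (\<Sum>j\<in>UNIV. integral unit_cube (\<lambda>x. (transformed F j s x)\<^sup>2))"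
    by (rule lattice_sum_bound_smooth[OF s B]) blast
  show ?thesis
  proof (rule that[of "C2 * sqrt C1"])
    show "C2 * sqrt C1 \<ge> 0" using C1 C2 by simp
    fix f :: "real^'n \<Rightarrow> real" and n :: nat and u v :: "real^'n"
    assume f: "f \<in> sobolev s" and n: "n \<ge> 1" and u: "u \<in> dilation_cube" and v: "v \<in> unit_cube"
    let ?S = "scaled_frolov B n u" and ?p = "real n powr (- real s / real CARD('n))"
    note fc = sobolev_continuous[OF f]
    have "u $ j \<noteq> 0" for j using dilation_cubeD(1)[OF u, of j] by auto
    then have inv: "invertible ?S" by (rule invertible_scaled_frolov[OF B n])
    fix i0 :: 'n
    from C1(2)[OF f] obtain F where sm: "\<And>k. smooth_family (F k)"
      and bd: "\<And>k. (\<Sum>j\<in>UNIV. integral unit_cube (\<lambda>x. (transformed (F k) j s x)\<^sup>2)) \<le> C1 * (sobolev_norm s f)\<^sup>2"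
      and lim: "\<And>\<xi>. (\<lambda>k. ft (transformed (F k) i0 0) \<xi>) \<longlonglongrightarrow> ft (pullback f) \<xi>" by blast
    have sum: "(\<Sum>m\<in>A. cmod (ft (pullback f) (?S *v real_vec m))) \<le> C2 * sqrt C1 * ?p * sobolev_norm s f" if A: "finite A" "0 \<notin> A" for A
    proof (rule LIMSEQ_le_const2)
      show "(\<lambda>k. \<Sum>m\<in>A. cmod (ft (transformed (F k) i0 0) (?S *v real_vec m))) \<longlonglongrightarrow> (\<Sum>m\<in>A. cmod (ft (pullback f) (?S *v real_vec m)))"
        by (intro tendsto_intros lim)
      have "(\<Sum>m\<in>A. cmod (ft (transformed (F k) i0 0) (?S *v real_vec m))) \<le> C2 * sqrt C1 * ?p * sobolev_norm s f" for k
      proof -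
        have "(\<Sum>m\<in>A. cmod (ft (transformed (F k) i0 0) (?S *v real_vec m))) \<le>
            C2 * ?p * sqrt (\<Sum>j\<in>UNIV. integral unit_cube (\<lambda>x. (transformed (F k) j s x)\<^sup>2))"
          by (rule C2(2)[OF sm n u A])
        also have "\<dots> \<le> C2 * ?p * sqrt (C1 * (sobolev_norm s f)\<^sup>2)"
          using C2(1) by (intro mult_left_mono real_sqrt_le_mono bd) simp
        also have "sqrt (C1 * (sobolev_norm s f)\<^sup>2) = sqrt C1 * sobolev_norm s f"
          by (simp add: real_sqrt_mult sobolev_norm_nonneg)
        finally show ?thesis by (simp only: mult_ac)
      qed
      then show "\<exists>N. \<forall>k\<ge>N. (\<Sum>m\<in>A. cmod (ft (transformed (F k) i0 0) (?S *v real_vec m))) \<le> C2 * sqrt C1 * ?p * sobolev_norm s f"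
        by blast
    qed
    have "\<bar>lattice_rule ?S (pullback f) v - integral unit_cube (pullback f)\<bar> \<le> C2 * sqrt C1 * ?p * sobolev_norm s f"
      by (rule lattice_rule_sup[OF inv cube_function_pullback[OF fc] sum v])
    then show "\<bar>quadrature \<psi> ?S v f - cube_integral f\<bar> \<le> C2 * sqrt C1 * ?p * sobolev_norm s f"
      by (simp only: quadrature_eq_lattice_rule integral_pullback[OF fc] cube_integral_eq_integral[OF fc])
  qed
qed

text \<open>The rate is the square root of 4/n times the tail bound of order n^(-2s/d). Everything
  is estimated as a nonnegative extended integral, whose finiteness then yields
  integrability.\<close>

lemma randomized_error_bound:
  fixes B :: "real^'n::finite^'n"
  assumes F: "frolov_matrix B"
  obtains C where "C \<ge> 0" "\<And>(f :: real^'n \<Rightarrow> real) n (M :: 'w measure) U V. f \<in> sobolev s \<Longrightarrow> n \<ge> 1 \<Longrightarrow> random_dilation_shift M U V \<Longrightarrow>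
    integrable M (\<lambda>\<omega>. \<bar>quadrature \<psi> (scaled_frolov B n (U \<omega>)) (V \<omega>) f - cube_integral f\<bar>\<^sup>2) \<and>
    sqrt (prob_space.expectation M (\<lambda>\<omega>. \<bar>quadrature \<psi> (scaled_frolov B n (U \<omega>)) (V \<omega>) f - cube_integral f\<bar>\<^sup>2))
      \<le> C * real n powr (- real s / real CARD('n) - 1 / 2) * sobolev_norm s f"
proof -
  note B = frolov_invertible[OF F]
  obtain C1 where C1: "C1 \<ge> 0" "\<And>(f :: real^'n \<Rightarrow> real) n. f \<in> sobolev s \<Longrightarrow> n \<ge> 1 \<Longrightarrow>
    (\<integral>\<^sup>+\<xi>. indicator {\<xi>. real n \<le> (\<Prod>j\<in>UNIV. \<bar>\<xi> $ j\<bar>)} \<xi> * ennreal ((cmod (ft (pullback f) \<xi>))\<^sup>2) \<partial>lborel)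
    \<le> ennreal (C1 * real n powr (- 2 * real s / real CARD('n)) * (sobolev_norm s f)\<^sup>2)"
    by (rule tail_bound[where s=s]) blast
  \<comment> \<open>The volume of the dilation cube, positive because 2^(1/d) > 1; it normalizes the
    average over u.\<close>
  define \<kappa> where "\<kappa> = (\<Prod>b\<in>Basis. (vec (2 powr (1 / real CARD('n))) - vec 1 :: real^'n) \<bullet> b)"
  have two: "(2::real) powr (1 / real CARD('n)) > 1"
    by (rule gr_one_powr) auto
  have comp: "(vec (2 powr (1 / real CARD('n))) - vec 1 :: real^'n) \<bullet> b > 0" if "b \<in> Basis" for b
    using that two by (auto simp: Basis_vec_def inner_axis)
  have \<kappa>: "\<kappa> > 0" unfolding \<kappa>_def by (rule prod_pos) (use comp in blast)
  have vol: "emeasure lborel (dilation_cube :: (real^'n) set) = ennreal \<kappa>"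
    unfolding \<kappa>_def by (rule emeasure_lborel_cbox) (use comp in \<open>auto simp: inner_diff_left less_imp_le\<close>)
  show ?thesis
  proof (rule that[of "sqrt (4 * C1 / \<kappa>)"])
    show "sqrt (4 * C1 / \<kappa>) \<ge> 0" using C1 \<kappa> by simp
    fix f :: "real^'n \<Rightarrow> real" and n :: nat and M :: "'w measure" and U V :: "'w \<Rightarrow> real^'n"
    assume f: "f \<in> sobolev s" and n: "n \<ge> 1" and R: "random_dilation_shift M U V"
    interpret prob_space M using R by (simp add: random_dilation_shift_def)
    have rv [measurable]: "U \<in> borel_measurable M" "V \<in> borel_measurable M"
      using R by (auto simp: random_dilation_shift_def indep_var_distribution_eq)
    note fc = sobolev_continuous[OF f]
    let ?g = "pullback f" and ?R = "sobolev_norm s f"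
    note g = cube_function_pullback[OF fc]
    define e where "e = (\<lambda>(u, v). \<bar>quadrature \<psi> (scaled_frolov B n u) v f - cube_integral f\<bar>\<^sup>2)"
    have "(\<lambda>x. \<bar>(case x of (u, v) \<Rightarrow> quadrature \<psi> (scaled_frolov B n u) v f) - cube_integral f\<bar>\<^sup>2) \<in> borel_measurable (borel \<Otimes>\<^sub>M borel)"
      by (intro borel_measurable_power borel_measurable_abs borel_measurable_diff quadrature_measurable[OF B n fc] borel_measurable_const)
    then have e_meas [measurable]: "e \<in> borel_measurable (borel \<Otimes>\<^sub>M borel)"
      by (simp add: e_def split_beta)
    have e0: "e x \<ge> 0" for x by (simp add: e_def split_beta)
    define X where "X = 4 * C1 * real n powr (- 2 * real s / real CARD('n) - 1) * ?R\<^sup>2"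
    have X0: "X \<ge> 0" using C1 by (simp add: X_def)
    have [measurable]: "ft ?g \<in> borel_measurable borel"
      by (rule ft_measurable[OF cube_functionD(1)[OF g]])
    have "(\<integral>\<^sup>+u. (\<integral>\<^sup>+v. ennreal (e (u, v)) * indicator unit_cube v \<partial>lborel) * indicator dilation_cube u \<partial>lborel) \<le>
       (\<integral>\<^sup>+u. indicator dilation_cube u * (\<integral>\<^sup>+m. ennreal ((cmod (ft ?g (scaled_frolov B n u *v real_vec m)))\<^sup>2) \<partial>count_space (- {0})) \<partial>lborel)"
    proof (rule nn_integral_mono)
      fix u :: "real^'n"
      show "(\<integral>\<^sup>+v. ennreal (e (u, v)) * indicator unit_cube v \<partial>lborel) * indicator dilation_cube u \<le>
        indicator dilation_cube u * (\<integral>\<^sup>+m. ennreal ((cmod (ft ?g (scaled_frolov B n u *v real_vec m)))\<^sup>2) \<partial>count_space (- {0}))"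
      proof (cases "u \<in> dilation_cube")
        case True
        have "u $ j \<noteq> 0" for j using dilation_cubeD(1)[OF True, of j] by auto
        then have inv: "invertible (scaled_frolov B n u)" by (rule invertible_scaled_frolov[OF B n])
        let ?L = "lattice_rule (scaled_frolov B n u) ?g"
        have eL: "e (u, v) = (?L v - integral unit_cube ?g)\<^sup>2" for v
          by (simp only: e_def prod.case power2_abs quadrature_eq_lattice_rule integral_pullback[OF fc] cube_integral_eq_integral[OF fc])
        have "continuous_on unit_cube (\<lambda>v. (?L v - integral unit_cube ?g)\<^sup>2)"
          by (intro continuous_intros continuous_on_subset[OF continuous_lattice_rule[OF inv g]]) auto
        then have "(\<integral>\<^sup>+v. ennreal (e (u, v)) * indicator unit_cube v \<partial>lborel) = ennreal (integral unit_cube (\<lambda>v. (?L v - integral unit_cube ?g)\<^sup>2))"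
          unfolding eL by (rule nn_integral_cube_eq_integral) simp
        also have "\<dots> \<le> (\<integral>\<^sup>+m. ennreal ((cmod (ft ?g (scaled_frolov B n u *v real_vec m)))\<^sup>2) \<partial>count_space (- {0}))"
          by (rule lattice_rule_variance[OF inv g])
        finally show ?thesis using True by simp
      qed simp
    qed
    also have "\<dots> \<le> ennreal (4 / real n) * (\<integral>\<^sup>+\<xi>. indicator {\<xi>. real n \<le> (\<Prod>j\<in>UNIV. \<bar>\<xi> $ j\<bar>)} \<xi> * ennreal ((cmod (ft ?g \<xi>))\<^sup>2) \<partial>lborel)"
      by (rule frolov_average[OF F n]) measurable
    also have "\<dots> \<le> ennreal (4 / real n) * ennreal (C1 * real n powr (- 2 * real s / real CARD('n)) * ?R\<^sup>2)"
      by (intro mult_left_mono C1(2)[OF f n]) simp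
    also have "\<dots> = ennreal X"
    proof -
      have "real n powr (- 2 * real s / real CARD('n) - 1) = real n powr (- 2 * real s / real CARD('n)) / real n"
        using n by (simp add: powr_diff)
      then show ?thesis using C1 by (simp add: X_def ennreal_mult[symmetric])
    qed
    finally have le: "(\<integral>\<^sup>+u. (\<integral>\<^sup>+v. ennreal (e (u, v)) * indicator unit_cube v \<partial>lborel) * indicator dilation_cube u \<partial>lborel) \<le> ennreal X" .
    have "(\<integral>\<^sup>+\<omega>. ennreal (e (U \<omega>, V \<omega>)) \<partial>M) =
        (\<integral>\<^sup>+u. (\<integral>\<^sup>+v. ennreal (e (u, v)) * indicator unit_cube v \<partial>lborel) * indicator dilation_cube u \<partial>lborel) / ennreal \<kappa>"
      unfolding vol[symmetric] by (rule random_dilation_shift_nn_integral[OF R]) measurable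
    also have "\<dots> \<le> ennreal X / ennreal \<kappa>" by (rule divide_right_mono_ennreal[OF le])
    also have "\<dots> = ennreal (X / \<kappa>)" using X0 \<kappa> by (simp add: divide_ennreal)
    finally have le: "(\<integral>\<^sup>+\<omega>. ennreal (e (U \<omega>, V \<omega>)) \<partial>M) \<le> ennreal (X / \<kappa>)" .
    have int: "integrable M (\<lambda>\<omega>. e (U \<omega>, V \<omega>))"
    proof (rule integrableI_nonneg)
      show "(\<integral>\<^sup>+\<omega>. ennreal (e (U \<omega>, V \<omega>)) \<partial>M) < \<infinity>" using le by (rule order.strict_trans1) simp
    qed (auto simp: e0)
    have "expectation (\<lambda>\<omega>. e (U \<omega>, V \<omega>)) \<le> X / \<kappa>"
      using le nn_integral_eq_integral[OF int] e0 X0 \<kappa> by (simp add: ennreal_le_iff)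
    then have "sqrt (expectation (\<lambda>\<omega>. e (U \<omega>, V \<omega>))) \<le> sqrt (X / \<kappa>)" by (rule real_sqrt_le_mono)
    also have "X / \<kappa> = 4 * C1 / \<kappa> * (real n powr (- real s / real CARD('n) - 1 / 2))\<^sup>2 * ?R\<^sup>2"
    proof -
      have "(real n powr (- real s / real CARD('n) - 1 / 2))\<^sup>2 = real n powr (- 2 * real s / real CARD('n) - 1)"
        using n by (simp add: power2_eq_square powr_add[symmetric])
      then show ?thesis by (simp add: X_def)
    qed
    also have "sqrt \<dots> = sqrt (4 * C1 / \<kappa>) * real n powr (- real s / real CARD('n) - 1 / 2) * ?R"
      by (simp only: real_sqrt_mult real_sqrt_abs) (simp add: sobolev_norm_nonneg)
    finally show "integrable M (\<lambda>\<omega>. \<bar>quadrature \<psi> (scaled_frolov B n (U \<omega>)) (V \<omega>) f - cube_integral f\<bar>\<^sup>2) \<and>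
      sqrt (expectation (\<lambda>\<omega>. \<bar>quadrature \<psi> (scaled_frolov B n (U \<omega>)) (V \<omega>) f - cube_integral f\<bar>\<^sup>2))
        \<le> sqrt (4 * C1 / \<kappa>) * real n powr (- real s / real CARD('n) - 1 / 2) * ?R"
      using int by (simp add: e_def)
  qed
qed

end

theorem theorem12:
  fixes s :: nat
    and B :: "real^'n^'n::finite"
    and \<psi> :: "real \<Rightarrow> real"
  assumes "real s > real CARD('n) / 2"
    and "frolov_matrix B"
    and "smooth_real_on UNIV \<psi>"
    and "\<And>t. t < 0 \<Longrightarrow> \<psi> t = 0"
    and "\<And>t. t > 1 \<Longrightarrow> \<psi> t = 1"
    and "diffeomorphism_real {0<..<1} {0<..<1} \<psi>"
  shows "\<exists>c>0. \<forall>n\<ge>1. \<forall>f\<in>sobolev s.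
    (\<forall>(M :: 'w measure) U V. random_dilation_shift M U V \<longrightarrow>
       integrable M (\<lambda>\<omega>. \<bar>quadrature \<psi> (scaled_frolov B n (U \<omega>)) (V \<omega>) f - cube_integral f\<bar>\<^sup>2) \<and>
       sqrt (prob_space.expectation M
         (\<lambda>\<omega>. \<bar>quadrature \<psi> (scaled_frolov B n (U \<omega>)) (V \<omega>) f - cube_integral f\<bar>\<^sup>2))
       \<le> c * real n powr (- real s / real CARD('n) - 1 / 2) * sobolev_norm s f) \<and>
    (SUP (u, v) \<in> dilation_cube \<times> unit_cube.
       ereal \<bar>quadrature \<psi> (scaled_frolov B n u) v f - cube_integral f\<bar>)
     \<le> ereal (c * real n powr (- real s / real CARD('n)) * sobolev_norm s f)"
proof -
  interpret smooth_step \<psi> by unfold_locales (use assms in auto)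
  obtain C1 where C1: "C1 \<ge> 0" "\<And>(f :: real^'n \<Rightarrow> real) n (M :: 'w measure) U V. f \<in> sobolev s \<Longrightarrow> n \<ge> 1 \<Longrightarrow> random_dilation_shift M U V \<Longrightarrow>
    integrable M (\<lambda>\<omega>. \<bar>quadrature \<psi> (scaled_frolov B n (U \<omega>)) (V \<omega>) f - cube_integral f\<bar>\<^sup>2) \<and>
    sqrt (prob_space.expectation M (\<lambda>\<omega>. \<bar>quadrature \<psi> (scaled_frolov B n (U \<omega>)) (V \<omega>) f - cube_integral f\<bar>\<^sup>2))
      \<le> C1 * real n powr (- real s / real CARD('n) - 1 / 2) * sobolev_norm s f"
    by (rule randomized_error_bound[OF assms(2), where s=s]) blast
  obtain C2 where C2: "C2 \<ge> 0" "\<And>(f :: real^'n \<Rightarrow> real) n u v. f \<in> sobolev s \<Longrightarrow> n \<ge> 1 \<Longrightarrow> u \<in> dilation_cube \<Longrightarrow> v \<in> unit_cube \<Longrightarrow>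
    \<bar>quadrature \<psi> (scaled_frolov B n u) v f - cube_integral f\<bar> \<le> C2 * real n powr (- real s / real CARD('n)) * sobolev_norm s f"
    by (rule uniform_error_bound[OF assms(1) frolov_invertible[OF assms(2)]]) blast
  \<comment> \<open>The summand 1 guarantees c > 0 even if both constants are 0.\<close>
  define c where "c = C1 + C2 + 1"
  have c: "c > 0" "C1 \<le> c" "C2 \<le> c" using C1(1) C2(1) by (auto simp: c_def)
  show ?thesis
  proof (intro exI[of _ c] conjI ballI allI impI c(1))
    fix n :: nat and f :: "real^'n \<Rightarrow> real" assume n: "1 \<le> n" and f: "f \<in> sobolev s"
    have mono: "C * real n powr a * sobolev_norm s f \<le> c * real n powr a * sobolev_norm s f" if "C \<le> c" for C a
      using that by (intro mult_right_mono sobolev_norm_nonneg) auto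
    {
      fix M :: "'w measure" and U V :: "'w \<Rightarrow> real^'n"
      assume R: "random_dilation_shift M U V"
      show "integrable M (\<lambda>\<omega>. \<bar>quadrature \<psi> (scaled_frolov B n (U \<omega>)) (V \<omega>) f - cube_integral f\<bar>\<^sup>2)"
        using C1(2)[OF f n R] ..
      show "sqrt (prob_space.expectation M (\<lambda>\<omega>. \<bar>quadrature \<psi> (scaled_frolov B n (U \<omega>)) (V \<omega>) f - cube_integral f\<bar>\<^sup>2))
        \<le> c * real n powr (- real s / real CARD('n) - 1 / 2) * sobolev_norm s f"
        using C1(2)[OF f n R] mono[OF c(2)] by (meson order_trans)
    }
    show "(SUP (u, v) \<in> dilation_cube \<times> unit_cube. ereal \<bar>quadrature \<psi> (scaled_frolov B n u) v f - cube_integral f\<bar>)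
      \<le> ereal (c * real n powr (- real s / real CARD('n)) * sobolev_norm s f)"
    proof (rule SUP_least)
      fix x :: "(real^'n) \<times> (real^'n)" assume "x \<in> dilation_cube \<times> unit_cube"
      then obtain u v where x: "x = (u, v)" "u \<in> dilation_cube" "v \<in> unit_cube" by blast
      have "\<bar>quadrature \<psi> (scaled_frolov B n u) v f - cube_integral f\<bar> \<le> c * real n powr (- real s / real CARD('n)) * sobolev_norm s f"
        using C2(2)[OF f n x(2,3)] mono[OF c(3)] by (meson order_trans)
      then show "(case x of (u, v) \<Rightarrow> ereal \<bar>quadrature \<psi> (scaled_frolov B n u) v f - cube_integral f\<bar>)
         \<le> ereal (c * real n powr (- real s / real CARD('n)) * sobolev_norm s f)"
        by (simp add: x(1))
    qed
  qed
qed

end
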